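(* Let $\mathcal I=\mathbb R_+=[0,\infty)$ and $x_n=\sqrt n$, $n\in\mathbb N$, $X=\{x_n\}_{n=1}^\infty$. If $\alpha_n=-n^{-\varepsilon}$, $n\in\mathbb N$, with $\varepsilon\in[0,1/2)$, then the operator $\mathrm H_{X,\alpha}$ is self-adjoint and not semibounded below in $L^2(\mathcal I)$.
   Context: $W^{2,2}(\mathcal I\setminus X)=\{f\in L^2(\mathcal I): f,f'\in AC_{loc}(\mathcal I\setminus X),\ f''\in L^2(\mathcal I)\}$, and $W^{2,2}_{\mathrm{comp}}(\mathcal I\setminus X)$ is the set of its elements with compact support in $\mathcal I=[0,\infty)$. $\mathrm H_{X,\alpha}$ is the closure in $L^2(\mathcal I)$ of the symmetric operator $-\mathrm d^2/\mathrm dx^2$ with domain $$\{f\in W^{2,2}_{\mathrm{comp}}(\mathcal I\setminus X): f'(0)=0,\ f(x_n+)=f(x_n-),\ f'(x_n+)-f'(x_n-)=\alpha_nf(x_n),\ n\in\mathbb N\}.$$ A symmetric operator $T$ is semibounded below if $(Tf,f)\ge c\|f\|^2$ for all $f\in\operatorname{dom}(T)$ with some $c\in\mathbb R$. *)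

theory Defs
  imports "HOL-Analysis.Analysis"
begin

section \<open>The space of square integrable functions on the half-line\<close>

abbreviation half_line :: "real set" where
  "half_line \<equiv> {0..}"

abbreviation half_line_measure :: "real measure" where
  "half_line_measure \<equiv> lebesgue_on half_line"

text \<open>
  Elements of the Hilbert space are represented by functions; two representatives are identified
  when they agree almost everywhere on the half-line.  Values at negative arguments never matter.
\<close>

definition L2 :: "(real \<Rightarrow> complex) set" where
  "L2 = {f \<in> borel_measurable half_line_measure.
           integrable half_line_measure (\<lambda>x. (cmod (f x))\<^sup>2)}"

definition L2_eq :: "(real \<Rightarrow> complex) \<Rightarrow> (real \<Rightarrow> complex) \<Rightarrow> bool" where
  "L2_eq f g \<longleftrightarrow> (AE x in half_line_measure. f x = g x)"

definition L2_inner :: "(real \<Rightarrow> complex) \<Rightarrow> (real \<Rightarrow> complex) \<Rightarrow> complex" where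
  "L2_inner f g = (\<integral>x. f x * cnj (g x) \<partial>half_line_measure)"

definition L2_norm :: "(real \<Rightarrow> complex) \<Rightarrow> real" where
  "L2_norm f = sqrt (\<integral>x. (cmod (f x))\<^sup>2 \<partial>half_line_measure)"


section \<open>Unbounded operators\<close>

text \<open>
  An operator \<open>T\<close> is given by its graph, the set of all pairs of representatives \<open>(f, g)\<close> with
  \<open>f \<in> dom T\<close> and \<open>T f = g\<close> in \<open>L\<^sup>2\<close>.  Such a graph is closed under changing \<open>f\<close> and \<open>g\<close> on null sets,
  and it is single-valued up to null sets.
\<close>

type_synonym L2_graph = "((real \<Rightarrow> complex) \<times> (real \<Rightarrow> complex)) set"

definition linear_operator :: "L2_graph \<Rightarrow> bool" where
  "linear_operator T \<longleftrightarrow>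
     T \<subseteq> L2 \<times> L2 \<and>
     (\<forall>f g u v. (f, g) \<in> T \<longrightarrow> u \<in> L2 \<longrightarrow> v \<in> L2 \<longrightarrow> L2_eq f u \<longrightarrow> L2_eq g v \<longrightarrow> (u, v) \<in> T) \<and>
     ((\<lambda>x. 0, \<lambda>x. 0) \<in> T) \<and>
     (\<forall>f g u v. (f, g) \<in> T \<longrightarrow> (u, v) \<in> T \<longrightarrow> (\<lambda>x. f x + u x, \<lambda>x. g x + v x) \<in> T) \<and>
     (\<forall>c f g. (f, g) \<in> T \<longrightarrow> (\<lambda>x. c * f x, \<lambda>x. c * g x) \<in> T) \<and>
     (\<forall>f g v. (f, g) \<in> T \<longrightarrow> (f, v) \<in> T \<longrightarrow> L2_eq g v)"

definition densely_defined :: "L2_graph \<Rightarrow> bool" where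
  "densely_defined T \<longleftrightarrow>
     (\<forall>h\<in>L2. \<forall>e>0. \<exists>(f, g)\<in>T. L2_norm (\<lambda>x. h x - f x) < e)"

definition operator_closure :: "L2_graph \<Rightarrow> L2_graph" where
  "operator_closure T =
     {(f, g) \<in> L2 \<times> L2.
        \<forall>e>0. \<exists>(u, v)\<in>T. L2_norm (\<lambda>x. f x - u x) < e \<and> L2_norm (\<lambda>x. g x - v x) < e}"

definition operator_adjoint :: "L2_graph \<Rightarrow> L2_graph" where
  "operator_adjoint T =
     {(h, k) \<in> L2 \<times> L2. \<forall>(f, g)\<in>T. L2_inner g h = L2_inner f k}"

definition self_adjoint :: "L2_graph \<Rightarrow> bool" where
  "self_adjoint T \<longleftrightarrow> linear_operator T \<and> densely_defined T \<and> operator_adjoint T = T"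

text \<open>For symmetric \<open>T\<close> the form \<open>(T f, f)\<close> is real, so taking the real part loses nothing.\<close>

definition semibounded_below :: "L2_graph \<Rightarrow> bool" where
  "semibounded_below T \<longleftrightarrow> (\<exists>c. \<forall>(f, g)\<in>T. Re (L2_inner g f) \<ge> c * (L2_norm f)\<^sup>2)"


section \<open>Sobolev space with point interactions\<close>

definition absolutely_continuous_on :: "real \<Rightarrow> real \<Rightarrow> (real \<Rightarrow> complex) \<Rightarrow> bool" where
  "absolutely_continuous_on a b f \<longleftrightarrow>
     (\<forall>e>0. \<exists>d>0. \<forall>P :: (real \<times> real) set.
        finite P \<longrightarrow>
        (\<forall>(s, t)\<in>P. a \<le> s \<and> s < t \<and> t \<le> b) \<longrightarrow>
        pairwise (\<lambda>(s, t) (s', t'). disjnt {s<..<t} {s'<..<t'}) P \<longrightarrow>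
        (\<Sum>(s, t)\<in>P. t - s) < d \<longrightarrow>
        (\<Sum>(s, t)\<in>P. cmod (f t - f s)) < e)"

definition AC_loc :: "real set \<Rightarrow> (real \<Rightarrow> complex) set" where
  "AC_loc S = {f. \<forall>a b. a \<le> b \<longrightarrow> {a..b} \<subseteq> S \<longrightarrow> absolutely_continuous_on a b f}"

text \<open>The derivative on the half-line, one-sided at \<open>0\<close>.\<close>

definition D_half_line :: "(real \<Rightarrow> complex) \<Rightarrow> real \<Rightarrow> complex" where
  "D_half_line f x = vector_derivative f (at x within half_line)"

text \<open>
  Elements are functions on \<open>half_line - X\<close>; their values on \<open>X\<close> play no role.  That \<open>f'\<close> is locally
  absolutely continuous entails that \<open>f\<close> is differentiable at every point of \<open>half_line - X\<close>, and that
  \<open>f''\<close> exists almost everywhere; both are stated because \<open>vector_derivative\<close> is total.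
\<close>

definition W22 :: "real set \<Rightarrow> (real \<Rightarrow> complex) set" where
  "W22 X = {f \<in> L2.
     f \<in> AC_loc (half_line - X) \<and>
     (\<forall>x\<in>half_line - X. f differentiable (at x within half_line)) \<and>
     D_half_line f \<in> AC_loc (half_line - X) \<and>
     (AE x in half_line_measure. D_half_line f differentiable (at x within half_line)) \<and>
     D_half_line (D_half_line f) \<in> L2}"

definition W22_comp :: "real set \<Rightarrow> (real \<Rightarrow> complex) set" where
  "W22_comp X = {f \<in> W22 X. compact (closure {x \<in> half_line - X. f x \<noteq> 0})}"


section \<open>The Hamiltonian with delta-interactions\<close>

text \<open>
  The interaction centres \<open>x n\<close> and strengths \<open>\<alpha> n\<close> are indexed by \<open>n \<ge> 1\<close>; the value at \<open>n = 0\<close> is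
  ignored.
\<close>

definition interaction_set :: "(nat \<Rightarrow> real) \<Rightarrow> real set" where
  "interaction_set x = x ` {1..}"

text \<open>In the interface conditions, \<open>f (x\<^sub>n)\<close> is the common value \<open>c\<close> of the two one-sided limits.\<close>

definition delta_domain :: "(nat \<Rightarrow> real) \<Rightarrow> (nat \<Rightarrow> real) \<Rightarrow> (real \<Rightarrow> complex) set" where
  "delta_domain x \<alpha> = {f \<in> W22_comp (interaction_set x).
     D_half_line f 0 = 0 \<and>
     (\<forall>n\<ge>1. \<exists>c p q.
        (f \<longlongrightarrow> c) (at_left (x n)) \<and> (f \<longlongrightarrow> c) (at_right (x n)) \<and>
        (D_half_line f \<longlongrightarrow> p) (at_left (x n)) \<and> (D_half_line f \<longlongrightarrow> q) (at_right (x n)) \<and>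
        q - p = of_real (\<alpha> n) * c)}"

definition minus_second_derivative :: "(real \<Rightarrow> complex) set \<Rightarrow> L2_graph" where
  "minus_second_derivative D =
     {(f, g) \<in> L2 \<times> L2. \<exists>u\<in>D. L2_eq f u \<and> L2_eq g (\<lambda>x. - D_half_line (D_half_line u) x)}"

definition H_delta :: "(nat \<Rightarrow> real) \<Rightarrow> (nat \<Rightarrow> real) \<Rightarrow> L2_graph" where
  "H_delta x \<alpha> = operator_closure (minus_second_derivative (delta_domain x \<alpha>))"

end

theory Submission
  imports Defs
begin

text \<open>
  Let \<open>T\<close> be the operator before taking the closure.  An element \<open>(h, k)\<close> of its adjoint is
  orthogonal to the range of \<open>T\<close>, up to a particular solution of \<open>-w'' = k\<close>; on \<open>[0, \<surd>M]\<close> this range is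
  the orthogonal complement of the solution of the homogeneous initial value problem, so \<open>h\<close> itself
  solves \<open>-h'' = k\<close> with the interface conditions.  Multiplying \<open>h\<close> by slowly decaying cutoff functions
  \<open>X\<close> whose derivative vanishes at all \<open>\<surd>n\<close> approximates \<open>(h, k)\<close> in the graph norm: testing the equation with
  \<open>X'\<^sup>2 h\<close> bounds \<open>X' h'\<close> without any contribution of the interactions.  Such cutoffs exist because the
  squares of the spacings \<open>\<surd>(n+1) - \<surd>n\<close> have divergent sum.  Hence the adjoint equals the closure.

  Unboundedness from below is seen on functions of fixed width near \<open>N\<close> that take values of order \<open>1\<close> at
  the \<open>N\<close> points \<open>\<surd>n\<close> next to \<open>N\<close>, where the interaction energy is of order \<open>-N powr (1 - 2\<epsilon>)\<close>.
\<close>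

section \<open>Absolutely continuous functions\<close>

text \<open>The obstacle is the term 2 X' h' in (X h)'' = X h'' + 2 X' h' + X'' h: membership of h
  and h'' in L2 does not directly control h', since the quadratic form need not be bounded below,
  and the shrinking spacings leave no cells of fixed length on which a cutoff could vary. A smooth X
  preserves the interface conditions by itself, as X' h is continuous; that X' vanishes on the grid
  serves the estimate of X' h'. A function with bounded second derivative that is critical at both
  ends of a cell of length d changes there by at most a multiple of d^2. As the n-th spacing is
  about 1 / (2 sqrt n), the harmonic series permits growth like ln (1 + x^2), and the cutoffs are
  built from such a function. Self-adjointness is obtained for arbitrary real strengths; their size
  enters only in the failure of a lower bound. The differential equation is treated through local
  solutions without integrability or boundary conditions, so that homogeneous solutions, particular
  solutions and domain elements obey the same Green and Wronskian identities.\<close>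

text \<open>At a point where the derivative fails there are, for some h > 0, arbitrarily short
  intervals with that point as one end on which the increment of the integral misses
  \<open>f x\<close> times the length by at least h times the length. Henstock's lemma bounds the
  sum of such errors over disjoint fine intervals, and Vitali's theorem extracts a disjoint family
  covering almost all such points.\<close>

theorem negligible_not_differentiable_integral:
  fixes f :: "real \<Rightarrow> 'a::euclidean_space"
  assumes f: "f integrable_on {a..b}"
  shows "negligible {x \<in> {a<..<b}. \<not> ((\<lambda>y. integral {a..y} f) has_vector_derivative f x) (at x)}"
proof -
  define F where "F = (\<lambda>y. integral {a..y} f)"
  define bad where "bad h x y \<longleftrightarrow> a < y \<and> y < b \<and> y \<noteq> x \<and>
      norm (F y - F x - (y - x) *\<^sub>R f x) \<ge> h * \<bar>y - x\<bar>" for h x y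
  define E where "E h = {x \<in> {a<..<b}. \<forall>d>0. \<exists>y. \<bar>y - x\<bar> < d \<and> bad h x y}" for h
  have F_diff: "F y - F x = integral {x..y} f" if "a \<le> x" "x \<le> y" "y \<le> b" for x y
  proof -
    have "f integrable_on {a..y}"
      using f that by (auto intro: integrable_on_subinterval)
    then show ?thesis
      using Henstock_Kurzweil_Integration.integral_combine[of a x y f] that by (simp add: F_def algebra_simps)
  qed
  have neg: "negligible (E h)" if h: "h > 0" for h
  proof (clarsimp simp: negligible_outer_le)
    fix e :: real assume e: "e > 0"
    \<comment> \<open>Each bad interval contributes at least h times its length to this sum, so the
      budget \<open>e * h\<close> bounds the total length by \<open>e\<close>.\<close>
    obtain \<gamma> where \<gamma>: "gauge \<gamma>" and Hen: "\<And>p. \<lbrakk>p tagged_partial_division_of (cbox a b); \<gamma> fine p\<rbrakk> \<Longrightarrow>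
             sum (\<lambda>(x,k). norm(measure lborel k *\<^sub>R f x - integral k f)) p < e * h"
      using Henstock_lemma[of f a b "e * h"] f e h by auto
    \<comment> \<open>A pair consists of a tag and the other end of its interval, on either side of
      the tag; \<open>c\<close> and \<open>r\<close> describe the same interval as a ball, the form
      used by the covering theorem.\<close>
    define J where "J = (\<lambda>(x::real,y). {min x y..max x y})"
    define K where "K = {(x,y). x \<in> {a<..<b} \<and> bad h x y \<and> J (x,y) \<subseteq> \<gamma> x}"
    define c where "c = (\<lambda>(x::real,y). (x + y) / 2)"
    define r where "r = (\<lambda>(x::real,y). \<bar>y - x\<bar> / 2)"
    have ball: "cball (c i) (r i) = J i" for i
    proof -
      obtain x y where i: "i = (x, y)" by (cases i)
      have "\<bar>(x + y) / 2 - t\<bar> \<le> \<bar>y - x\<bar> / 2 \<longleftrightarrow> min x y \<le> t \<and> t \<le> max x y" for t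
      proof -
        have "(x + y) / 2 = (min x y + max x y) / 2" "\<bar>y - x\<bar> = max x y - min x y" by auto
        then show ?thesis unfolding abs_le_iff by (auto simp: field_simps)
      qed
      then show ?thesis by (auto simp: i c_def r_def J_def dist_real_def)
    qed
    obtain C where C: "countable C" "C \<subseteq> K"
      and pw: "pairwise (\<lambda>i j. disjnt (cball (c i) (r i)) (cball (c j) (r j))) C"
      and rest: "negligible (E h - (\<Union>i \<in> C. cball (c i) (r i)))"
    proof (rule Vitali_covering_theorem_cballs[of K r "E h" c])
      fix i assume "i \<in> K" then show "0 < r i"
        by (auto simp: K_def r_def bad_def)
    next
      fix x d :: real assume x: "x \<in> E h" and d: "0 < d"
      obtain d' where d': "d' > 0" "ball x d' \<subseteq> \<gamma> x"
        using \<gamma> by (metis gauge_def open_contains_ball_eq)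
      then obtain y where y: "\<bar>y - x\<bar> < min d d'" "bad h x y"
        using x d by (auto simp: E_def) (meson min_less_iff_conj)
      have "J (x,y) \<subseteq> ball x d'"
        using y by (auto simp: J_def dist_real_def)
      then have "(x,y) \<in> K"
        using x y d' by (auto simp: K_def E_def)
      then show "\<exists>i. i \<in> K \<and> x \<in> cball (c i) (r i) \<and> r i < d"
        using y unfolding ball by (intro exI[of _ "(x,y)"]) (auto simp: J_def r_def)
    qed auto
    define U where "U = (\<Union>i\<in>C. J i)"
    \<comment> \<open>Henstock's lemma speaks of finite divisions, so the countable family is
      measured through its finite subfamilies.\<close>
    have fin: "measure lebesgue (\<Union>i\<in>I. J i) \<le> e" if I: "I \<subseteq> C" "finite I" for I
    proof -
      define p where "p = (\<lambda>i. (fst i, J i)) ` I"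
      have pwI: "pairwise (\<lambda>i j. disjnt (J i) (J j)) I"
        using pairwise_mono[OF pw] I by (simp add: ball pairwise_subset)
      have ne: "fst i \<in> J i" for i
        by (cases i) (auto simp: J_def)
      have sub: "J i \<subseteq> {a..b}" if "i \<in> I" for i
        using that I C by (cases i) (fastforce simp: K_def J_def bad_def)
      have tp: "p tagged_partial_division_of cbox a b"
        unfolding tagged_partial_division_of_def
      proof (intro conjI allI impI)
        show "finite p" using I by (simp add: p_def)
      next
        fix x k assume "(x, k) \<in> p"
        then obtain i where i: "i \<in> I" "x = fst i" "k = J i" by (auto simp: p_def)
        then show "x \<in> k" "k \<subseteq> cbox a b" using ne sub by auto
        show "\<exists>a b. k = cbox a b" using i by (cases i) (auto simp: J_def)
      next
        fix x1 K1 x2 K2 assume *: "(x1, K1) \<in> p \<and> (x2, K2) \<in> p \<and> (x1, K1) \<noteq> (x2, K2)"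
        then obtain i j where ij: "i \<in> I" "x1 = fst i" "K1 = J i" "j \<in> I" "x2 = fst j" "K2 = J j"
          by (auto simp: p_def)
        then have "i \<noteq> j" using * by auto
        then have "disjnt K1 K2" using pwI ij by (auto simp: pairwise_def)
        then show "interior K1 \<inter> interior K2 = {}"
          using interior_subset by (fastforce simp: disjnt_def)
      qed
      moreover have "\<gamma> fine p"
        using I C by (force simp: fine_def p_def K_def)
      ultimately have lt: "(\<Sum>(x,k)\<in>p. norm (measure lborel k *\<^sub>R f x - integral k f)) < e * h"
        by (rule Hen)
      have inj: "inj_on (\<lambda>i. (fst i, J i)) I"
      proof (rule inj_onI)
        fix i j assume "i \<in> I" "j \<in> I" "(fst i, J i) = (fst j, J j)"
        then show "i = j" using pwI ne[of i] by (auto simp: pairwise_def disjnt_def)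
      qed
      have "h * measure lebesgue (\<Union>i\<in>I. J i) \<le> (\<Sum>i\<in>I. h * measure lebesgue (J i))"
        using measure_UNION_le[of I J lebesgue] I h
        by (auto simp: sum_distrib_left[symmetric] J_def split: prod.splits)
      also have "\<dots> \<le> (\<Sum>i\<in>I. norm (measure lborel (J i) *\<^sub>R f (fst i) - integral (J i) f))"
      proof (rule sum_mono)
        fix i assume i: "i \<in> I"
        obtain x y where xy: "i = (x,y)" by (cases i)
        have b: "bad h x y" and x: "a < x" "x < b" using i I C xy by (auto simp: K_def)
        show "h * measure lebesgue (J i) \<le> norm (measure lborel (J i) *\<^sub>R f (fst i) - integral (J i) f)"
        proof (cases "x < y")
          case True
          then have "F y - F x = integral (J i) f"
            using F_diff[of x y] x b by (simp add: J_def xy bad_def)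
          then show ?thesis
            using b True by (simp add: xy J_def bad_def norm_minus_commute)
        next
          case False
          then have yx: "y < x" using b by (auto simp: bad_def)
          then have *: "F x - F y = integral (J i) f"
            using F_diff[of y x] x b by (simp add: J_def xy bad_def)
          have "measure lborel (J i) *\<^sub>R f (fst i) - integral (J i) f = F y - F x - (y - x) *\<^sub>R f x"
            unfolding *[symmetric] using yx by (simp add: xy J_def algebra_simps)
          then show ?thesis
            using b yx by (simp add: xy J_def bad_def)
        qed
      qed
      also have "\<dots> = (\<Sum>(x,k)\<in>p. norm (measure lborel k *\<^sub>R f x - integral k f))"
        by (simp add: p_def sum.reindex[OF inj])
      finally have "h * measure lebesgue (\<Union>i\<in>I. J i) \<le> h * e"
        using lt by (simp add: mult.commute)
      then show ?thesis using h by simp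
    qed
    have U: "U \<in> lmeasurable" "measure lebesgue U \<le> e"
      unfolding U_def using fin e
      by (auto intro!: fmeasurable_UN_bound[OF \<open>countable C\<close>] measure_UN_bound[OF \<open>countable C\<close>]
               simp: J_def split: prod.splits)
    have N: "negligible (E h - U)" using rest by (simp add: U_def ball)
    show "\<exists>T. E h \<subseteq> T \<and> T \<in> lmeasurable \<and> measure lebesgue T \<le> e"
    proof (intro exI conjI)
      show "E h \<subseteq> U \<union> (E h - U)" by auto
      show "U \<union> (E h - U) \<in> lmeasurable"
        by (intro fmeasurable.Un negligible_imp_measurable U N)
      show "measure lebesgue (U \<union> (E h - U)) \<le> e"
        using measure_Un_le[of U lebesgue "E h - U"] U N
        by (simp add: negligible_imp_measure0 negligible_imp_sets fmeasurableD)
    qed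
  qed
  have "{x \<in> {a<..<b}. \<not> (F has_vector_derivative f x) (at x)} \<subseteq> (\<Union>n. E (inverse (real (Suc n))))"
  proof
    fix x assume "x \<in> {x \<in> {a<..<b}. \<not> (F has_vector_derivative f x) (at x)}"
    then have x: "a < x" "x < b" and nd: "\<not> (F has_vector_derivative f x) (at x)" by auto
    have "\<exists>h>0. \<forall>d>0. \<exists>y. \<bar>y - x\<bar> < d \<and> norm (F y - F x - (y - x) *\<^sub>R f x) > h * \<bar>y - x\<bar>"
      using nd unfolding has_vector_derivative_def has_derivative_at_alt
      by (auto simp: bounded_linear_scaleR_left) (meson not_le)
    then obtain h where h: "h > 0"
      and H: "\<And>d. d > 0 \<Longrightarrow> \<exists>y. \<bar>y - x\<bar> < d \<and> norm (F y - F x - (y - x) *\<^sub>R f x) > h * \<bar>y - x\<bar>"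
      by auto
    obtain n where n: "inverse (real (Suc n)) < h"
      using h reals_Archimedean by blast
    have "x \<in> E (inverse (real (Suc n)))"
      unfolding E_def mem_Collect_eq
    proof (intro conjI allI impI)
      show "x \<in> {a<..<b}" using x by simp
    next
      fix d :: real assume "d > 0"
      then obtain y where y: "\<bar>y - x\<bar> < min d (min (x - a) (b - x))"
         "norm (F y - F x - (y - x) *\<^sub>R f x) > h * \<bar>y - x\<bar>"
        using H[of "min d (min (x - a) (b - x))"] x by auto
      have "y \<noteq> x" using y(2) by auto
      moreover have "inverse (real (Suc n)) * \<bar>y - x\<bar> \<le> norm (F y - F x - (y - x) *\<^sub>R f x)"
        using mult_right_mono[of "inverse (real (Suc n))" h "\<bar>y - x\<bar>"] n y(2) by linarith
      ultimately show "\<exists>y. \<bar>y - x\<bar> < d \<and> bad (inverse (real (Suc n))) x y"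
        using y x by (intro exI[of _ y]) (auto simp: bad_def)
    qed
    then show "x \<in> (\<Union>n. E (inverse (real (Suc n))))" by blast
  qed
  moreover have "negligible (\<Union>n. E (inverse (real (Suc n))))"
    by (rule negligible_countable_Union) (auto intro: neg)
  ultimately show ?thesis
    unfolding F_def by (rule negligible_subset[rotated])
qed

text \<open>The gauge has two regimes. At a point of differentiability it enforces the straddle
  estimate; at an exceptional point it confines the interval to an open set \<open>U\<close> of
  measure less than the \<open>d\<close> of absolute continuity. The integrand is set to 0 at
  exceptional points, so that only increments of \<open>F\<close> remain there, and their sum is
  small.\<close>

theorem fundamental_theorem_absolutely_continuous:
  fixes F f :: "real \<Rightarrow> complex"
  assumes ab: "a \<le> b" and AC: "absolutely_continuous_on a b F"
    and N: "negligible N"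
    and der: "\<And>x. x \<in> {a<..<b} - N \<Longrightarrow> (F has_vector_derivative f x) (at x)"
  shows "(f has_integral F b - F a) {a..b}"
proof -
  define N' where "N' = N \<union> {a, b}"
  have N': "negligible N'" using N by (simp add: N'_def)
  define g where "g x = (if x \<in> N' then 0 else f x)" for x
  have derg: "(F has_vector_derivative g x) (at x)" if "x \<in> {a..b} - N'" for x
    using that der[of x] by (auto simp: g_def N'_def)
  have "(g has_integral F b - F a) {a..b}"
    unfolding has_integral_real
  proof (intro allI impI)
    fix e :: real assume e: "e > 0"
    \<comment> \<open>The straddle errors add up to at most \<open>e1 * (b - a)\<close>, hence to at
      most e/2; the summand 1 covers the case \<open>a = b\<close>.\<close>
    define e1 where "e1 = e / (2 * (b - a + 1))"
    have e1: "e1 > 0" using e ab by (simp add: e1_def)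
    obtain d where d: "d > 0" and dAC: "\<And>P. finite P \<Longrightarrow> (\<forall>(s, t)\<in>P. a \<le> s \<and> s < t \<and> t \<le> b) \<Longrightarrow>
        pairwise (\<lambda>(s, t) (s', t'). disjnt {s<..<t} {s'<..<t'}) P \<Longrightarrow>
        (\<Sum>(s, t)\<in>P. t - s) < d \<Longrightarrow> (\<Sum>(s, t)\<in>P. cmod (F t - F s)) < e / 2"
      using AC[unfolded absolutely_continuous_on_def, rule_format, of "e/2"] e by auto
    obtain U where U: "open U" "N' \<subseteq> U" "U - N' \<in> lmeasurable" "emeasure lebesgue (U - N') < ennreal d"
      using sets_lebesgue_outer_open[of N' d] N' d by (metis negligible_imp_sets)
    have Um: "U \<in> lmeasurable" "measure lebesgue U < d"
    proof -
      have eq: "U = (U - N') \<union> N'" using U by auto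
      have NM: "N' \<in> lmeasurable" using N' negligible_imp_measurable by blast
      show "U \<in> lmeasurable" by (subst eq) (intro fmeasurable.Un U NM)
      have "measure lebesgue (U - N') < d"
        using U d by (simp add: emeasure_eq_measure2 ennreal_less_iff)
      moreover have "measure lebesgue U \<le> measure lebesgue (U - N') + measure lebesgue N'"
        by (subst eq) (intro measure_Un_le fmeasurableD U NM)
      ultimately show "measure lebesgue U < d"
        using N' by (simp add: negligible_imp_measure0)
    qed
    have "\<exists>\<delta>. \<forall>x \<in> {a..b} - N'. \<delta> x > 0 \<and> (\<forall>y. \<bar>y - x\<bar> < \<delta> x \<longrightarrow>
              cmod (F y - F x - (y - x) *\<^sub>R g x) \<le> e1 * \<bar>y - x\<bar>)"
      by (rule bchoice) (use derg e1 in \<open>auto simp: has_vector_derivative_def has_derivative_at_alt\<close>)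
    then obtain \<delta> where \<delta>: "\<And>x. x \<in> {a..b} - N' \<Longrightarrow> \<delta> x > 0"
      and str: "\<And>x y. x \<in> {a..b} - N' \<Longrightarrow> \<bar>y - x\<bar> < \<delta> x \<Longrightarrow>
              cmod (F y - F x - (y - x) *\<^sub>R g x) \<le> e1 * \<bar>y - x\<bar>"
      by metis
    define \<gamma> where "\<gamma> x = (if x \<in> N' then U else if x \<in> {a..b} then ball x (\<delta> x) else UNIV)" for x
    show "\<exists>\<gamma>. gauge \<gamma> \<and> (\<forall>D. D tagged_division_of {a..b} \<and> \<gamma> fine D \<longrightarrow>
        cmod ((\<Sum>(x,k)\<in>D. measure lborel k *\<^sub>R g x) - (F b - F a)) < e)"
    proof (intro exI conjI allI impI)
      show "gauge \<gamma>"
        unfolding gauge_def \<gamma>_def using U \<delta> by auto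
    next
      fix D assume "D tagged_division_of {a..b} \<and> \<gamma> fine D"
      then have D: "D tagged_division_of {a..b}" and fine: "\<gamma> fine D" by auto
      have fD: "finite D" using D by (rule tagged_division_of_finite)
      have DK: "\<exists>u v. K = {u..v} \<and> u \<le> x \<and> x \<le> v \<and> a \<le> u \<and> v \<le> b" if xK: "(x,K) \<in> D" for x K
      proof -
        obtain u v where "K = {u..v}" "x \<in> K" "K \<subseteq> {a..b}"
          using tagged_division_ofD(2-4)[OF D xK] by auto
        then show ?thesis by (intro exI[of _ u] exI[of _ v]) auto
      qed
      define w where "w = (\<lambda>(x,K). measure lborel K *\<^sub>R g x - (F (Sup K) - F (Inf K)))"
      define DN where "DN = {(x,K)\<in>D. x \<in> N'}"
      have DNsub: "DN \<subseteq> D" by (auto simp: DN_def)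
      have fDN: "finite DN" using finite_subset[OF DNsub fD] .
      have "cmod ((\<Sum>(x,k)\<in>D. measure lborel k *\<^sub>R g x) - (F b - F a)) = cmod (\<Sum>i\<in>D. w i)"
        using additive_tagged_division_1[OF ab D, of F]
        by (simp add: w_def split_def sum_subtractf)
      moreover have "cmod (\<Sum>i\<in>D. w i) \<le> (\<Sum>i\<in>DN. cmod (w i)) + (\<Sum>i\<in>D - DN. cmod (w i))"
        using norm_sum[of w D] sum.subset_diff[OF DNsub fD, of "\<lambda>i. cmod (w i)"] by simp
      moreover have "(\<Sum>i\<in>D - DN. cmod (w i)) \<le> e1 * (b - a)"
      proof -
        have le: "cmod (w i) \<le> (case i of (x,K) \<Rightarrow> e1 * (Sup K - Inf K))" if "i \<in> D - DN" for i
        proof -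
          obtain x K where i: "i = (x,K)" by (cases i)
          have xK: "(x,K) \<in> D" "x \<notin> N'" using that i by (auto simp: DN_def)
          obtain u v where uv: "K = {u..v}" "u \<le> x" "x \<le> v" "a \<le> u" "v \<le> b"
            using DK[OF xK(1)] by blast
          have "K \<subseteq> ball x (\<delta> x)"
            using fine xK uv by (fastforce simp: fine_def \<gamma>_def)
          then have "\<bar>u - x\<bar> < \<delta> x" "\<bar>v - x\<bar> < \<delta> x"
            using uv by (auto simp: dist_real_def subset_iff abs_minus_commute dest: spec[of _ u] spec[of _ v])
          then have 1: "cmod (F u - F x - (u - x) *\<^sub>R g x) \<le> e1 * (x - u)"
            "cmod (F v - F x - (v - x) *\<^sub>R g x) \<le> e1 * (v - x)"
            using str[of x u] str[of x v] uv xK by auto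
          have "w i = (F u - F x - (u - x) *\<^sub>R g x) - (F v - F x - (v - x) *\<^sub>R g x)"
            using uv by (simp add: w_def i algebra_simps)
          then have "cmod (w i) \<le> e1 * (x - u) + e1 * (v - x)"
            using 1 norm_triangle_ineq4[of "F u - F x - (u - x) *\<^sub>R g x" "F v - F x - (v - x) *\<^sub>R g x"]
            by simp
          then show ?thesis using uv by (simp add: i algebra_simps)
        qed
        have nn: "0 \<le> (case i of (x,K) \<Rightarrow> e1 * (Sup K - Inf K))" if "i \<in> D" for i
          using that DK e1 by (cases i) fastforce
        have "(\<Sum>i\<in>D - DN. cmod (w i)) \<le> (\<Sum>i\<in>D - DN. case i of (x,K) \<Rightarrow> e1 * (Sup K - Inf K))"
          by (rule sum_mono) (rule le)
        also have "\<dots> \<le> (\<Sum>i\<in>D. case i of (x,K) \<Rightarrow> e1 * (Sup K - Inf K))"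
          by (rule sum_mono2[OF fD]) (use nn in auto)
        also have "\<dots> = e1 * (b - a)"
          using additive_tagged_division_1[OF ab D, of "\<lambda>x. x"]
          by (simp add: split_def sum_distrib_left[symmetric])
        finally show ?thesis .
      qed
      moreover have "(\<Sum>i\<in>DN. cmod (w i)) < e / 2"
      proof -
        \<comment> \<open>Degenerate intervals are dropped because absolute continuity speaks of
          pairs with \<open>s < t\<close>; their increments are 0. Passing from tagged sets to pairs
          of end points is injective, since the interiors are disjoint and nonempty.\<close>
        define DP where "DP = {(x,K)\<in>DN. Inf K < Sup K}"
        define ends where "ends = (\<lambda>(x::real,K::real set). (Inf K, Sup K))"
        define P where "P = ends ` DP"
        have DPsub: "DP \<subseteq> DN" by (auto simp: DP_def)
        have fDP: "finite DP" using finite_subset[OF DPsub fDN] .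
        have DPK: "K = {Inf K..Sup K} \<and> Inf K < Sup K \<and> a \<le> Inf K \<and> Sup K \<le> b \<and> K \<subseteq> U"
          if "(x,K) \<in> DP" for x K
        proof -
          have D': "(x,K) \<in> D" "x \<in> N'" "Inf K < Sup K" using that by (auto simp: DP_def DN_def)
          obtain u v where uv: "K = {u..v}" "u \<le> x" "x \<le> v" "a \<le> u" "v \<le> b"
            using DK[OF D'(1)] by blast
          have "K \<subseteq> \<gamma> x" using fine D'(1) by (auto simp: fine_def)
          then have "K \<subseteq> U" using D'(2) by (simp add: \<gamma>_def)
          with uv D' show ?thesis by auto
        qed
        have dj: "disjnt {fst (ends i)<..<snd (ends i)} {fst (ends j)<..<snd (ends j)}"
          if "i \<in> DP" "j \<in> DP" "i \<noteq> j" for i j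
        proof -
          obtain x K where i: "i = (x,K)" by (cases i)
          obtain y L where j: "j = (y,L)" by (cases j)
          have "interior K \<inter> interior L = {}"
            using tagged_division_ofD(5)[OF D, of x K y L] that by (auto simp: i j DP_def DN_def)
          moreover have "interior K = {Inf K<..<Sup K}" "interior L = {Inf L<..<Sup L}"
            using DPK[of x K] DPK[of y L] that interior_atLeastAtMost_real[of "Inf K" "Sup K"]
              interior_atLeastAtMost_real[of "Inf L" "Sup L"] by (auto simp: i j)
          ultimately show ?thesis by (simp add: i j ends_def disjnt_def)
        qed
        have inj: "inj_on ends DP"
        proof (rule inj_onI, rule ccontr)
          fix i j assume *: "i \<in> DP" "j \<in> DP" "ends i = ends j" "i \<noteq> j"
          have "fst (ends i) < snd (ends i)" using * by (auto simp: ends_def DP_def)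
          then show False using dj[of i j] * by (auto simp: disjnt_def)
        qed
        have "(\<Sum>i\<in>DN. cmod (w i)) = (\<Sum>i\<in>DN. cmod (F (snd (ends i)) - F (fst (ends i))))"
          by (rule sum.cong) (auto simp: DN_def w_def g_def ends_def norm_minus_commute)
        also have "\<dots> = (\<Sum>i\<in>DP. cmod (F (snd (ends i)) - F (fst (ends i))))"
        proof (rule sum.mono_neutral_right[OF fDN DPsub], intro ballI)
          fix i assume i: "i \<in> DN - DP"
          obtain x K where xK: "i = (x,K)" by (cases i)
          have "Sup K \<le> Inf K" "(x,K) \<in> D" using i xK by (auto simp: DP_def DN_def)
          then have "Sup K = Inf K" using DK[of x K] by fastforce
          then show "cmod (F (snd (ends i)) - F (fst (ends i))) = 0" by (simp add: ends_def xK)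
        qed
        also have "\<dots> = (\<Sum>(s,t)\<in>P. cmod (F t - F s))"
          by (simp add: P_def sum.reindex[OF inj] split_def)
        also have "\<dots> < e / 2"
        proof (rule dAC)
          show "finite P" using fDP by (simp add: P_def)
          show "\<forall>(s, t)\<in>P. a \<le> s \<and> s < t \<and> t \<le> b"
            using DPK by (auto simp: P_def ends_def)
          show "pairwise (\<lambda>(s, t) (s', t'). disjnt {s<..<t} {s'<..<t'}) P"
            using dj by (auto simp: pairwise_def P_def split_def)
          have "(\<Sum>(s,t)\<in>P. t - s) = (\<Sum>i\<in>DP. snd (ends i) - fst (ends i))"
            by (simp add: P_def sum.reindex[OF inj] split_def)
          also have "\<dots> = (\<Sum>i\<in>DP. measure lebesgue {fst (ends i)<..<snd (ends i)})"
            by (rule sum.cong) (auto simp: ends_def DP_def)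
          also have "\<dots> = measure lebesgue (\<Union>i\<in>DP. {fst (ends i)<..<snd (ends i)})"
            by (subst measure_UNION') (use fDP dj in \<open>auto simp: pairwise_def\<close>)
          also have "\<dots> \<le> measure lebesgue U"
          proof (rule measure_mono_fmeasurable)
            show "(\<Union>i\<in>DP. {fst (ends i)<..<snd (ends i)}) \<subseteq> U"
              using DPK by (auto simp: ends_def) (metis atLeastAtMost_iff less_imp_le subsetD)
          qed (use Um fDP in \<open>auto intro!: sets.finite_UN\<close>)
          finally show "(\<Sum>(s, t)\<in>P. t - s) < d" using Um by simp
        qed
        finally show ?thesis .
      qed
      moreover have "e1 * (b - a) \<le> e / 2"
      proof -
        have "e1 * (b - a) \<le> e1 * (b - a + 1)" using e1 by (intro mult_left_mono) auto
        also have "\<dots> = e / 2" using ab by (simp add: e1_def field_simps)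
        finally show ?thesis .
      qed
      ultimately show "cmod ((\<Sum>(x,k)\<in>D. measure lborel k *\<^sub>R g x) - (F b - F a)) < e" by linarith
    qed
  qed
  then show ?thesis
    by (rule has_integral_spike[OF N', rotated]) (auto simp: g_def)
qed

section \<open>Stability properties of absolute continuity\<close>

definition subinterval_family :: "real \<Rightarrow> real \<Rightarrow> (real \<times> real) set \<Rightarrow> bool" where
  "subinterval_family a b P \<longleftrightarrow> finite P \<and> (\<forall>(s, t)\<in>P. a \<le> s \<and> s < t \<and> t \<le> b) \<and>
      pairwise (\<lambda>(s, t) (s', t'). disjnt {s<..<t} {s'<..<t'}) P"

lemma absolutely_continuous_on_iff:
  "absolutely_continuous_on a b f \<longleftrightarrow>
     (\<forall>e>0. \<exists>d>0. \<forall>P. subinterval_family a b P \<longrightarrow>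
        (\<Sum>(s, t)\<in>P. t - s) < d \<longrightarrow> (\<Sum>(s, t)\<in>P. cmod (f t - f s)) < e)"
  unfolding absolutely_continuous_on_def subinterval_family_def imp_conjL ..

lemma absolutely_continuous_onE:
  assumes "absolutely_continuous_on a b f" "e > 0"
  obtains d where "d > 0" "\<And>P. \<lbrakk>subinterval_family a b P; (\<Sum>(s, t)\<in>P. t - s) < d\<rbrakk> \<Longrightarrow>
      (\<Sum>(s, t)\<in>P. cmod (f t - f s)) < e"
  using assms unfolding absolutely_continuous_on_iff by blast

text \<open>Bounds on single increments add up over a family of intervals. Lipschitz functions,
  sums, products and conjugates are all treated as instances of this comparison.\<close>

lemma absolutely_continuous_on_dominated:
  assumes f: "absolutely_continuous_on a b f" and g: "absolutely_continuous_on a b g"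
    and AB: "A \<ge> 0" "B \<ge> 0"
    and le: "\<And>s t. \<lbrakk>a \<le> s; s < t; t \<le> b\<rbrakk> \<Longrightarrow>
        cmod (h t - h s) \<le> A * cmod (f t - f s) + B * cmod (g t - g s)"
  shows "absolutely_continuous_on a b h"
  unfolding absolutely_continuous_on_iff
proof (intro allI impI)
  fix e :: real assume e: "e > 0"
  define e' where "e' = e / (A + B + 1)"
  have e': "e' > 0" using e AB by (simp add: e'_def add_nonneg_pos)
  obtain d1 where d1: "d1 > 0" "\<And>P. subinterval_family a b P \<Longrightarrow> (\<Sum>(s, t)\<in>P. t - s) < d1 \<Longrightarrow> (\<Sum>(s, t)\<in>P. cmod (f t - f s)) < e'"
    using absolutely_continuous_onE[OF f e'] by blast
  obtain d2 where d2: "d2 > 0" "\<And>P. subinterval_family a b P \<Longrightarrow> (\<Sum>(s, t)\<in>P. t - s) < d2 \<Longrightarrow> (\<Sum>(s, t)\<in>P. cmod (g t - g s)) < e'"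
    using absolutely_continuous_onE[OF g e'] by blast
  show "\<exists>d>0. \<forall>P. subinterval_family a b P \<longrightarrow>
        (\<Sum>(s, t)\<in>P. t - s) < d \<longrightarrow> (\<Sum>(s, t)\<in>P. cmod (h t - h s)) < e"
  proof (intro exI[of _ "min d1 d2"] conjI allI impI)
    fix P :: "(real \<times> real) set"
    assume okP: "subinterval_family a b P" and lt: "(\<Sum>(s, t)\<in>P. t - s) < min d1 d2"
    have P: "\<forall>(s, t)\<in>P. a \<le> s \<and> s < t \<and> t \<le> b" using okP by (simp add: subinterval_family_def)
    have 1: "(\<Sum>(s, t)\<in>P. cmod (f t - f s)) < e'" "(\<Sum>(s, t)\<in>P. cmod (g t - g s)) < e'"
      using d1(2)[OF okP] d2(2)[OF okP] lt by auto
    have "(\<Sum>(s, t)\<in>P. cmod (h t - h s)) \<le> (\<Sum>(s, t)\<in>P. A * cmod (f t - f s) + B * cmod (g t - g s))"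
      by (rule sum_mono) (use P le in auto)
    also have "\<dots> = A * (\<Sum>(s, t)\<in>P. cmod (f t - f s)) + B * (\<Sum>(s, t)\<in>P. cmod (g t - g s))"
      by (simp add: split_def sum.distrib sum_distrib_left)
    also have "\<dots> \<le> A * e' + B * e'"
      using 1 AB by (intro add_mono mult_left_mono) auto
    also have "\<dots> < (A + B + 1) * e'" using e' by (simp add: algebra_simps)
    also have "\<dots> = e" using AB by (simp add: e'_def)
    finally show "(\<Sum>(s, t)\<in>P. cmod (h t - h s)) < e" .
  qed (use d1 d2 in auto)
qed

lemma absolutely_continuous_on_of_real: "absolutely_continuous_on a b of_real"
  unfolding absolutely_continuous_on_iff
proof (intro allI impI)
  fix e :: real assume e: "e > 0"
  have "(\<Sum>(s, t)\<in>P. cmod (of_real t - of_real s)) = (\<Sum>(s, t)\<in>P. t - s)"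
    if "subinterval_family a b P" for P
    by (rule sum.cong) (use that in \<open>auto simp: subinterval_family_def simp flip: of_real_diff\<close>)
  with e show "\<exists>d>0. \<forall>P. subinterval_family a b P \<longrightarrow>
        (\<Sum>(s, t)\<in>P. t - s) < d \<longrightarrow> (\<Sum>(s, t)\<in>P. cmod (of_real t - of_real s)) < e"
    by (intro exI[of _ e]) auto
qed

lemma lipschitz_imp_absolutely_continuous_on:
  assumes "B \<ge> 0" "\<And>s t. \<lbrakk>a \<le> s; s < t; t \<le> b\<rbrakk> \<Longrightarrow> cmod (h t - h s) \<le> B * (t - s)"
  shows "absolutely_continuous_on a b h"
  by (rule absolutely_continuous_on_dominated[OF absolutely_continuous_on_of_real
        absolutely_continuous_on_of_real, of B 0]) (use assms in \<open>auto simp flip: of_real_diff\<close>)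

lemma absolutely_continuous_on_subinterval:
  assumes "absolutely_continuous_on a b f" "a \<le> c" "d \<le> b"
  shows "absolutely_continuous_on c d f"
  unfolding absolutely_continuous_on_iff
proof (intro allI impI)
  fix e :: real assume "e > 0"
  then obtain \<delta> where "\<delta> > 0" and \<delta>: "\<And>P. subinterval_family a b P \<Longrightarrow>
        (\<Sum>(s, t)\<in>P. t - s) < \<delta> \<Longrightarrow> (\<Sum>(s, t)\<in>P. cmod (f t - f s)) < e"
    using absolutely_continuous_onE[OF assms(1)] by blast
  moreover have "subinterval_family a b P" if "subinterval_family c d P" for P
    using that assms(2,3) unfolding subinterval_family_def by fastforce
  ultimately show "\<exists>\<delta>>0. \<forall>P. subinterval_family c d P \<longrightarrow>
        (\<Sum>(s, t)\<in>P. t - s) < \<delta> \<longrightarrow> (\<Sum>(s, t)\<in>P. cmod (f t - f s)) < e"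
    by blast
qed

lemma absolutely_continuous_on_imp_continuous_on:
  assumes "absolutely_continuous_on a b f"
  shows "continuous_on {a..b} f"
  unfolding continuous_on_iff
proof (intro ballI allI impI)
  fix x e :: real assume x: "x \<in> {a..b}" and e: "e > 0"
  obtain d where d: "d > 0" "\<And>P. subinterval_family a b P \<Longrightarrow>
        (\<Sum>(s, t)\<in>P. t - s) < d \<Longrightarrow> (\<Sum>(s, t)\<in>P. cmod (f t - f s)) < e"
    using absolutely_continuous_onE[OF assms e] by blast
  have *: "cmod (f t - f s) < e" if "a \<le> s" "s < t" "t \<le> b" "t - s < d" for s t
    using d(2)[of "{(s,t)}"] that by (auto simp: subinterval_family_def)
  show "\<exists>d>0. \<forall>x'\<in>{a..b}. dist x' x < d \<longrightarrow> dist (f x') (f x) < e"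
  proof (intro exI[of _ d] conjI ballI impI)
    fix y assume y: "y \<in> {a..b}" "dist y x < d"
    consider "y < x" | "y = x" | "x < y" by linarith
    then show "dist (f y) (f x) < e"
      using *[of y x] *[of x y] x y e
      by cases (auto simp: dist_norm norm_minus_commute)
  qed (use d in auto)
qed

lemma absolutely_continuous_on_mult:
  assumes f: "absolutely_continuous_on a b f" and g: "absolutely_continuous_on a b g"
  shows "absolutely_continuous_on a b (\<lambda>x. f x * g x)"
proof -
  have "\<exists>B. \<forall>x\<in>{a..b}. cmod (h x) \<le> B" if "absolutely_continuous_on a b h" for h
    using compact_imp_bounded[OF compact_continuous_image[OF
        absolutely_continuous_on_imp_continuous_on[OF that]]] by (auto simp: bounded_iff)
  then obtain A B where A: "\<And>x. x \<in> {a..b} \<Longrightarrow> cmod (f x) \<le> A" and B: "\<And>x. x \<in> {a..b} \<Longrightarrow> cmod (g x) \<le> B"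
    using f g by metis
  show ?thesis
  proof (rule absolutely_continuous_on_dominated[OF f g, of "\<bar>B\<bar>" "\<bar>A\<bar>"])
    fix s t assume st: "a \<le> s" "s < t" "t \<le> b"
    have "f t * g t - f s * g s = (f t - f s) * g t + f s * (g t - g s)"
      by (simp add: algebra_simps)
    also have "cmod \<dots> \<le> cmod (f t - f s) * cmod (g t) + cmod (f s) * cmod (g t - g s)"
      by (metis norm_mult norm_triangle_ineq)
    also have "\<dots> \<le> cmod (f t - f s) * \<bar>B\<bar> + \<bar>A\<bar> * cmod (g t - g s)"
      using A[of s] B[of t] st by (intro add_mono mult_left_mono mult_right_mono) auto
    finally show "cmod (f t * g t - f s * g s) \<le> \<bar>B\<bar> * cmod (f t - f s) + \<bar>A\<bar> * cmod (g t - g s)"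
      by (simp add: mult.commute)
  qed auto
qed

lemma absolutely_continuous_on_add:
  assumes "absolutely_continuous_on a b f" "absolutely_continuous_on a b g"
  shows "absolutely_continuous_on a b (\<lambda>x. f x + g x)"
  by (rule absolutely_continuous_on_dominated[OF assms, of 1 1])
     (auto, metis add_diff_add norm_triangle_ineq)

lemma absolutely_continuous_on_const: "absolutely_continuous_on a b (\<lambda>x. c)"
  by (rule lipschitz_imp_absolutely_continuous_on[of 0]) auto

lemma absolutely_continuous_on_cnj:
  assumes "absolutely_continuous_on a b f"
  shows "absolutely_continuous_on a b (\<lambda>x. cnj (f x))"
  by (rule absolutely_continuous_on_dominated[OF assms assms, of 1 0])
     (auto simp flip: complex_cnj_diff)

lemma absolutely_continuous_on_cong:
  assumes "\<And>x. x \<in> {a..b} \<Longrightarrow> f x = g x" "absolutely_continuous_on a b g"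
  shows "absolutely_continuous_on a b f"
  by (rule absolutely_continuous_on_dominated[OF assms(2) assms(2), of 1 0]) (auto simp: assms(1))

lemma differentiable_bounded_imp_absolutely_continuous_on:
  assumes "\<And>x. x \<in> {a..b} \<Longrightarrow> (f has_vector_derivative f' x) (at x within {a..b})"
    and "\<And>x. x \<in> {a..b} \<Longrightarrow> cmod (f' x) \<le> B"
  shows "absolutely_continuous_on a b f"
proof (rule lipschitz_imp_absolutely_continuous_on[of "\<bar>B\<bar>"])
  fix s t assume st: "a \<le> s" "s < t" "t \<le> b"
  have "norm (f t - f s) \<le> \<bar>B\<bar> * norm (t - s)"
  proof (rule differentiable_bound[where S = "{a..b}" and f' = "\<lambda>x h. h *\<^sub>R f' x"])
    fix x assume "x \<in> {a..b}"
    then show "(f has_derivative (\<lambda>h. h *\<^sub>R f' x)) (at x within {a..b})"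
      using assms(1) by (simp add: has_vector_derivative_def)
    show "onorm (\<lambda>h. h *\<^sub>R f' x) \<le> \<bar>B\<bar>"
    proof (rule onorm_le)
      fix h :: real
      have "\<bar>h\<bar> * cmod (f' x) \<le> \<bar>h\<bar> * \<bar>B\<bar>"
        using assms(2)[OF \<open>x \<in> {a..b}\<close>] by (intro mult_left_mono) auto
      then show "norm (h *\<^sub>R f' x) \<le> \<bar>B\<bar> * norm h" by (simp add: mult.commute)
    qed
  qed (use st in auto)
  then show "cmod (f t - f s) \<le> \<bar>B\<bar> * (t - s)" using st by simp
qed auto

section \<open>Indefinite integrals and one-sided limits\<close>

text \<open>The modulus of \<open>f\<close> is split into its truncation at height n and a remainder
  \<open>h\<close> with integral below e/2. The remainder is small over every family of disjoint
  intervals, and the truncation contributes at most n times the total length.\<close>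

lemma absolutely_continuous_on_integral:
  fixes f :: "real \<Rightarrow> complex"
  assumes f: "f absolutely_integrable_on {a..b}"
  shows "absolutely_continuous_on a b (\<lambda>x. integral {a..x} f)"
  unfolding absolutely_continuous_on_iff
proof (intro allI impI)
  fix e :: real assume e: "e > 0"
  define m where "m n x = min (cmod (f x)) (real n)" for n x
  have nf: "(\<lambda>x. cmod (f x)) absolutely_integrable_on {a..b}"
    using absolutely_integrable_norm[OF f] by (simp add: comp_def)
  have mint: "m n absolutely_integrable_on {a..b}" for n
    unfolding m_def by (rule absolutely_integrable_min_1[OF nf]) simp
  have mi: "m n integrable_on {s..t}" if "a \<le> s" "t \<le> b" for n s t
    using mint[of n] that by (meson absolutely_integrable_on_def atLeastatMost_subset_iff integrable_on_subinterval)
  have ni: "(\<lambda>x. cmod (f x)) integrable_on {s..t}" if "a \<le> s" "t \<le> b" for s t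
    using nf that by (meson absolutely_integrable_on_def atLeastatMost_subset_iff integrable_on_subinterval)
  have "(\<lambda>n. integral {a..b} (m n)) \<longlonglongrightarrow> integral {a..b} (\<lambda>x. cmod (f x))"
  proof (rule dominated_convergence(2))
    show "m n integrable_on {a..b}" for n using mi by simp
    show "(\<lambda>x. cmod (f x)) integrable_on {a..b}" using ni by simp
    show "norm (m n x) \<le> cmod (f x)" for n x by (simp add: m_def)
    show "(\<lambda>n. m n x) \<longlonglongrightarrow> cmod (f x)" for x
    proof (rule tendsto_eventually)
      obtain N where "cmod (f x) \<le> real N" using real_arch_simple by blast
      then show "\<forall>\<^sub>F n in sequentially. m n x = cmod (f x)"
        by (intro eventually_sequentiallyI[of N]) (auto simp: m_def min_def)
    qed
  qed
  then have "\<forall>\<^sub>F n in sequentially. dist (integral {a..b} (m n)) (integral {a..b} (\<lambda>x. cmod (f x))) < e / 2"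
    using tendstoD[of _ _ _ "e / 2"] e by simp
  then obtain n where n: "\<bar>integral {a..b} (m n) - integral {a..b} (\<lambda>x. cmod (f x))\<bar> < e / 2"
    by (auto simp: eventually_sequentially dist_real_def)
  define h where "h x = cmod (f x) - m n x" for x
  have h0: "h x \<ge> 0" for x by (simp add: h_def m_def)
  have hi: "h integrable_on {s..t}" if "a \<le> s" "t \<le> b" for s t
    unfolding h_def using ni mi that by (intro integrable_diff) auto
  have "integral {a..b} h = integral {a..b} (\<lambda>x. cmod (f x)) - integral {a..b} (m n)"
    unfolding h_def by (rule integral_diff) (auto intro: ni mi)
  then have hab: "integral {a..b} h < e / 2"
    using n by linarith
  show "\<exists>d>0. \<forall>P. subinterval_family a b P \<longrightarrow>
        (\<Sum>(s, t)\<in>P. t - s) < d \<longrightarrow> (\<Sum>(s, t)\<in>P. cmod (integral {a..t} f - integral {a..s} f)) < e"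
  \<comment> \<open>With this total length the truncated part contributes at most e/2;
    \<open>n + 1\<close> avoids a division by 0.\<close>
  proof (intro exI[of _ "e / (2 * real (n + 1))"] conjI allI impI)
    fix P :: "(real \<times> real) set"
    assume "subinterval_family a b P" and lt: "(\<Sum>(s, t)\<in>P. t - s) < e / (2 * real (n + 1))"
    then have P: "finite P" "\<forall>(s, t)\<in>P. a \<le> s \<and> s < t \<and> t \<le> b"
        "pairwise (\<lambda>(s, t) (s', t'). disjnt {s<..<t} {s'<..<t'}) P"
      by (auto simp: subinterval_family_def)
    have "(\<Sum>(s, t)\<in>P. cmod (integral {a..t} f - integral {a..s} f)) \<le> (\<Sum>(s, t)\<in>P. integral {s..t} h + real n * (t - s))"
    proof (rule sum_mono, clarify)
      fix s t assume "(s,t) \<in> P"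
      then have st: "a \<le> s" "s < t" "t \<le> b" using P by auto
      have fi: "f integrable_on {s'..t'}" if "a \<le> s'" "t' \<le> b" for s' t'
        using f that by (meson absolutely_integrable_on_def atLeastatMost_subset_iff integrable_on_subinterval)
      have "integral {a..t} f - integral {a..s} f = integral {s..t} f"
        using Henstock_Kurzweil_Integration.integral_combine[of a s t f] fi[of a t] st by (simp add: algebra_simps)
      then have "cmod (integral {a..t} f - integral {a..s} f) \<le> integral {s..t} (\<lambda>x. cmod (f x))"
        using integral_norm_bound_integral[of f "{s..t}" "\<lambda>x. cmod (f x)"] fi[of s t] ni[of s t] st by simp
      also have "\<dots> = integral {s..t} (\<lambda>x. h x + m n x)" by (simp add: h_def)
      also have "\<dots> = integral {s..t} h + integral {s..t} (m n)"
        using hi mi st by (intro integral_add) auto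
      also have "integral {s..t} (m n) \<le> integral {s..t} (\<lambda>x. real n)"
        using mi st by (intro integral_le) (auto simp: m_def)
      also have "\<dots> = real n * (t - s)" using st by simp
      finally show "cmod (integral {a..t} f - integral {a..s} f) \<le> integral {s..t} h + real n * (t - s)" by simp
    qed
    also have "\<dots> = (\<Sum>(s, t)\<in>P. integral {s..t} h) + real n * (\<Sum>(s, t)\<in>P. t - s)"
      by (simp add: split_def sum.distrib sum_distrib_left)
    also have "real n * (\<Sum>(s, t)\<in>P. t - s) \<le> real n * (e / (2 * real (n + 1)))"
      using lt by (intro mult_left_mono) auto
    also have "\<dots> \<le> e / 2" using e by (simp add: field_simps)
    also have "(\<Sum>(s, t)\<in>P. integral {s..t} h) \<le> integral {a..b} h"
    proof -
      define I where "I = (\<lambda>(s::real,t). {s..t})"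
      have inj: "inj_on I P"
        using P(2) by (intro inj_onI) (fastforce simp: I_def)
      have div: "I ` P division_of \<Union>(I ` P)"
        unfolding division_of_def
      proof (intro conjI ballI allI impI)
        fix K assume "K \<in> I ` P"
        then obtain s t where K: "K = {s..t}" "(s,t) \<in> P" by (auto simp: I_def)
        show "K \<noteq> {}" using K P by fastforce
        show "\<exists>a b. K = cbox a b" using K by auto
      next
        fix K L assume KL: "K \<in> I ` P" "L \<in> I ` P" "K \<noteq> L"
        then obtain s t s' t' where *: "K = {s..t}" "(s,t) \<in> P" "L = {s'..t'}" "(s',t') \<in> P"
          by (auto simp: I_def)
        then have "(s,t) \<noteq> (s',t')" using KL by auto
        then show "interior K \<inter> interior L = {}"
          using P(3) * by (fastforce simp: pairwise_def disjnt_def)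
      qed (use P in auto)
      have sub: "\<Union>(I ` P) \<subseteq> {a..b}" using P(2) by (fastforce simp: I_def)
      have hU: "h integrable_on \<Union>(I ` P)"
        using sub hi[of a b] by (intro integrable_on_subdivision[OF div]) (auto simp: box_real)
      have "(\<Sum>(s, t)\<in>P. integral {s..t} h) = (\<Sum>K\<in>I ` P. integral K h)"
        unfolding sum.reindex[OF inj] by (simp add: I_def split_def)
      also have "\<dots> = integral (\<Union>(I ` P)) h"
        using integral_combine_division_topdown[OF hU div] by simp
      also have "\<dots> \<le> integral {a..b} h"
        using h0 hU hi[of a b] sub by (intro integral_subset_le) auto
      finally show ?thesis .
    qed
    finally show "(\<Sum>(s, t)\<in>P. cmod (integral {a..t} f - integral {a..s} f)) < e"
      using hab by (simp add: field_simps)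
  qed (use e in auto)
qed

text \<open>On the open interval \<open>F\<close> and the indefinite integral of \<open>f\<close>
  differ by a constant, and the latter is continuous up to the ends, so limits of \<open>F\<close>
  can replace its end values. This is the form needed on a cell, where derivatives have only
  one-sided limits at the ends.\<close>

lemma has_integral_limits_absolutely_continuous:
  fixes F f :: "real \<Rightarrow> complex"
  assumes ab: "a < b"
    and AC: "\<And>s t. \<lbrakk>a < s; s \<le> t; t < b\<rbrakk> \<Longrightarrow> absolutely_continuous_on s t F"
    and N: "negligible N"
    and der: "\<And>x. x \<in> {a<..<b} - N \<Longrightarrow> (F has_vector_derivative f x) (at x)"
    and f: "f integrable_on {a..b}"
    and A: "(F \<longlongrightarrow> A) (at_right a)" and B: "(F \<longlongrightarrow> B) (at_left b)"
  shows "(f has_integral B - A) {a..b}"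
proof -
  define G where "G x = integral {a..x} f" for x
  have contG: "continuous_on {a..b} G"
    unfolding G_def by (rule indefinite_integral_continuous_1[OF f])
  define m where "m = (a + b) / 2"
  have m: "a < m" "m < b" using ab by (auto simp: m_def)
  have diff: "G t - G s = F t - F s" if "a < s" "s \<le> t" "t < b" for s t
  proof -
    have "(f has_integral F t - F s) {s..t}"
      by (rule fundamental_theorem_absolutely_continuous[OF that(2) AC[OF that] N]) (use that der in auto)
    moreover have "f integrable_on {a..t}" using f that by (auto intro: integrable_on_subinterval)
    ultimately show ?thesis
      using Henstock_Kurzweil_Integration.integral_combine[of a s t f] that
      by (auto simp: G_def integral_unique algebra_simps)
  qed
  have eq: "G x = F x + (G m - F m)" if "a < x" "x < b" for x
    using diff[of x m] diff[of m x] that m by (cases "x \<le> m") (auto simp: algebra_simps)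
  have "(G \<longlongrightarrow> G a) (at_right a)" "(G \<longlongrightarrow> G b) (at_left b)"
    using contG ab by (auto simp: continuous_on_def at_within_Icc_at_right at_within_Icc_at_left dest: bspec[of _ _ a] bspec[of _ _ b])
  moreover have "(G \<longlongrightarrow> A + (G m - F m)) (at_right a)"
  proof (rule Lim_transform_eventually)
    show "((\<lambda>x. F x + (G m - F m)) \<longlongrightarrow> A + (G m - F m)) (at_right a)"
      by (intro tendsto_intros A)
    show "\<forall>\<^sub>F x in at_right a. F x + (G m - F m) = G x"
      using eq ab by (auto simp: eventually_at_right_field intro!: exI[of _ b])
  qed
  moreover have "(G \<longlongrightarrow> B + (G m - F m)) (at_left b)"
  proof (rule Lim_transform_eventually)
    show "((\<lambda>x. F x + (G m - F m)) \<longlongrightarrow> B + (G m - F m)) (at_left b)"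
      by (intro tendsto_intros B)
    show "\<forall>\<^sub>F x in at_left b. F x + (G m - F m) = G x"
      using eq ab by (auto simp: eventually_at_left_field intro!: exI[of _ a])
  qed
  ultimately have "G a = A + (G m - F m)" "G b = B + (G m - F m)"
    using tendsto_unique trivial_limit_at_right_real trivial_limit_at_left_real by blast+
  then have "G b - G a = B - A" by simp
  then have "integral {a..b} f = B - A" by (simp add: G_def)
  then show ?thesis using f by (metis has_integral_integral)
qed

section \<open>The Hilbert space and unbounded operators\<close>

lemma half_line_sets [simp]: "half_line \<in> sets lebesgue"
  by simp

text \<open>Allows null sets of the restricted Lebesgue measure and negligible sets of the gauge
  integral to be exchanged; both kinds of argument occur below.\<close>

lemma AE_half_line_iff:
  "(AE x in half_line_measure. P x) \<longleftrightarrow> (\<exists>N. negligible N \<and> (\<forall>x\<ge>0. x \<notin> N \<longrightarrow> P x))"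
proof -
  have "(AE x in half_line_measure. P x) \<longleftrightarrow> (AE x in lebesgue. x \<in> half_line \<longrightarrow> P x)"
    by (subst AE_restrict_space_iff) auto
  also have "\<dots> \<longleftrightarrow> negligible {x. \<not> (0 \<le> x \<longrightarrow> P x)}"
    by (simp add: completion.AE_iff_null_sets negligible_iff_null_sets)
  also have "\<dots> \<longleftrightarrow> (\<exists>N. negligible N \<and> (\<forall>x\<ge>0. x \<notin> N \<longrightarrow> P x))"
    by (auto intro: negligible_subset)
  finally show ?thesis .
qed

lemma half_line_measurable_AE:
  fixes f g :: "real \<Rightarrow> complex"
  assumes f: "f \<in> borel_measurable half_line_measure" and ae: "AE x in half_line_measure. f x = g x"
  shows "g \<in> borel_measurable half_line_measure"
proof -
  obtain N where N: "negligible N" "\<And>x. x \<ge> 0 \<Longrightarrow> x \<notin> N \<Longrightarrow> f x = g x"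
    using ae by (auto simp: AE_half_line_iff)
  have "(\<lambda>x. if x \<in> half_line then f x else 0) \<in> borel_measurable lebesgue"
    using f by (subst borel_measurable_if_D borel_measurable_if) auto
  moreover have "AE x in lebesgue. (if x \<in> half_line then f x else 0) = (if x \<in> half_line then g x else 0)"
    using N by (intro AE_I'[of N]) (auto simp: negligible_iff_null_sets)
  ultimately have "(\<lambda>x. if x \<in> half_line then g x else 0) \<in> borel_measurable lebesgue"
    by (rule borel_measurable_AE)
  then show ?thesis using borel_measurable_if[OF half_line_sets, of g] by blast
qed

lemma borel_measurable_cnj [measurable (raw)]:
  "f \<in> borel_measurable M \<Longrightarrow> (\<lambda>x. cnj (f x)) \<in> borel_measurable M"
  by (rule measurable_compose[of f M borel cnj]) (auto intro!: borel_measurable_continuous_onI continuous_intros)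

lemma L2_measurable: "f \<in> L2 \<Longrightarrow> f \<in> borel_measurable half_line_measure"
  and L2_integrable: "f \<in> L2 \<Longrightarrow> integrable half_line_measure (\<lambda>x. (cmod (f x))\<^sup>2)"
  by (auto simp: L2_def)

lemma L2_dominated:
  assumes "F \<in> L2" "f \<in> borel_measurable half_line_measure"
    and "AE x in half_line_measure. cmod (f x) \<le> B * cmod (F x)"
  shows "f \<in> L2"
  unfolding L2_def mem_Collect_eq
proof
  show "integrable half_line_measure (\<lambda>x. (cmod (f x))\<^sup>2)"
  proof (rule Bochner_Integration.integrable_bound)
    show "integrable half_line_measure (\<lambda>x. B\<^sup>2 * (cmod (F x))\<^sup>2)"
      using L2_integrable[OF assms(1)] by simp
    show "AE x in half_line_measure. norm ((cmod (f x))\<^sup>2) \<le> norm (B\<^sup>2 * (cmod (F x))\<^sup>2)"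
      using assms(3)
    proof eventually_elim
      case (elim x)
      then have "(cmod (f x))\<^sup>2 \<le> (B * cmod (F x))\<^sup>2" by (intro power_mono) auto
      then show ?case by (simp add: power_mult_distrib)
    qed
  qed (use assms(2) in measurable)
qed (use assms in auto)

lemma L2_cong_AE:
  assumes "f \<in> L2" "L2_eq f g"
  shows "g \<in> L2"
proof (rule L2_dominated[OF assms(1), of _ 1])
  show "g \<in> borel_measurable half_line_measure"
    using half_line_measurable_AE[OF L2_measurable[OF assms(1)]] assms(2) by (simp add: L2_eq_def)
  show "AE x in half_line_measure. cmod (g x) \<le> 1 * cmod (f x)"
    using assms(2) unfolding L2_eq_def by eventually_elim auto
qed

lemma L2_zero [simp]: "(\<lambda>x. 0) \<in> L2"
  by (simp add: L2_def)

lemma L2_mult_integrable: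
  assumes "f \<in> L2" "g \<in> L2"
  shows "integrable half_line_measure (\<lambda>x. cmod (f x) * cmod (g x))"
proof (rule Bochner_Integration.integrable_bound)
  show "integrable half_line_measure (\<lambda>x. (cmod (f x))\<^sup>2 + (cmod (g x))\<^sup>2)"
    using assms by (auto simp: L2_integrable)
  show "AE x in half_line_measure. norm (cmod (f x) * cmod (g x)) \<le> norm ((cmod (f x))\<^sup>2 + (cmod (g x))\<^sup>2)"
  proof (rule AE_I2)
    fix x
    have "cmod (f x) * cmod (g x) \<le> (cmod (f x))\<^sup>2 + (cmod (g x))\<^sup>2"
      using sum_squares_bound[of "cmod (f x)" "cmod (g x)"] mult_nonneg_nonneg[OF norm_ge_zero norm_ge_zero, of "f x" "g x"]
      unfolding mult.assoc by linarith
    then show "norm (cmod (f x) * cmod (g x)) \<le> norm ((cmod (f x))\<^sup>2 + (cmod (g x))\<^sup>2)" by simp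
  qed
qed (use L2_measurable[OF assms(1)] L2_measurable[OF assms(2)] in measurable)

lemma L2_square_expansion_integrable:
  assumes "f \<in> L2" "g \<in> L2"
  shows "integrable half_line_measure (\<lambda>x. (cmod (f x))\<^sup>2 + 2 * (cmod (f x) * cmod (g x)) + (cmod (g x))\<^sup>2)"
  by (intro Bochner_Integration.integrable_add Bochner_Integration.integrable_mult_right
      L2_integrable L2_mult_integrable assms)

lemma L2_inner_integrable:
  assumes "f \<in> L2" "g \<in> L2"
  shows "integrable half_line_measure (\<lambda>x. f x * cnj (g x))"
proof (rule Bochner_Integration.integrable_bound[OF L2_mult_integrable[OF assms]])
  show "(\<lambda>x. f x * cnj (g x)) \<in> borel_measurable half_line_measure"
    using L2_measurable[OF assms(1)] L2_measurable[OF assms(2)] by measurable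
qed (auto simp: norm_mult)

lemma L2_cmult [simp]: "f \<in> L2 \<Longrightarrow> (\<lambda>x. c * f x) \<in> L2"
  by (rule L2_dominated[of f _ "cmod c"]) (auto dest: L2_measurable simp: norm_mult)

lemma L2_add [simp]:
  assumes "f \<in> L2" "g \<in> L2"
  shows "(\<lambda>x. f x + g x) \<in> L2"
  unfolding L2_def mem_Collect_eq
proof
  show m: "(\<lambda>x. f x + g x) \<in> borel_measurable half_line_measure"
    using L2_measurable[OF assms(1)] L2_measurable[OF assms(2)] by measurable
  show "integrable half_line_measure (\<lambda>x. (cmod (f x + g x))\<^sup>2)"
  proof (rule Bochner_Integration.integrable_bound)
    show "integrable half_line_measure (\<lambda>x. (cmod (f x))\<^sup>2 + 2 * (cmod (f x) * cmod (g x)) + (cmod (g x))\<^sup>2)"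
      by (rule L2_square_expansion_integrable[OF assms])
    show "AE x in half_line_measure. norm ((cmod (f x + g x))\<^sup>2)
        \<le> norm ((cmod (f x))\<^sup>2 + 2 * (cmod (f x) * cmod (g x)) + (cmod (g x))\<^sup>2)"
    proof (rule AE_I2)
      fix x
      have "(cmod (f x + g x))\<^sup>2 \<le> (cmod (f x) + cmod (g x))\<^sup>2"
        by (intro power_mono norm_triangle_ineq) auto
      then show "norm ((cmod (f x + g x))\<^sup>2)
        \<le> norm ((cmod (f x))\<^sup>2 + 2 * (cmod (f x) * cmod (g x)) + (cmod (g x))\<^sup>2)"
        by (simp add: power2_sum algebra_simps)
    qed
  qed (use m in measurable)
qed

lemma L2_uminus [simp]: "f \<in> L2 \<Longrightarrow> (\<lambda>x. - f x) \<in> L2"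
  using L2_cmult[of f "-1"] by simp

lemma L2_diff [simp]: "f \<in> L2 \<Longrightarrow> g \<in> L2 \<Longrightarrow> (\<lambda>x. f x - g x) \<in> L2"
  using L2_add[of f "\<lambda>x. - g x"] by simp

lemma L2_norm_nonneg [simp]: "L2_norm f \<ge> 0"
  by (simp add: L2_norm_def)

lemma L2_norm_square: "(L2_norm f)\<^sup>2 = (\<integral>x. (cmod (f x))\<^sup>2 \<partial>half_line_measure)"
  by (simp add: L2_norm_def)

lemma L2_inner_self: "L2_inner f f = of_real ((L2_norm f)\<^sup>2)"
  unfolding L2_inner_def L2_norm_square
  by (simp add: complex_norm_square[symmetric] flip: integral_complex_of_real)

lemma L2_norm_mono:
  assumes "g \<in> L2" "AE x in half_line_measure. cmod (f x) \<le> cmod (g x)"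
  shows "L2_norm f \<le> L2_norm g"
  unfolding L2_norm_def
proof (rule real_sqrt_le_mono, rule integral_mono_AE')
  show "integrable half_line_measure (\<lambda>x. (cmod (g x))\<^sup>2)" by (rule L2_integrable[OF assms(1)])
  show "AE x in half_line_measure. (cmod (f x))\<^sup>2 \<le> (cmod (g x))\<^sup>2"
    using assms(2) by eventually_elim (auto intro: power_mono)
qed auto

lemma L2_norm_cong_AE:
  assumes "L2_eq f g" "f \<in> L2"
  shows "L2_norm f = L2_norm g"
proof (rule order.antisym)
  show "L2_norm f \<le> L2_norm g"
    using assms L2_cong_AE[OF assms(2,1)] by (intro L2_norm_mono) (auto simp: L2_eq_def elim: eventually_mono)
  show "L2_norm g \<le> L2_norm f"
    using assms by (intro L2_norm_mono) (auto simp: L2_eq_def elim: eventually_mono)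
qed

lemma L2_norm_cmult: "L2_norm (\<lambda>x. c * f x) = cmod c * L2_norm f"
  by (simp add: L2_norm_def norm_mult power_mult_distrib real_sqrt_mult)

text \<open>Integrating 2 s t |f| |g| <= s^2 |f|^2 + t^2 |g|^2 leaves two free parameters;
  \<open>s = L2_norm g\<close> and \<open>t = L2_norm f\<close> give the claim if neither norm is 0.
  The version with moduli inside the integral also yields the triangle inequality.\<close>

lemma L2_Cauchy_Schwarz_norm:
  assumes f: "f \<in> L2" and g: "g \<in> L2"
  shows "(\<integral>x. cmod (f x) * cmod (g x) \<partial>half_line_measure) \<le> L2_norm f * L2_norm g"
proof -
  define I where "I = (\<integral>x. cmod (f x) * cmod (g x) \<partial>half_line_measure)"
  define A where "A = L2_norm f"
  define B where "B = L2_norm g"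
  have AB: "A \<ge> 0" "B \<ge> 0" by (auto simp: A_def B_def)
  have I0: "I \<ge> 0" unfolding I_def by (rule integral_nonneg_AE) auto
  have quad: "2 * s * t * I \<le> s\<^sup>2 * A\<^sup>2 + t\<^sup>2 * B\<^sup>2" for s t
  proof -
    have "2 * s * t * I = (\<integral>x. 2 * s * t * (cmod (f x) * cmod (g x)) \<partial>half_line_measure)"
      unfolding I_def by simp
    also have "\<dots> \<le> (\<integral>x. s\<^sup>2 * (cmod (f x))\<^sup>2 + t\<^sup>2 * (cmod (g x))\<^sup>2 \<partial>half_line_measure)"
    proof (rule integral_mono)
      fix x
      show "2 * s * t * (cmod (f x) * cmod (g x)) \<le> s\<^sup>2 * (cmod (f x))\<^sup>2 + t\<^sup>2 * (cmod (g x))\<^sup>2"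
        using sum_squares_bound[of "s * cmod (f x)" "t * cmod (g x)"]
        by (simp add: power_mult_distrib algebra_simps)
    qed (use f g in \<open>auto intro!: L2_mult_integrable simp: L2_integrable\<close>)
    also have "\<dots> = s\<^sup>2 * A\<^sup>2 + t\<^sup>2 * B\<^sup>2"
      using f g by (simp add: A_def B_def L2_norm_square L2_integrable)
    finally show ?thesis .
  qed
  show "I \<le> L2_norm f * L2_norm g" unfolding A_def[symmetric] B_def[symmetric]
  proof (cases "A = 0 \<or> B = 0")
    case False
    then have pos: "A * B > 0" using AB by simp
    have "2 * (A * B) * I \<le> 2 * (A * B) * (A * B)"
      using quad[of B A] by (simp add: power2_eq_square algebra_simps)
    then show "I \<le> A * B" by (rule mult_left_le_imp_le) (use pos in simp)
  next
    case True
    have "I \<le> 0"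
    proof (rule ccontr)
      assume "\<not> I \<le> 0"
      then have I: "I > 0" by simp
      show False
      \<comment> \<open>The parameter that multiplies a vanishing norm costs nothing on the right,
        so a large value of it contradicts \<open>quad\<close> when \<open>I > 0\<close>.\<close>
      proof (cases "A = 0")
        case True
        then have "2 * (B\<^sup>2 + 1) \<le> B\<^sup>2" using quad[of "(B\<^sup>2 + 1) / I" 1] I by simp
        then show False using zero_le_power2[of B] by simp
      next
        case False
        then have "B = 0" using \<open>A = 0 \<or> B = 0\<close> by auto
        then have "2 * (A\<^sup>2 + 1) \<le> A\<^sup>2" using quad[of 1 "(A\<^sup>2 + 1) / I"] I by simp
        then show False using zero_le_power2[of A] by simp
      qed
    qed
    then show "I \<le> A * B" using True by auto
  qed
qed

lemma L2_Cauchy_Schwarz: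
  assumes "f \<in> L2" "g \<in> L2"
  shows "cmod (L2_inner f g) \<le> L2_norm f * L2_norm g"
proof -
  have "cmod (L2_inner f g) \<le> (\<integral>x. cmod (f x) * cmod (g x) \<partial>half_line_measure)"
    unfolding L2_inner_def
    using integral_norm_bound[of half_line_measure "\<lambda>x. f x * cnj (g x)"] by (simp add: norm_mult)
  then show ?thesis using L2_Cauchy_Schwarz_norm[OF assms] by simp
qed

lemma L2_norm_triangle:
  assumes f: "f \<in> L2" and g: "g \<in> L2"
  shows "L2_norm (\<lambda>x. f x + g x) \<le> L2_norm f + L2_norm g"
proof (rule power2_le_imp_le)
  have "(L2_norm (\<lambda>x. f x + g x))\<^sup>2
      \<le> (\<integral>x. (cmod (f x))\<^sup>2 + 2 * (cmod (f x) * cmod (g x)) + (cmod (g x))\<^sup>2 \<partial>half_line_measure)"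
    unfolding L2_norm_square
  proof (rule integral_mono)
    fix x
    have "(cmod (f x + g x))\<^sup>2 \<le> (cmod (f x) + cmod (g x))\<^sup>2"
      by (intro power_mono norm_triangle_ineq) auto
    then show "(cmod (f x + g x))\<^sup>2 \<le> (cmod (f x))\<^sup>2 + 2 * (cmod (f x) * cmod (g x)) + (cmod (g x))\<^sup>2"
      by (simp add: power2_sum algebra_simps)
  qed (use f g in \<open>auto intro!: L2_square_expansion_integrable simp: L2_integrable\<close>)
  also have "\<dots> = (L2_norm f)\<^sup>2 + 2 * (\<integral>x. cmod (f x) * cmod (g x) \<partial>half_line_measure) + (L2_norm g)\<^sup>2"
    using f g by (simp add: L2_norm_square L2_integrable L2_mult_integrable)
  also have "\<dots> \<le> (L2_norm f + L2_norm g)\<^sup>2"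
    using L2_Cauchy_Schwarz_norm[OF f g] by (simp add: power2_sum)
  finally show "(L2_norm (\<lambda>x. f x + g x))\<^sup>2 \<le> (L2_norm f + L2_norm g)\<^sup>2" .
qed auto

lemma L2_norm_zero_iff:
  assumes "f \<in> L2"
  shows "L2_norm f = 0 \<longleftrightarrow> L2_eq f (\<lambda>x. 0)"
proof -
  have "L2_norm f = 0 \<longleftrightarrow> (AE x in half_line_measure. (cmod (f x))\<^sup>2 = 0)"
    unfolding L2_norm_def
    using integral_nonneg_eq_0_iff_AE[OF L2_integrable[OF assms]] by simp
  then show ?thesis by (simp add: L2_eq_def)
qed

lemma L2_norm_dominated_convergence:
  assumes F: "F \<in> L2" and f: "\<And>n. f n \<in> borel_measurable half_line_measure"
    and bd: "\<And>n. AE x in half_line_measure. cmod (f n x) \<le> cmod (F x)"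
    and lim: "AE x in half_line_measure. (\<lambda>n. f n x) \<longlonglongrightarrow> 0"
  shows "(\<lambda>n. L2_norm (f n)) \<longlonglongrightarrow> 0"
proof -
  have "(\<lambda>n. \<integral>x. (cmod (f n x))\<^sup>2 \<partial>half_line_measure) \<longlonglongrightarrow> (\<integral>x. 0 \<partial>half_line_measure)"
  proof (rule integral_dominated_convergence)
    show "integrable half_line_measure (\<lambda>x. (cmod (F x))\<^sup>2)" by (rule L2_integrable[OF F])
    show "AE x in half_line_measure. (\<lambda>n. (cmod (f n x))\<^sup>2) \<longlonglongrightarrow> 0"
      using lim by eventually_elim (auto intro!: tendsto_eq_intros tendsto_norm_zero)
    show "AE x in half_line_measure. norm ((cmod (f n x))\<^sup>2) \<le> (cmod (F x))\<^sup>2" for n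
      using bd[of n] by eventually_elim (auto intro: power_mono)
    show "(\<lambda>x. (cmod (f n x))\<^sup>2) \<in> borel_measurable half_line_measure" for n
      using f[of n] by measurable
  qed simp
  then have "(\<lambda>n. sqrt (\<integral>x. (cmod (f n x))\<^sup>2 \<partial>half_line_measure)) \<longlonglongrightarrow> sqrt 0"
    by (intro tendsto_real_sqrt) simp
  then show ?thesis by (simp add: L2_norm_def)
qed

lemma L2_inner_add_left:
  "f \<in> L2 \<Longrightarrow> g \<in> L2 \<Longrightarrow> h \<in> L2 \<Longrightarrow> L2_inner (\<lambda>x. f x + g x) h = L2_inner f h + L2_inner g h"
  unfolding L2_inner_def by (simp add: distrib_right L2_inner_integrable)

lemma L2_inner_diff_left:
  "f \<in> L2 \<Longrightarrow> g \<in> L2 \<Longrightarrow> h \<in> L2 \<Longrightarrow> L2_inner (\<lambda>x. f x - g x) h = L2_inner f h - L2_inner g h"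
  unfolding L2_inner_def by (simp add: left_diff_distrib L2_inner_integrable)

lemma L2_inner_cmult_left: "L2_inner (\<lambda>x. c * f x) h = c * L2_inner f h"
  unfolding L2_inner_def by (simp add: mult.assoc)

lemma L2_inner_commute: "L2_inner g f = cnj (L2_inner f g)"
  unfolding L2_inner_def by (subst Bochner_Integration.integral_cnj[symmetric]) (simp add: mult.commute)

lemma L2_inner_add_right:
  "f \<in> L2 \<Longrightarrow> g \<in> L2 \<Longrightarrow> h \<in> L2 \<Longrightarrow> L2_inner h (\<lambda>x. f x + g x) = L2_inner h f + L2_inner h g"
  by (metis L2_inner_add_left L2_inner_commute complex_cnj_add)

lemma L2_inner_diff_right:
  "f \<in> L2 \<Longrightarrow> g \<in> L2 \<Longrightarrow> h \<in> L2 \<Longrightarrow> L2_inner h (\<lambda>x. f x - g x) = L2_inner h f - L2_inner h g"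
  by (metis L2_inner_diff_left L2_inner_commute complex_cnj_diff)

lemma L2_inner_cmult_right: "L2_inner h (\<lambda>x. c * f x) = cnj c * L2_inner h f"
  by (metis L2_inner_cmult_left L2_inner_commute complex_cnj_mult)

lemma L2_inner_cong:
  assumes "L2_eq f u" "L2_eq g v" "f \<in> L2" "g \<in> L2"
  shows "L2_inner f g = L2_inner u v"
  unfolding L2_inner_def
proof (rule integral_cong_AE)
  have "u \<in> L2" "v \<in> L2" using assms L2_cong_AE by blast+
  note [measurable] = L2_measurable[OF assms(3)] L2_measurable[OF assms(4)]
    L2_measurable[OF \<open>u \<in> L2\<close>] L2_measurable[OF \<open>v \<in> L2\<close>]
  show "(\<lambda>x. f x * cnj (g x)) \<in> borel_measurable half_line_measure"
    "(\<lambda>x. u x * cnj (v x)) \<in> borel_measurable half_line_measure" by measurable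
  show "AE x in half_line_measure. f x * cnj (g x) = u x * cnj (v x)"
    using assms(1,2) unfolding L2_eq_def by eventually_elim simp
qed

section \<open>Closures, adjoints and essential self-adjointness\<close>

lemma operator_closure_superset:
  assumes "T \<subseteq> L2 \<times> L2" shows "T \<subseteq> operator_closure T"
proof
  fix p assume p: "p \<in> T"
  obtain f g where fg: "p = (f, g)" by (cases p)
  have "L2_norm (\<lambda>x. f x - f x) = 0" "L2_norm (\<lambda>x. g x - g x) = 0" by (auto simp: L2_norm_def)
  then show "p \<in> operator_closure T"
    using p assms unfolding operator_closure_def fg by (auto intro!: bexI[of _ "(f,g)"])
qed

text \<open>The pairing is continuous in the graph norm by Cauchy-Schwarz, so the identity that
  defines the adjoint passes to limits of graph elements.\<close>

lemma L2_inner_operator_closure_adjoint: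
  assumes T: "T \<subseteq> L2 \<times> L2" and fg: "(f, g) \<in> operator_closure T" and hk: "(h, k) \<in> operator_adjoint T"
  shows "L2_inner g h = L2_inner f k"
proof -
  have L: "f \<in> L2" "g \<in> L2" "h \<in> L2" "k \<in> L2"
    using fg hk by (auto simp: operator_closure_def operator_adjoint_def)
  have "cmod (L2_inner g h - L2_inner f k) \<le> e" if e: "e > 0" for e
  proof -
    define d where "d = e / (L2_norm h + L2_norm k + 1)"
    have d: "d > 0" using e by (simp add: d_def add_nonneg_pos)
    obtain u v where uv: "(u,v) \<in> T" "L2_norm (\<lambda>x. f x - u x) < d" "L2_norm (\<lambda>x. g x - v x) < d"
      using fg d unfolding operator_closure_def by blast
    have uv2: "u \<in> L2" "v \<in> L2" "L2_inner v h = L2_inner u k"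
      using T uv hk by (auto simp: operator_adjoint_def)
    have "L2_inner g h - L2_inner f k = L2_inner (\<lambda>x. g x - v x) h - L2_inner (\<lambda>x. f x - u x) k"
      using L uv2 by (simp add: L2_inner_diff_left)
    also have "cmod \<dots> \<le> cmod (L2_inner (\<lambda>x. g x - v x) h) + cmod (L2_inner (\<lambda>x. f x - u x) k)"
      by (rule norm_triangle_ineq4)
    also have "\<dots> \<le> L2_norm (\<lambda>x. g x - v x) * L2_norm h + L2_norm (\<lambda>x. f x - u x) * L2_norm k"
      using L uv2 by (intro add_mono L2_Cauchy_Schwarz) auto
    also have "\<dots> \<le> d * L2_norm h + d * L2_norm k"
      using uv by (intro add_mono mult_right_mono) auto
    also have "\<dots> \<le> d * (L2_norm h + L2_norm k + 1)" using d by (simp add: algebra_simps)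
    also have "\<dots> = e"
      using add_nonneg_pos[of "L2_norm h + L2_norm k" 1] by (simp add: d_def)
    finally show ?thesis .
  qed
  then have "cmod (L2_inner g h - L2_inner f k) \<le> 0" by (rule field_le_epsilon) simp
  then show ?thesis by simp
qed

text \<open>Density enters through single-valuedness: the difference \<open>d\<close> of two images
  is orthogonal to the domain, and approximating \<open>d\<close> by domain elements gives
  \<open>(L2_norm d)\<^sup>2 \<le> e * L2_norm d\<close> for every e > 0.\<close>

lemma linear_operator_adjoint:
  assumes T: "T \<subseteq> L2 \<times> L2" and dense: "densely_defined T"
  shows "linear_operator (operator_adjoint T)"
  unfolding linear_operator_def
proof (intro conjI allI impI)
  show "operator_adjoint T \<subseteq> L2 \<times> L2" by (auto simp: operator_adjoint_def)
next
  fix f g u v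
  assume *: "(f, g) \<in> operator_adjoint T" "u \<in> L2" "v \<in> L2" "L2_eq f u" "L2_eq g v"
  have "L2_inner q u = L2_inner p v" if "(p,q) \<in> T" for p q
  proof -
    have "p \<in> L2" "q \<in> L2" using that T by auto
    moreover have "L2_eq p p" "L2_eq q q" by (auto simp: L2_eq_def)
    ultimately show ?thesis
      using L2_inner_cong[of q q f u] L2_inner_cong[of p p g v] * that
      by (auto simp: operator_adjoint_def)
  qed
  then show "(u, v) \<in> operator_adjoint T" using * by (auto simp: operator_adjoint_def)
next
  show "(\<lambda>x. 0, \<lambda>x. 0) \<in> operator_adjoint T" by (auto simp: operator_adjoint_def L2_inner_def)
next
  fix f g u v assume "(f, g) \<in> operator_adjoint T" "(u, v) \<in> operator_adjoint T"
  then show "(\<lambda>x. f x + u x, \<lambda>x. g x + v x) \<in> operator_adjoint T"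
    using T by (fastforce simp: operator_adjoint_def L2_inner_add_right)
next
  fix c f g assume "(f, g) \<in> operator_adjoint T"
  then show "(\<lambda>x. c * f x, \<lambda>x. c * g x) \<in> operator_adjoint T"
    using T by (fastforce simp: operator_adjoint_def L2_inner_cmult_right)
next
  fix f g v assume *: "(f, g) \<in> operator_adjoint T" "(f, v) \<in> operator_adjoint T"
  define d where "d = (\<lambda>x. g x - v x)"
  have L: "g \<in> L2" "v \<in> L2" "d \<in> L2" using * by (auto simp: operator_adjoint_def d_def)
  have orth: "L2_inner p d = 0" if "(p,q) \<in> T" for p q
  proof -
    have "p \<in> L2" using that T by auto
    then have "L2_inner p d = L2_inner p g - L2_inner p v" using L by (simp add: d_def L2_inner_diff_right)
    also have "L2_inner p g = L2_inner q f"
      using * that by (fastforce simp: operator_adjoint_def)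
    also have "L2_inner q f = L2_inner p v"
      using * that by (fastforce simp: operator_adjoint_def)
    finally show ?thesis by simp
  qed
  have "L2_norm d \<le> e" if e: "e > 0" for e
  proof -
    obtain p q where pq: "(p,q) \<in> T" "L2_norm (\<lambda>x. d x - p x) < e"
      using dense L(3) e unfolding densely_defined_def by blast
    have p: "p \<in> L2" using pq T by auto
    have "of_real ((L2_norm d)\<^sup>2) = L2_inner (\<lambda>x. d x - p x) d"
      using L p orth[OF pq(1)] by (simp add: L2_inner_diff_left L2_inner_self)
    then have "(L2_norm d)\<^sup>2 \<le> L2_norm (\<lambda>x. d x - p x) * L2_norm d"
      using L2_Cauchy_Schwarz[of "\<lambda>x. d x - p x" d] L p
      by (metis L2_diff norm_of_real abs_of_nonneg zero_le_power2)
    also have "\<dots> \<le> e * L2_norm d" using pq by (intro mult_right_mono) auto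
    finally have "L2_norm d * L2_norm d \<le> e * L2_norm d" by (simp add: power2_eq_square)
    then show ?thesis
      using L2_norm_nonneg[of d] e by (auto simp: mult_le_cancel_right)
  qed
  then have "L2_norm d \<le> 0" by (rule field_le_epsilon) simp
  then have "L2_norm d = 0" by (simp add: order.antisym)
  then have "L2_eq d (\<lambda>x. 0)" using L2_norm_zero_iff[OF L(3)] by simp
  then show "L2_eq g v" by (simp add: L2_eq_def d_def)
qed

text \<open>Symmetry puts the closure inside the adjoint by continuity of the pairing, so the two
  coincide, and closing a graph does not change its adjoint. That the closure is a linear operator
  is inherited from the adjoint.\<close>

theorem self_adjoint_operator_closureI:
  assumes T: "T \<subseteq> L2 \<times> L2" and dense: "densely_defined T"
    and sym: "T \<subseteq> operator_adjoint T" and adj: "operator_adjoint T \<subseteq> operator_closure T"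
  shows "self_adjoint (operator_closure T)"
proof -
  have sub: "operator_closure T \<subseteq> operator_adjoint T"
  proof clarify
    fix f g assume fg: "(f, g) \<in> operator_closure T"
    have "L2_inner q f = L2_inner p g" if "(p,q) \<in> T" for p q
    proof -
      have "L2_inner g p = L2_inner f q"
        using L2_inner_operator_closure_adjoint[OF T fg] sym that by blast
      then show ?thesis by (metis L2_inner_commute)
    qed
    then show "(f, g) \<in> operator_adjoint T"
      using fg by (auto simp: operator_adjoint_def operator_closure_def)
  qed
  with adj have eq: "operator_closure T = operator_adjoint T" by auto
  have "operator_adjoint (operator_closure T) = operator_adjoint T"
  proof (intro equalityI)
    show "operator_adjoint (operator_closure T) \<subseteq> operator_adjoint T"
      using operator_closure_superset[OF T] by (auto simp: operator_adjoint_def)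
    show "operator_adjoint T \<subseteq> operator_adjoint (operator_closure T)"
      using L2_inner_operator_closure_adjoint[OF T] by (auto simp: operator_adjoint_def)
  qed
  moreover have "densely_defined (operator_closure T)"
    using dense operator_closure_superset[OF T] unfolding densely_defined_def by blast
  ultimately show ?thesis
    using linear_operator_adjoint[OF T dense] eq by (simp add: self_adjoint_def)
qed

lemma semibounded_below_mono: "S \<subseteq> T \<Longrightarrow> semibounded_below T \<Longrightarrow> semibounded_below S"
  unfolding semibounded_below_def by blast

section \<open>Solutions with point interactions at the square roots\<close>

declare of_nat_Suc [simp del]

abbreviation pt :: "nat \<Rightarrow> real" where "pt n \<equiv> sqrt (real n)"

section \<open>Cells between consecutive square roots\<close>

definition grid :: "real set" where "grid = pt ` {1..}"

text \<open>For x >= 0 this is the index n of the half-open cell from \<open>pt n\<close> to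
  \<open>pt (Suc n)\<close> that contains x. Since \<open>pt 0 = 0\<close> is the boundary point and
  not an interaction centre, cell 0 is the only one whose left end lies off the grid.\<close>

definition cell :: "real \<Rightarrow> nat" where "cell x = nat \<lfloor>x\<^sup>2\<rfloor>"

lemma cell_eq_iff: "x \<ge> 0 \<Longrightarrow> cell x = n \<longleftrightarrow> pt n \<le> x \<and> x < pt (Suc n)"
proof -
  assume x: "x \<ge> 0"
  have "cell x = n \<longleftrightarrow> real n \<le> x\<^sup>2 \<and> x\<^sup>2 < real (Suc n)"
    unfolding cell_def by (auto simp: nat_eq_iff floor_eq_iff of_nat_Suc)
  moreover have "real n \<le> x\<^sup>2 \<longleftrightarrow> pt n \<le> x" using x by (metis real_sqrt_abs real_sqrt_le_iff abs_of_nonneg)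
  moreover have "x\<^sup>2 < real (Suc n) \<longleftrightarrow> x < pt (Suc n)" using x by (metis real_sqrt_abs real_sqrt_less_iff abs_of_nonneg)
  ultimately show ?thesis by simp
qed

lemma pt_cell: "x \<ge> 0 \<Longrightarrow> pt (cell x) \<le> x" "x \<ge> 0 \<Longrightarrow> x < pt (Suc (cell x))"
  using cell_eq_iff[of x "cell x"] by auto

lemma pt_in_grid: "n \<ge> 1 \<Longrightarrow> pt n \<in> grid"
  by (auto simp: grid_def)

lemma open_cell_grid: "pt n < x \<Longrightarrow> x < pt (Suc n) \<Longrightarrow> x \<notin> grid"
  by (auto simp: grid_def)

lemma zero_notin_grid [simp]: "0 \<notin> grid"
  by (auto simp: grid_def)

lemma grid_cases:
  assumes "x \<ge> 0" "x \<notin> grid"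
  obtains "x = 0" | n where "pt n < x" "x < pt (Suc n)"
proof (cases "x = pt (cell x)")
  case True
  then have "cell x = 0" using assms pt_in_grid[of "cell x"] by force
  then show thesis using True that by simp
next
  case False
  then show thesis using that pt_cell[of x] assms by force
qed

lemma countable_grid: "countable grid"
  by (simp add: grid_def)

lemma negligible_grid: "negligible grid"
  using countable_imp_null_set_lborel[OF countable_grid]
  by (simp add: negligible_iff_null_sets null_sets_completionI)

text \<open>Reduces local absolute continuity off the grid to a single cell: leaving the cell of
  \<open>s\<close> would mean passing its right end, which is a grid point.\<close>

lemma grid_avoiding_interval:
  assumes "s \<le> t" "{s..t} \<subseteq> half_line - grid"
  shows "pt (cell s) \<le> s" "t < pt (Suc (cell s))" "s = 0 \<or> pt (cell s) < s"
proof -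
  have s: "s \<ge> 0" "s \<notin> grid" using assms by auto
  show 1: "pt (cell s) \<le> s" using pt_cell s by auto
  show "t < pt (Suc (cell s))"
  proof (rule ccontr)
    assume "\<not> t < pt (Suc (cell s))"
    then have "pt (Suc (cell s)) \<in> {s..t}" using pt_cell(2)[OF s(1)] by auto
    then show False using assms pt_in_grid[of "Suc (cell s)"] by auto
  qed
  show "s = 0 \<or> pt (cell s) < s"
    using grid_cases[OF s] 1 cell_eq_iff[OF s(1)] by (metis less_imp_le)
qed

lemma at_within_half_line: "x > 0 \<Longrightarrow> at x within half_line = at x"
  by (rule at_within_interior) simp

lemma continuous_on_cells:
  assumes "\<And>n. continuous_on {pt n..pt (Suc n)} f"
  shows "continuous_on half_line f"
proof -
  have M: "continuous_on {0..pt M} f" for M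
  proof (induction M)
    case (Suc M)
    have "{0..pt (Suc M)} = {0..pt M} \<union> {pt M..pt (Suc M)}"
      by (rule ivl_disj_un_two_touch(4)[symmetric]) auto
    then show ?case using continuous_on_closed_Un[OF _ _ Suc assms[of M]] by simp
  qed simp
  show ?thesis
    unfolding continuous_on_def
  proof
    fix x :: real assume x: "x \<in> half_line"
    define b where "b = pt (Suc (cell x))"
    have b: "x < b" using pt_cell x by (simp add: b_def)
    have "at x within half_line = at x within {0..b}"
      by (rule at_within_nhd[of x "{..<b}"]) (use b in auto)
    then show "(f \<longlongrightarrow> f x) (at x within half_line)"
      using M[of "Suc (cell x)"] b x by (simp add: continuous_on_def b_def[symmetric])
  qed
qed

section \<open>Local solutions of u'' = g with interface conditions\<close>

text \<open>The equation is kept local, with no integrability at infinity and no condition at 0.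
  Here \<open>u\<close> is the continuous representative, so \<open>u (pt n)\<close> is the common
  one-sided limit. The derivative \<open>v\<close> is a separate argument because its values on the
  grid are arbitrary and only its one-sided limits matter there.\<close>

definition dsol :: "(nat \<Rightarrow> real) \<Rightarrow> (real \<Rightarrow> complex) \<Rightarrow> (real \<Rightarrow> complex) \<Rightarrow> (real \<Rightarrow> complex) \<Rightarrow> bool" where
  "dsol a u v g \<longleftrightarrow>
     continuous_on half_line u \<and>
     (\<forall>x\<in>half_line - grid. (u has_vector_derivative v x) (at x within half_line)) \<and>
     v \<in> AC_loc (half_line - grid) \<and>
     (AE x in half_line_measure. (v has_vector_derivative g x) (at x within half_line)) \<and>
     (\<forall>b. g absolutely_integrable_on {0..b}) \<and>
     (\<forall>n\<ge>1. \<exists>p. (v \<longlongrightarrow> p) (at_left (pt n)) \<and>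
        (v \<longlongrightarrow> p + of_real (a n) * u (pt n)) (at_right (pt n)))"

lemma dsolD:
  assumes "dsol a u v g"
  shows "continuous_on half_line u"
    "\<And>x. x \<ge> 0 \<Longrightarrow> x \<notin> grid \<Longrightarrow> (u has_vector_derivative v x) (at x within half_line)"
    "v \<in> AC_loc (half_line - grid)"
    "AE x in half_line_measure. (v has_vector_derivative g x) (at x within half_line)"
    "g absolutely_integrable_on {0..b}"
  using assms by (auto simp: dsol_def)

text \<open>Assembles a solution from pieces that are regular up to both ends of their closed cells.
  At a grid point \<open>cell\<close> selects the piece to the right; the matching conditions then
  supply continuity of \<open>u\<close> and the jump of \<open>v\<close>.\<close>

lemma dsol_cellsI:
  fixes U V :: "nat \<Rightarrow> real \<Rightarrow> complex"
  assumes U: "\<And>n x. pt n \<le> x \<Longrightarrow> x \<le> pt (Suc n) \<Longrightarrow> (U n has_vector_derivative V n x) (at x within half_line)"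
    and V: "\<And>n. absolutely_continuous_on (pt n) (pt (Suc n)) (V n)"
    and der: "AE x in half_line_measure. \<forall>n. pt n < x \<longrightarrow> x < pt (Suc n) \<longrightarrow> (V n has_vector_derivative g x) (at x)"
    and g: "\<And>b. g absolutely_integrable_on {0..b}"
    and cont: "\<And>n. U (Suc n) (pt (Suc n)) = U n (pt (Suc n))"
    and jump: "\<And>n. V (Suc n) (pt (Suc n)) = V n (pt (Suc n)) + of_real (a (Suc n)) * U n (pt (Suc n))"
  shows "dsol a (\<lambda>x. U (cell x) x) (\<lambda>x. V (cell x) x) g"
proof -
  define u where "u = (\<lambda>x. U (cell x) x)"
  define v where "v = (\<lambda>x. V (cell x) x)"
  have cell: "cell x = n" if "pt n \<le> x" "x < pt (Suc n)" for n x
    using that cell_eq_iff[of x n] by (meson order_trans real_sqrt_ge_zero of_nat_0_le_iff)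
  have u: "u x = U n x" if "pt n \<le> x" "x \<le> pt (Suc n)" for n x
  proof (cases "x = pt (Suc n)")
    case True
    then have "cell x = Suc n" using cell[of "Suc n" x] by simp
    then show ?thesis using True cont by (simp add: u_def)
  next
    case False
    then show ?thesis using cell[of n x] that by (simp add: u_def)
  qed
  have v: "v x = V n x" if "pt n \<le> x" "x < pt (Suc n)" for n x
    using cell[of n x] that by (simp add: v_def)
  have sub: "{pt n..pt (Suc n)} \<subseteq> half_line" for n by (auto intro: order_trans)
  have Uc: "continuous_on {pt n..pt (Suc n)} (U n)" for n
  proof (rule continuous_on_vector_derivative)
    fix x assume "x \<in> {pt n..pt (Suc n)}"
    then show "(U n has_vector_derivative V n x) (at x within {pt n..pt (Suc n)})"
      using has_vector_derivative_within_subset[OF U sub] by auto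
  qed
  have Vc: "continuous_on {pt n..pt (Suc n)} (V n)" for n
    by (rule absolutely_continuous_on_imp_continuous_on[OF V])
  have lims: "(V n \<longlongrightarrow> V n (pt n)) (at_right (pt n))" "(V n \<longlongrightarrow> V n (pt (Suc n))) (at_left (pt (Suc n)))" for n
    using Vc[of n] unfolding continuous_on_def
    by (auto simp: at_within_Icc_at_right at_within_Icc_at_left dest: bspec[of _ _ "pt n"] bspec[of _ _ "pt (Suc n)"])
  have vR: "(v \<longlongrightarrow> V n (pt n)) (at_right (pt n))" for n
  proof (rule Lim_transform_eventually[OF lims(1)])
    show "\<forall>\<^sub>F x in at_right (pt n). V n x = v x"
      using v by (auto simp: eventually_at_right_field intro!: exI[of _ "pt (Suc n)"] v[symmetric])
  qed
  have vL: "(v \<longlongrightarrow> V n (pt (Suc n))) (at_left (pt (Suc n)))" for n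
  proof (rule Lim_transform_eventually[OF lims(2)])
    show "\<forall>\<^sub>F x in at_left (pt (Suc n)). V n x = v x"
      by (auto simp: eventually_at_left_field intro!: exI[of _ "pt n"] v[symmetric])
  qed
  show ?thesis
    unfolding dsol_def u_def[symmetric] v_def[symmetric]
  proof (intro conjI ballI allI impI)
    show "continuous_on half_line u"
    proof (rule continuous_on_cells)
      show "continuous_on {pt n..pt (Suc n)} u" for n
        by (rule continuous_on_eq[OF Uc]) (use u in auto)
    qed
  next
    fix x assume "x \<in> half_line - grid"
    then have x: "x \<ge> 0" "x \<notin> grid" by auto
    define n where "n = cell x"
    have n: "pt n \<le> x" "x < pt (Suc n)" using pt_cell x by (auto simp: n_def)
    have "\<exists>d>0. \<forall>y\<in>half_line. dist y x < d \<longrightarrow> pt n \<le> y \<and> y < pt (Suc n)"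
    proof (cases "x = 0")
      case True
      then have "n = 0" by (simp add: n_def cell_def)
      then show ?thesis using True by (intro exI[of _ 1]) (auto simp: dist_real_def of_nat_Suc)
    next
      case False
      have "pt n < x" using grid_cases[OF x] False n cell_eq_iff[OF x(1)] n_def by (metis less_imp_le)
      then show ?thesis using n
        by (intro exI[of _ "min (x - pt n) (pt (Suc n) - x)"]) (auto simp: dist_real_def abs_if split: if_splits)
    qed
    then obtain d where d: "d > 0" "\<And>y. y \<in> half_line \<Longrightarrow> dist y x < d \<Longrightarrow> pt n \<le> y \<and> y < pt (Suc n)" by blast
    have "(U n has_vector_derivative v x) (at x within half_line)"
      using U[of n x] v[of n x] n by simp
    then show "(u has_vector_derivative v x) (at x within half_line)"
    proof (rule has_vector_derivative_transform_within[OF _ d(1)])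
      show "U n y = u y" if "y \<in> half_line" "dist y x < d" for y
        using d(2)[OF that] u[of n y] by simp
    qed (use x in simp)
  next
    show "v \<in> AC_loc (half_line - grid)"
      unfolding AC_loc_def
    proof (intro CollectI allI impI)
      fix s t :: real assume st: "s \<le> t" "{s..t} \<subseteq> half_line - grid"
      note * = grid_avoiding_interval[OF st]
      show "absolutely_continuous_on s t v"
      proof (rule absolutely_continuous_on_cong)
        show "absolutely_continuous_on s t (V (cell s))"
          by (rule absolutely_continuous_on_subinterval[OF V]) (use * in auto)
        show "v x = V (cell s) x" if "x \<in> {s..t}" for x
          using that * by (intro v) auto
      qed
    qed
  next
    have "AE x in half_line_measure. x \<notin> grid \<union> {0}"
      unfolding AE_half_line_iff by (intro exI[of _ "grid \<union> {0}"]) (auto intro: negligible_Un negligible_grid)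
    with der AE_space show "AE x in half_line_measure. (v has_vector_derivative g x) (at x within half_line)"
    proof eventually_elim
      case (elim x)
      then have x: "x \<ge> 0" "x \<notin> grid" "x \<noteq> 0" by auto
      obtain n where n: "pt n < x" "x < pt (Suc n)" using grid_cases[OF x(1,2)] x(3) by metis
      have "(V n has_vector_derivative g x) (at x)" using elim n by auto
      then have "(v has_vector_derivative g x) (at x)"
        by (rule has_vector_derivative_transform_within_open[of _ _ _ "{pt n<..<pt (Suc n)}"])
           (use n in \<open>auto intro!: v[symmetric]\<close>)
      then show ?case by (rule has_vector_derivative_at_within)
    qed
  next
    fix n :: nat assume "n \<ge> 1"
    then obtain m where m: "n = Suc m" by (cases n) auto
    show "\<exists>p. (v \<longlongrightarrow> p) (at_left (pt n)) \<and> (v \<longlongrightarrow> p + of_real (a n) * u (pt n)) (at_right (pt n))"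
      using vL[of m] vR[of n] jump[of m] u[of m "pt n"] by (intro exI[of _ "V m (pt n)"]) (simp add: m)
  qed (rule g)
qed

text \<open>On each cell the solution is the second antiderivative \<open>KK\<close> of
  \<open>g\<close> plus an affine function; continuity and the jump condition determine the value
  and the slope of the affine part from one cell to the next.\<close>

lemma dsol_exists:
  assumes g: "\<And>b. g absolutely_integrable_on {0..b}"
  obtains u v where "dsol a u v g" "u 0 = c" "v 0 = d"
proof -
  define K where "K x = integral {0..x} g" for x
  define KK where "KK x = integral {0..x} K" for x
  have gi: "g integrable_on {0..b}" for b using g by (auto simp: absolutely_integrable_on_def)
  have Kc: "continuous_on {0..b} K" for b
    unfolding K_def by (rule indefinite_integral_continuous_1[OF gi])
  have KK: "(KK has_vector_derivative K x) (at x within half_line)" if "x \<ge> 0" for x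
  proof -
    have "(KK has_vector_derivative K x) (at x within {0..x+1})"
      unfolding KK_def by (rule integral_has_vector_derivative[OF Kc]) (use that in auto)
    moreover have "at x within {0..x+1} = at x within half_line"
      by (rule at_within_nhd[of x "{..<x+1}"]) auto
    ultimately show ?thesis by simp
  qed
  \<comment> \<open>The state holds the value at \<open>pt n\<close> and the slope of the affine
    part. The slope grows by the strength times the value of the whole solution, which includes
    \<open>KK\<close>.\<close>
  define st where "st = rec_nat (c, d) (\<lambda>n (l, s). let l' = l + of_real (pt (Suc n) - pt n) * s
      in (l', s + of_real (a (Suc n)) * (l' + KK (pt (Suc n)))))"
  define l where "l n = fst (st n)" for n
  define s where "s n = snd (st n)" for n
  have l: "l 0 = c" "l (Suc n) = l n + of_real (pt (Suc n) - pt n) * s n" for n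
    by (simp_all add: l_def s_def st_def split_def Let_def)
  have s: "s 0 = d" "s (Suc n) = s n + of_real (a (Suc n)) * (l (Suc n) + KK (pt (Suc n)))" for n
    by (simp_all add: l_def s_def st_def split_def Let_def)
  define U where "U n x = KK x + (l n + of_real (x - pt n) * s n)" for n x
  define V where "V n x = K x + s n" for n x
  have "dsol a (\<lambda>x. U (cell x) x) (\<lambda>x. V (cell x) x) g"
  proof (rule dsol_cellsI)
    fix n x assume x: "pt n \<le> x" "x \<le> pt (Suc n)"
    then have "x \<ge> 0" by (meson order_trans real_sqrt_ge_zero of_nat_0_le_iff)
    then show "(U n has_vector_derivative V n x) (at x within half_line)"
      unfolding U_def V_def by (auto intro!: derivative_eq_intros KK)
  next
    fix n
    have "absolutely_continuous_on 0 (pt (Suc n)) (\<lambda>x. integral {0..x} g + s n)"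
      by (intro absolutely_continuous_on_add absolutely_continuous_on_integral g absolutely_continuous_on_const)
    then show "absolutely_continuous_on (pt n) (pt (Suc n)) (V n)"
      unfolding V_def K_def by (rule absolutely_continuous_on_subinterval) auto
  next
    \<comment> \<open>Differentiability almost everywhere of the indefinite integral is known on
      bounded intervals; the union over b serves the whole half-line.\<close>
    define N where "N b = {x \<in> {0<..<real b}. \<not> (K has_vector_derivative g x) (at x)}" for b
    have "negligible (N b)" for b
      unfolding N_def K_def by (rule negligible_not_differentiable_integral[OF gi])
    then have "negligible (\<Union>b. N b)" by (intro negligible_countable_Union) auto
    moreover have "(V n has_vector_derivative g x) (at x)"
      if x: "x \<notin> (\<Union>b. N b)" "pt n < x" "x < pt (Suc n)" for n x
    proof -
      obtain b where b: "x < real b" using reals_Archimedean2 by blast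
      have "x > 0" using x(2) by (meson le_less_trans real_sqrt_ge_zero of_nat_0_le_iff)
      then have "(K has_vector_derivative g x) (at x)" using x(1) b by (auto simp: N_def)
      then show ?thesis unfolding V_def by (auto intro!: derivative_eq_intros)
    qed
    ultimately show "AE x in half_line_measure. \<forall>n. pt n < x \<longrightarrow> x < pt (Suc n) \<longrightarrow> (V n has_vector_derivative g x) (at x)"
      unfolding AE_half_line_iff by (intro exI[of _ "\<Union>b. N b"]) blast
  qed (auto simp: U_def V_def l s g)
  moreover have "cell 0 = 0" by (simp add: cell_def)
  ultimately show thesis
    using that[of "\<lambda>x. U (cell x) x" "\<lambda>x. V (cell x) x"]
    by (simp add: U_def V_def K_def KK_def l s)
qed

section \<open>Test functions, Green's formula and the Wronskian\<close>

text \<open>Green's formula asks of its second function only one derivative, locally bounded off the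
  grid, and no jump condition. The weaker notion is needed for the cutoff estimate: the square of a
  cutoff derivative is only once continuously differentiable, so its product with a solution need
  not be a \<open>dsol\<close>.\<close>

definition dform :: "(real \<Rightarrow> complex) \<Rightarrow> (real \<Rightarrow> complex) \<Rightarrow> bool" where
  "dform u v \<longleftrightarrow>
     continuous_on half_line u \<and>
     (\<forall>x\<in>half_line - grid. (u has_vector_derivative v x) (at x within half_line)) \<and>
     v \<in> borel_measurable half_line_measure \<and>
     (\<forall>b. \<exists>B. \<forall>x\<in>{0..b} - grid. cmod (v x) \<le> B)"

lemma cell_subset: "pt n < s \<Longrightarrow> t < pt (Suc n) \<Longrightarrow> {s..t} \<subseteq> half_line - grid"
proof
  fix x assume *: "pt n < s" "t < pt (Suc n)" "x \<in> {s..t}"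
  then have x: "pt n < x" "x < pt (Suc n)" by auto
  have "x \<ge> 0" using x(1) real_sqrt_ge_zero[of "real n"] by linarith
  then show "x \<in> half_line - grid" using open_cell_grid[OF x] by auto
qed

lemma dsol_AC_cell:
  assumes "dsol a u v g" "pt n < s" "s \<le> t" "t < pt (Suc n)"
  shows "absolutely_continuous_on s t v"
  using dsolD(3)[OF assms(1)] cell_subset[OF assms(2,4)] assms(3) by (auto simp: AC_loc_def)

lemma isCont_cell:
  assumes "dsol a u v g" "pt n < x" "x < pt (Suc n)"
  shows "isCont v x"
proof -
  obtain s where s: "pt n < s" "s < x" using dense assms by blast
  obtain t where t: "x < t" "t < pt (Suc n)" using dense assms by blast
  have "continuous_on {s..t} v"
    by (rule absolutely_continuous_on_imp_continuous_on[OF dsol_AC_cell[OF assms(1)]]) (use s t in auto)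
  then show ?thesis by (rule continuous_on_interior) (use s t in auto)
qed

lemma dsol_right_limit:
  assumes "dsol a u v g"
  shows "\<exists>R. (v \<longlongrightarrow> R) (at_right (pt n))" and "(v \<longlongrightarrow> v 0) (at_right 0)"
proof -
  have "{0..1/2} \<subseteq> half_line - grid"
  proof
    fix x :: real assume x: "x \<in> {0..1/2}"
    then show "x \<in> half_line - grid"
      using open_cell_grid[of 0 x] by (cases "x = 0") (auto simp: of_nat_Suc)
  qed
  then have "continuous_on {0..1/2} v"
    using dsolD(3)[OF assms] by (intro absolutely_continuous_on_imp_continuous_on) (auto simp: AC_loc_def)
  then show 0: "(v \<longlongrightarrow> v 0) (at_right 0)"
    by (auto simp: continuous_on_def at_within_Icc_at_right dest: bspec[of _ _ 0])
  show "\<exists>R. (v \<longlongrightarrow> R) (at_right (pt n))"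
  proof (cases "n = 0")
    case False
    then have "n \<ge> 1" by simp
    then show ?thesis using assms unfolding dsol_def by blast
  qed (use 0 in auto)
qed

text \<open>Both one-sided limits exist, so \<open>v\<close> extends continuously to the closed cell
  and compactness applies.\<close>

lemma dsol_bounded_cell:
  assumes "dsol a u v g"
  shows "\<exists>B. \<forall>x. pt n < x \<longrightarrow> x < pt (Suc n) \<longrightarrow> cmod (v x) \<le> B"
proof -
  obtain R where R: "(v \<longlongrightarrow> R) (at_right (pt n))" using dsol_right_limit[OF assms] by blast
  obtain L where L: "(v \<longlongrightarrow> L) (at_left (pt (Suc n)))"
    using assms unfolding dsol_def by (metis le_add1 plus_1_eq_Suc)
  define w where "w x = (if x = pt n then R else if x = pt (Suc n) then L else v x)" for x
  have lt: "pt n < pt (Suc n)" by (simp add: of_nat_Suc)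
  have "continuous_on {pt n..pt (Suc n)} w"
  proof (rule continuous_on_IccI[OF _ _ _ lt])
    have "\<forall>\<^sub>F x in at_right (pt n). v x = w x"
      using lt by (auto simp: eventually_at_right_field w_def intro!: exI[of _ "pt (Suc n)"])
    then show "(w \<longlongrightarrow> w (pt n)) (at_right (pt n))"
      using Lim_transform_eventually[OF R] by (simp add: w_def)
    have "\<forall>\<^sub>F x in at_left (pt (Suc n)). v x = w x"
      using lt by (auto simp: eventually_at_left_field w_def intro!: exI[of _ "pt n"])
    then show "(w \<longlongrightarrow> w (pt (Suc n))) (at_left (pt (Suc n)))"
      using Lim_transform_eventually[OF L] lt by (simp add: w_def)
  next
    fix x assume x: "pt n < x" "x < pt (Suc n)"
    have "\<forall>\<^sub>F y in at x. v y = w y"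
      unfolding eventually_at_topological
      by (intro exI[of _ "{pt n<..<pt (Suc n)}"]) (use x in \<open>auto simp: w_def\<close>)
    moreover have "(v \<longlongrightarrow> v x) (at x)" using isCont_cell[OF assms x] by (simp add: isCont_def)
    ultimately show "w \<midarrow>x\<rightarrow> w x"
      using Lim_transform_eventually x by (fastforce simp: w_def)
  qed
  then have "bounded (w ` {pt n..pt (Suc n)})"
    by (intro compact_imp_bounded compact_continuous_image) auto
  then obtain B where "\<forall>y\<in>w ` {pt n..pt (Suc n)}. cmod y \<le> B" unfolding bounded_iff by blast
  then show ?thesis by (intro exI[of _ B]) (force simp: w_def)
qed

lemma dsol_imp_dform:
  assumes "dsol a u v g"
  shows "dform u v"
  unfolding dform_def
proof (intro conjI allI)
  have M: "\<exists>B. \<forall>x\<in>{0..<pt M} - grid. cmod (v x) \<le> B" for M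
  proof (induction M)
    case (Suc M)
    obtain B where B: "\<forall>x\<in>{0..<pt M} - grid. cmod (v x) \<le> B" using Suc by blast
    obtain C where C: "\<forall>x. pt M < x \<longrightarrow> x < pt (Suc M) \<longrightarrow> cmod (v x) \<le> C"
      using dsol_bounded_cell[OF assms] by blast
    show ?case
    \<comment> \<open>The open cells miss the points \<open>pt M\<close>. For
      \<open>M \<ge> 1\<close> these lie in the grid, so only the value at 0 has to be added to the
      bound.\<close>
    proof (intro exI[of _ "max (cmod (v 0)) (max B C)"] ballI)
      fix x assume x: "x \<in> {0..<pt (Suc M)} - grid"
      consider "x = 0" | "x < pt M" | "pt M < x" | "x = pt M" "M \<ge> 1" by (cases M) force+
      then show "cmod (v x) \<le> max (cmod (v 0)) (max B C)"
        using B C x pt_in_grid[of M] by cases (auto simp: le_max_iff_disj)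
    qed
  qed auto
  show "\<exists>B. \<forall>x\<in>{0..b} - grid. cmod (v x) \<le> B" for b
  proof -
    obtain B where B: "\<forall>x\<in>{0..<pt (Suc (cell \<bar>b\<bar>))} - grid. cmod (v x) \<le> B" using M by blast
    have "{0..b} \<subseteq> {0..<pt (Suc (cell \<bar>b\<bar>))}" using pt_cell(2)[of "\<bar>b\<bar>"] by auto
    then show ?thesis using B by blast
  qed
next
  define S where "S = (\<Union>n. {pt n<..<pt (Suc n)})"
  have "continuous_on S v"
    unfolding S_def using isCont_cell[OF assms] by (intro continuous_at_imp_continuous_on) auto
  moreover have "open S" by (auto simp: S_def)
  ultimately have "v \<in> borel_measurable (lebesgue_on S)"
    by (intro continuous_imp_measurable_on_sets_lebesgue) auto
  moreover have "S = half_line - (grid \<union> {0})"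
  proof
    show "S \<subseteq> half_line - (grid \<union> {0})"
    proof
      fix x assume "x \<in> S"
      then obtain n where n: "pt n < x" "x < pt (Suc n)" by (auto simp: S_def)
      then have "x > 0" using real_sqrt_ge_zero[of "real n"] by linarith
      then show "x \<in> half_line - (grid \<union> {0})" using open_cell_grid[OF n] by auto
    qed
    show "half_line - (grid \<union> {0}) \<subseteq> S"
    proof
      fix x assume "x \<in> half_line - (grid \<union> {0})"
      then have "x \<ge> 0" "x \<notin> grid" "x \<noteq> 0" by auto
      then show "x \<in> S" using grid_cases[of x] by (auto simp: S_def)
    qed
  qed
  moreover have "grid \<union> {0} \<in> null_sets half_line_measure"
    using negligible_grid
    by (subst null_sets_restrict_space) (auto simp flip: negligible_iff_null_sets simp: grid_def)
  ultimately show "v \<in> borel_measurable half_line_measure"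
    using borel_measurable_diff_null[of "grid \<union> {0}" half_line v] by simp
qed (use dsolD[OF assms] in auto)

lemma dformD:
  assumes "dform u v"
  shows "continuous_on half_line u"
    "\<And>x. x \<ge> 0 \<Longrightarrow> x \<notin> grid \<Longrightarrow> (u has_vector_derivative v x) (at x within half_line)"
    "v \<in> borel_measurable half_line_measure"
  using assms by (auto simp: dform_def)

lemma dform_AC:
  assumes "dform u v" "{s..t} \<subseteq> half_line - grid"
  shows "absolutely_continuous_on s t u"
proof -
  obtain B where B: "\<forall>x\<in>{0..t} - grid. cmod (v x) \<le> B" using assms unfolding dform_def by blast
  show ?thesis
  proof (rule differentiable_bounded_imp_absolutely_continuous_on)
    fix x assume x: "x \<in> {s..t}"
    then have "x \<ge> 0" "x \<notin> grid" using assms by auto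
    then show "(u has_vector_derivative v x) (at x within {s..t})"
      using dformD(2)[OF assms(1)] has_vector_derivative_within_subset assms(2) by blast
    show "cmod (v x) \<le> B" using B x \<open>x \<ge> 0\<close> \<open>x \<notin> grid\<close> by auto
  qed
qed

lemma measurable_half_line_Icc:
  fixes f :: "real \<Rightarrow> complex"
  assumes "f \<in> borel_measurable half_line_measure"
  shows "f \<in> borel_measurable (lebesgue_on {0..b})"
  by (rule measurable_restrict_mono[OF assms]) auto

lemma absolutely_integrable_continuous_mult:
  fixes f u :: "real \<Rightarrow> complex"
  assumes "f absolutely_integrable_on {0..b}" "continuous_on half_line u"
  shows "(\<lambda>x. u x * f x) absolutely_integrable_on {0..b}"
proof (rule absolutely_integrable_bounded_measurable_product[OF bilinear_times _ _ _ assms(1)])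
  have c: "continuous_on {0..b} u" by (rule continuous_on_subset[OF assms(2)]) auto
  show "u \<in> borel_measurable (lebesgue_on {0..b})"
    by (rule continuous_imp_measurable_on_sets_lebesgue[OF c]) auto
  show "bounded (u ` {0..b})"
    by (intro compact_imp_bounded compact_continuous_image c) auto
qed auto

lemma dform_mult_integrable:
  assumes "f absolutely_integrable_on {0..b}" "dform u v"
  shows "(\<lambda>x. v x * f x) absolutely_integrable_on {0..b}"
proof -
  obtain B where B: "\<forall>x\<in>{0..b} - grid. cmod (v x) \<le> B" using assms unfolding dform_def by blast
  \<comment> \<open>The values of \<open>v\<close> on the grid are unconstrained; they are set to 0
    before boundedness is used.\<close>
  define w where "w x = (if x \<in> grid then 0 else v x)" for x
  have B': "\<forall>x\<in>{0..b} - grid. cmod (v x) \<le> \<bar>B\<bar>" using B by force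
  have "grid \<in> sets lebesgue" using negligible_grid negligible_imp_sets by blast
  then have "(\<lambda>x. if x \<in> grid then 0 else v x) \<in> borel_measurable (lebesgue_on {0..b})"
    by (intro measurable_If_set) (auto intro: measurable_half_line_Icc dformD(3)[OF assms(2)] simp: sets_restrict_space)
  then have "(\<lambda>x. w x * f x) absolutely_integrable_on {0..b}"
    using B' by (intro absolutely_integrable_bounded_measurable_product[OF bilinear_times _ _ _ assms(1)])
       (auto simp: w_def[abs_def] bounded_iff intro!: exI[of _ "\<bar>B\<bar>"])
  then show ?thesis
    by (rule absolutely_integrable_spike[OF _ negligible_grid]) (auto simp: w_def)
qed

lemma dform_derivative_integrable: "dform u v \<Longrightarrow> v absolutely_integrable_on {0..b}"
  using dform_mult_integrable[where f = "\<lambda>x. 1"] by fastforce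

text \<open>On each cell the integrand is the derivative of \<open>v1 * u2\<close>. When the cells
  are added, the end terms telescope up to the jumps of \<open>v1\<close>, each of which contributes
  the strength times \<open>u1 * u2\<close>. At the last point the left limit \<open>l\<close> is
  taken, so its jump is not counted and the sum stops at m. The identity is bilinear; conjugates are
  inserted through the second function.\<close>

lemma dsol_green:
  assumes 1: "dsol a u1 v1 g1" and 2: "dform u2 v2"
    and l: "(v1 \<longlongrightarrow> l) (at_left (pt (Suc m)))"
  shows "((\<lambda>x. g1 x * u2 x + v1 x * v2 x) has_integral
      l * u2 (pt (Suc m)) - v1 0 * u2 0 - (\<Sum>n=1..m. of_real (a n) * u1 (pt n) * u2 (pt n))) {0..pt (Suc m)}"
proof -
  define h where "h x = g1 x * u2 x + v1 x * v2 x" for x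
  have h: "h absolutely_integrable_on {0..b}" for b
  proof -
    have "(\<lambda>x. u2 x * g1 x) absolutely_integrable_on {0..b}"
      by (rule absolutely_integrable_continuous_mult[OF dsolD(5)[OF 1] dformD(1)[OF 2]])
    moreover have "(\<lambda>x. v1 x * v2 x) absolutely_integrable_on {0..b}"
      by (rule dform_mult_integrable[OF dform_derivative_integrable[OF 2] dsol_imp_dform[OF 1]])
    ultimately show ?thesis unfolding h_def
      by (subst mult.commute) (rule set_integral_add(1))
  qed
  obtain L where L: "\<And>n. n \<ge> 1 \<Longrightarrow> (v1 \<longlongrightarrow> L n) (at_left (pt n))"
    and R: "\<And>n. n \<ge> 1 \<Longrightarrow> (v1 \<longlongrightarrow> L n + of_real (a n) * u1 (pt n)) (at_right (pt n))"
    using 1 unfolding dsol_def by metis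
  obtain N where N: "negligible N" and derN: "\<And>x. x \<ge> 0 \<Longrightarrow> x \<notin> N \<Longrightarrow> (v1 has_vector_derivative g1 x) (at x within half_line)"
    using dsolD(4)[OF 1] by (auto simp: AE_half_line_iff)
  have u2l: "(u2 \<longlongrightarrow> u2 (pt (Suc n))) (at_left (pt (Suc n)))" for n
  proof -
    have "continuous_on {0..pt (Suc n)} u2" by (rule continuous_on_subset[OF dformD(1)[OF 2]]) auto
    then show ?thesis by (auto simp: continuous_on_def at_within_Icc_at_left of_nat_Suc dest: bspec[of _ _ "pt (Suc n)"])
  qed
  have u2r: "(u2 \<longlongrightarrow> u2 (pt n)) (at_right (pt n))" for n
  proof -
    have "continuous_on {pt n..pt n + 1} u2"
      by (rule continuous_on_subset[OF dformD(1)[OF 2]]) (auto intro: order_trans[OF real_sqrt_ge_zero])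
    then show ?thesis by (auto simp: continuous_on_def at_within_Icc_at_right dest: bspec[of _ _ "pt n"])
  qed
  have cell: "(h has_integral L (Suc n) * u2 (pt (Suc n)) - R' * u2 (pt n)) {pt n..pt (Suc n)}"
    if R': "(v1 \<longlongrightarrow> R') (at_right (pt n))" for n R'
  proof (rule has_integral_limits_absolutely_continuous[where F = "\<lambda>x. v1 x * u2 x", OF _ _ N])
    fix s t assume st: "pt n < s" "s \<le> t" "t < pt (Suc n)"
    show "absolutely_continuous_on s t (\<lambda>x. v1 x * u2 x)"
      by (intro absolutely_continuous_on_mult dsol_AC_cell[OF 1 st] dform_AC[OF 2] cell_subset[OF st(1,3)])
  next
    fix x assume x: "x \<in> {pt n<..<pt (Suc n)} - N"
    then have x0: "x > 0" by (auto intro: le_less_trans[of 0 "pt n"])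
    have "(v1 has_vector_derivative g1 x) (at x)" "(u2 has_vector_derivative v2 x) (at x)"
      using derN[of x] dformD(2)[OF 2, of x] open_cell_grid[of n x] x x0 by (auto simp: at_within_half_line)
    then have "((\<lambda>x. v1 x * u2 x) has_vector_derivative (v1 x * v2 x + g1 x * u2 x)) (at x)"
      by (rule has_vector_derivative_mult)
    then show "((\<lambda>x. v1 x * u2 x) has_vector_derivative h x) (at x)" by (simp add: h_def add.commute)
  next
    have "h integrable_on {0..pt (Suc n)}" using h by (auto simp: absolutely_integrable_on_def)
    then show "h integrable_on {pt n..pt (Suc n)}" by (rule integrable_on_subinterval) auto
  next
    show "((\<lambda>x. v1 x * u2 x) \<longlongrightarrow> R' * u2 (pt n)) (at_right (pt n))" by (intro tendsto_intros R' u2r)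
    show "((\<lambda>x. v1 x * u2 x) \<longlongrightarrow> L (Suc n) * u2 (pt (Suc n))) (at_left (pt (Suc n)))"
      by (intro tendsto_intros L u2l) simp
  qed (simp add: of_nat_Suc)
  have "(h has_integral L (Suc m) * u2 (pt (Suc m)) - v1 0 * u2 0 - (\<Sum>n=1..m. of_real (a n) * u1 (pt n) * u2 (pt n))) {0..pt (Suc m)}"
  proof (induction m)
    case 0
    show ?case using cell[of "v1 0" 0] dsol_right_limit(2)[OF 1] by simp
  next
    case (Suc m)
    have "(h has_integral (L (Suc m) * u2 (pt (Suc m)) - v1 0 * u2 0 - (\<Sum>n=1..m. of_real (a n) * u1 (pt n) * u2 (pt n)))
       + (L (Suc (Suc m)) * u2 (pt (Suc (Suc m))) - (L (Suc m) + of_real (a (Suc m)) * u1 (pt (Suc m))) * u2 (pt (Suc m)))) {0..pt (Suc (Suc m))}"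
      by (rule has_integral_combine[OF _ _ Suc cell]) (auto intro: R)
    then show ?case by (simp add: algebra_simps)
  qed
  moreover have "L (Suc m) = l"
    using tendsto_unique[OF trivial_limit_at_left_real L[of "Suc m"] l] by simp
  ultimately show ?thesis by (simp add: h_def[abs_def])
qed

text \<open>Exchanging the two solutions in Green's formula leaves the interaction sum and the term
  \<open>v1 * v2\<close> unchanged, so both cancel in the difference.\<close>

lemma dsol_wronskian:
  assumes 1: "dsol a u1 v1 g1" and 2: "dsol a u2 v2 g2"
    and l1: "(v1 \<longlongrightarrow> l1) (at_left (pt (Suc m)))" and l2: "(v2 \<longlongrightarrow> l2) (at_left (pt (Suc m)))"
  shows "((\<lambda>x. g1 x * u2 x - u1 x * g2 x) has_integral
      (l1 * u2 (pt (Suc m)) - u1 (pt (Suc m)) * l2) - (v1 0 * u2 0 - u1 0 * v2 0)) {0..pt (Suc m)}"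
  using has_integral_diff[OF dsol_green[OF 1 dsol_imp_dform[OF 2] l1] dsol_green[OF 2 dsol_imp_dform[OF 1] l2]]
  by (simp add: algebra_simps)

section \<open>Operations preserving local solutions\<close>

lemma dsol_cmult:
  assumes "dsol a u v g"
  shows "dsol a (\<lambda>x. c * u x) (\<lambda>x. c * v x) (\<lambda>x. c * g x)"
  unfolding dsol_def
proof (intro conjI ballI allI impI)
  show "AE x in half_line_measure. ((\<lambda>x. c * v x) has_vector_derivative c * g x) (at x within half_line)"
    using dsolD(4)[OF assms] by eventually_elim (rule has_vector_derivative_mult_right)
next
  fix n :: nat assume "n \<ge> 1"
  then obtain p where "(v \<longlongrightarrow> p) (at_left (pt n))" "(v \<longlongrightarrow> p + of_real (a n) * u (pt n)) (at_right (pt n))"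
    using assms by (auto simp: dsol_def)
  then have "((\<lambda>x. c * v x) \<longlongrightarrow> c * p) (at_left (pt n))"
     "((\<lambda>x. c * v x) \<longlongrightarrow> c * (p + of_real (a n) * u (pt n))) (at_right (pt n))"
    by (auto intro!: tendsto_intros)
  then show "\<exists>p. ((\<lambda>x. c * v x) \<longlongrightarrow> p) (at_left (pt n)) \<and> ((\<lambda>x. c * v x) \<longlongrightarrow> p + of_real (a n) * (c * u (pt n))) (at_right (pt n))"
    by (intro exI[of _ "c * p"]) (simp add: algebra_simps)
qed (use dsolD[OF assms] in \<open>auto simp: AC_loc_def intro!: continuous_intros has_vector_derivative_mult_right
     absolutely_continuous_on_mult absolutely_continuous_on_const set_integrable_mult_right\<close>)

lemma dsol_add:
  assumes 1: "dsol a u1 v1 g1" and 2: "dsol a u2 v2 g2"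
  shows "dsol a (\<lambda>x. u1 x + u2 x) (\<lambda>x. v1 x + v2 x) (\<lambda>x. g1 x + g2 x)"
  unfolding dsol_def
proof (intro conjI ballI allI impI)
  show "AE x in half_line_measure. ((\<lambda>x. v1 x + v2 x) has_vector_derivative g1 x + g2 x) (at x within half_line)"
    using dsolD(4)[OF 1] dsolD(4)[OF 2] by eventually_elim (rule has_vector_derivative_add)
next
  fix n :: nat assume n: "n \<ge> 1"
  obtain p where "(v1 \<longlongrightarrow> p) (at_left (pt n))" "(v1 \<longlongrightarrow> p + of_real (a n) * u1 (pt n)) (at_right (pt n))"
    using 1 n by (auto simp: dsol_def)
  moreover obtain q where "(v2 \<longlongrightarrow> q) (at_left (pt n))" "(v2 \<longlongrightarrow> q + of_real (a n) * u2 (pt n)) (at_right (pt n))"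
    using 2 n by (auto simp: dsol_def)
  ultimately have "((\<lambda>x. v1 x + v2 x) \<longlongrightarrow> p + q) (at_left (pt n))"
     "((\<lambda>x. v1 x + v2 x) \<longlongrightarrow> (p + of_real (a n) * u1 (pt n)) + (q + of_real (a n) * u2 (pt n))) (at_right (pt n))"
    by (auto intro!: tendsto_intros)
  then show "\<exists>p. ((\<lambda>x. v1 x + v2 x) \<longlongrightarrow> p) (at_left (pt n)) \<and> ((\<lambda>x. v1 x + v2 x) \<longlongrightarrow> p + of_real (a n) * (u1 (pt n) + u2 (pt n))) (at_right (pt n))"
    by (intro exI[of _ "p + q"]) (simp add: algebra_simps)
qed (use dsolD[OF 1] dsolD[OF 2] in \<open>auto simp: AC_loc_def intro!: continuous_intros has_vector_derivative_add
     absolutely_continuous_on_add set_integral_add(1)\<close>)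

lemma has_vector_derivative_cnj_within:
  "(f has_vector_derivative f') F \<Longrightarrow> ((\<lambda>x. cnj (f x)) has_vector_derivative cnj f') F"
  by (rule bounded_linear.has_vector_derivative[OF bounded_linear_cnj])

text \<open>Conjugation keeps the interface conditions because the strengths are real.\<close>

lemma dsol_cnj:
  assumes "dsol a u v g"
  shows "dsol a (\<lambda>x. cnj (u x)) (\<lambda>x. cnj (v x)) (\<lambda>x. cnj (g x))"
  unfolding dsol_def
proof (intro conjI ballI allI impI)
  show "AE x in half_line_measure. ((\<lambda>x. cnj (v x)) has_vector_derivative cnj (g x)) (at x within half_line)"
    using dsolD(4)[OF assms] by eventually_elim (rule has_vector_derivative_cnj_within)
  show "(\<lambda>x. cnj (g x)) absolutely_integrable_on {0..b}" for b
    using absolutely_integrable_linear[OF dsolD(5)[OF assms] bounded_linear_cnj, of b] by (simp add: comp_def)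
next
  fix n :: nat assume "n \<ge> 1"
  then obtain p where "(v \<longlongrightarrow> p) (at_left (pt n))" "(v \<longlongrightarrow> p + of_real (a n) * u (pt n)) (at_right (pt n))"
    using assms by (auto simp: dsol_def)
  then have "((\<lambda>x. cnj (v x)) \<longlongrightarrow> cnj p) (at_left (pt n))"
     "((\<lambda>x. cnj (v x)) \<longlongrightarrow> cnj (p + of_real (a n) * u (pt n))) (at_right (pt n))"
    by (auto intro: tendsto_cnj simp del: complex_cnj_add)
  then show "\<exists>p. ((\<lambda>x. cnj (v x)) \<longlongrightarrow> p) (at_left (pt n)) \<and> ((\<lambda>x. cnj (v x)) \<longlongrightarrow> p + of_real (a n) * cnj (u (pt n))) (at_right (pt n))"
    by (intro exI[of _ "cnj p"]) simp
qed (use dsolD[OF assms] in \<open>auto simp: AC_loc_def intro!: continuous_intros has_vector_derivative_cnj_within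
     absolutely_continuous_on_cnj\<close>)

lemma half_line_filters:
  fixes f :: "real \<Rightarrow> complex"
  assumes "continuous_on half_line f" "x \<ge> 0"
  shows "(f \<longlongrightarrow> f x) (at_right x)" "x > 0 \<Longrightarrow> (f \<longlongrightarrow> f x) (at_left x)"
proof -
  have c: "(f \<longlongrightarrow> f x) (at x within half_line)" using assms by (auto simp: continuous_on_def)
  show "(f \<longlongrightarrow> f x) (at_right x)"
    by (rule tendsto_mono[OF at_le c]) (use assms in auto)
  show "(f \<longlongrightarrow> f x) (at_left x)" if "x > 0"
    using c that by (auto simp: at_within_half_line intro: tendsto_mono[OF at_le])
qed

lemma at_within_half_line_neq_bot: "x \<ge> 0 \<Longrightarrow> at x within half_line \<noteq> bot"
proof
  assume x: "x \<ge> 0" and "at x within half_line = bot"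
  moreover have "at_right x \<le> at x within half_line" using x by (intro at_le) auto
  ultimately show False by (simp add: bot_unique trivial_limit_at_right_real)
qed

lemma grid_eventually:
  assumes "n \<ge> 1"
  shows "\<forall>\<^sub>F x in at_left (pt n). x > 0 \<and> x \<notin> grid" "\<forall>\<^sub>F x in at_right (pt n). x > 0 \<and> x \<notin> grid"
proof -
  obtain m where m: "n = Suc m" using assms by (cases n) auto
  have pos: "0 < x" if "pt k < x" for k x using that by (auto intro: le_less_trans[of 0 "pt k"])
  show "\<forall>\<^sub>F x in at_left (pt n). x > 0 \<and> x \<notin> grid"
    unfolding m eventually_at_left_field using open_cell_grid[of m] pos
    by (intro exI[of _ "pt m"]) (auto simp: of_nat_Suc)
  show "\<forall>\<^sub>F x in at_right (pt n). x > 0 \<and> x \<notin> grid"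
    unfolding eventually_at_right_field using open_cell_grid[of n] pos
    by (intro exI[of _ "pt (Suc n)"]) (auto simp: of_nat_Suc)
qed

lemma eventually_off_grid:
  assumes "x \<ge> 0" "x \<notin> grid"
  shows "\<exists>d>0. \<forall>y\<in>half_line. dist y x < d \<longrightarrow> y \<notin> grid"
proof (cases "x = 0")
  case True
  have "y \<notin> grid" if "y \<ge> 0" "y < 1" for y
    using that open_cell_grid[of 0 y] by (cases "y = 0") (auto simp: of_nat_Suc)
  then show ?thesis using True by (intro exI[of _ 1]) (auto simp: dist_real_def)
next
  case False
  then obtain n where n: "pt n < x" "x < pt (Suc n)" using grid_cases[OF assms] by metis
  show ?thesis
    by (intro exI[of _ "min (x - pt n) (pt (Suc n) - x)"] conjI ballI impI)
       (use n in simp, rule open_cell_grid[of n], auto simp: dist_real_def abs_if split: if_splits)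
qed

definition trunc :: "nat \<Rightarrow> (real \<Rightarrow> complex) \<Rightarrow> real \<Rightarrow> complex" where
  "trunc M f x = (if x < pt M then f x else 0)"

text \<open>A vanishing value and left derivative at \<open>pt M\<close> make the extension by 0
  satisfy the interface condition there; at the other grid points the condition is either the old
  one or trivial.\<close>

lemma dsol_trunc:
  assumes "dsol a u v g" and M: "M \<ge> 1" and u: "u (pt M) = 0" and v: "(v \<longlongrightarrow> 0) (at_left (pt M))"
  shows "dsol a (trunc M u) (trunc M v) (trunc M g)"
  unfolding dsol_def
proof (intro conjI ballI allI impI)
  show "continuous_on half_line (trunc M u)"
  proof (rule continuous_on_cells)
    fix n
    have sub: "{pt n..pt (Suc n)} \<subseteq> half_line" by (auto intro: order_trans[OF real_sqrt_ge_zero])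
    show "continuous_on {pt n..pt (Suc n)} (trunc M u)"
    proof (cases "n < M")
      case True
      then have le: "pt (Suc n) \<le> pt M" by simp
      have "u x = trunc M u x" if "x \<in> {pt n..pt (Suc n)}" for x
      proof (cases "x < pt M")
        case False
        with that le have "x = pt M" by (simp add: order.antisym del: real_sqrt_le_iff)
        then show ?thesis using u by (simp add: trunc_def)
      qed (simp add: trunc_def)
      then show ?thesis
        by (rule continuous_on_eq[OF continuous_on_subset[OF dsolD(1)[OF assms(1)] sub]])
    next
      case False
      then have le: "pt M \<le> pt n" by simp
      have "0 = trunc M u x" if "x \<in> {pt n..pt (Suc n)}" for x
      proof -
        have "\<not> x < pt M" using le that unfolding atLeastAtMost_iff by linarith
        then show ?thesis by (simp add: trunc_def)
      qed
      then show ?thesis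
        by (rule continuous_on_eq[OF continuous_on_const])
    qed
  qed
next
  have loc: "\<exists>d>0. (\<forall>y. dist y x < d \<longrightarrow> y < pt M) \<or> (\<forall>y. dist y x < d \<longrightarrow> \<not> y < pt M)" if "x \<noteq> pt M" for x
    using that by (intro exI[of _ "\<bar>x - pt M\<bar>"]) (auto simp: dist_real_def abs_if)
  have tr: "(trunc M f has_vector_derivative trunc M f' x) (at x within half_line)"
    if "x \<noteq> pt M" "x \<ge> 0" "(f has_vector_derivative f' x) (at x within half_line)" for x f f'
  proof -
    obtain d where d: "d > 0" and *: "(\<forall>y. dist y x < d \<longrightarrow> y < pt M) \<or> (\<forall>y. dist y x < d \<longrightarrow> \<not> y < pt M)"
      using loc[OF \<open>x \<noteq> pt M\<close>] by blast
    from * show ?thesis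
    proof
      assume 1: "\<forall>y. dist y x < d \<longrightarrow> y < pt M"
      then have "x < pt M" using d by auto
      show ?thesis
        by (rule has_vector_derivative_transform_within[of f _ _ _ d])
           (use 1 d that \<open>x < pt M\<close> in \<open>auto simp: trunc_def\<close>)
    next
      assume 1: "\<forall>y. dist y x < d \<longrightarrow> \<not> y < pt M"
      then have "\<not> x < pt M" using d by auto
      show ?thesis
        by (rule has_vector_derivative_transform_within[of "\<lambda>x. 0" _ _ _ d])
           (use 1 d that \<open>\<not> x < pt M\<close> in \<open>auto simp: trunc_def\<close>)
    qed
  qed
  show "(trunc M u has_vector_derivative trunc M v x) (at x within half_line)" if "x \<in> half_line - grid" for x
    using that pt_in_grid[OF M] dsolD(2)[OF assms(1)] by (intro tr) auto
  have "AE x in half_line_measure. x \<notin> grid"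
    unfolding AE_half_line_iff using negligible_grid by blast
  with dsolD(4)[OF assms(1)] AE_space
  show "AE x in half_line_measure. (trunc M v has_vector_derivative trunc M g x) (at x within half_line)"
    by eventually_elim (use pt_in_grid[OF M] in \<open>auto intro!: tr\<close>)
next
  show "trunc M v \<in> AC_loc (half_line - grid)"
    unfolding AC_loc_def
  proof (intro CollectI allI impI)
    fix s t assume st: "s \<le> t" "{s..t} \<subseteq> half_line - grid"
    have "pt M \<notin> {s..t}" using st pt_in_grid[OF M] by auto
    then consider "t < pt M" | "pt M < s" by force
    then show "absolutely_continuous_on s t (trunc M v)"
    proof cases
      case 1
      show ?thesis
        by (rule absolutely_continuous_on_cong[of _ _ _ v]) (use 1 dsolD(3)[OF assms(1)] st in \<open>auto simp: trunc_def AC_loc_def\<close>)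
    next
      case 2
      show ?thesis
        by (rule absolutely_continuous_on_cong[OF _ absolutely_continuous_on_const[of _ _ 0]]) (use 2 in \<open>auto simp: trunc_def\<close>)
    qed
  qed
next
  fix b
  have "g absolutely_integrable_on ({..<pt M} \<inter> {0..b})"
    by (rule set_integrable_subset[OF dsolD(5)[OF assms(1), of b]]) auto
  moreover have "(\<lambda>x. indicat_real ({..<pt M} \<inter> {0..b}) x *\<^sub>R g x) = (\<lambda>x. indicat_real {0..b} x *\<^sub>R trunc M g x)"
    by (auto simp: indicator_def trunc_def)
  ultimately show "trunc M g absolutely_integrable_on {0..b}" by (simp add: set_integrable_def)
next
  fix n :: nat assume n: "n \<ge> 1"
  have evL: "\<forall>\<^sub>F x in at_left (pt n). f x = trunc M f x" if "n \<le> M" for f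
  proof -
    have "pt n \<le> pt M" using that by simp
    then show ?thesis
      unfolding eventually_at_left_field using n by (intro exI[of _ 0]) (auto simp: trunc_def simp del: real_sqrt_le_iff real_sqrt_less_iff)
  qed
  have evR: "\<forall>\<^sub>F x in at_right (pt n). f x = trunc M f x" if "n < M" for f
  proof -
    have "pt n < pt M" using that by simp
    then show ?thesis
      unfolding eventually_at_right_field by (intro exI[of _ "pt M"]) (auto simp: trunc_def simp del: real_sqrt_le_iff real_sqrt_less_iff)
  qed
  have zR: "\<forall>\<^sub>F x in at_right (pt n). 0 = trunc M f x" if "n \<ge> M" for f
  proof -
    have "pt M \<le> pt n" using that by simp
    then show ?thesis
      unfolding eventually_at_right_field by (intro exI[of _ "pt n + 1"]) (auto simp: trunc_def simp del: real_sqrt_le_iff real_sqrt_less_iff)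
  qed
  have zL: "\<forall>\<^sub>F x in at_left (pt n). 0 = trunc M f x" if "n > M" for f
  proof -
    have "pt M < pt n" using that by simp
    then show ?thesis
      unfolding eventually_at_left_field by (intro exI[of _ "pt M"]) (auto simp: trunc_def simp del: real_sqrt_le_iff real_sqrt_less_iff)
  qed
  obtain p where p: "(v \<longlongrightarrow> p) (at_left (pt n))" "(v \<longlongrightarrow> p + of_real (a n) * u (pt n)) (at_right (pt n))"
    using assms(1) n by (auto simp: dsol_def)
  have tu: "trunc M u (pt n) = (if n < M then u (pt n) else 0)" by (simp add: trunc_def)
  have tz: "trunc M u (pt M) = 0" by (simp add: trunc_def)
  consider "n < M" | "n = M" | "n > M" by linarith
  then show "\<exists>p. (trunc M v \<longlongrightarrow> p) (at_left (pt n)) \<and> (trunc M v \<longlongrightarrow> p + of_real (a n) * trunc M u (pt n)) (at_right (pt n))"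
  proof cases
    case 1
    then show ?thesis
      using Lim_transform_eventually[OF p(1) evL] Lim_transform_eventually[OF p(2) evR]
      by (intro exI[of _ p]) (auto simp: tu tz)
  next
    case 2
    then show ?thesis
      using Lim_transform_eventually[OF v evL[unfolded 2]] Lim_transform_eventually[OF tendsto_const zR]
      by (intro exI[of _ 0]) (auto simp: tu tz)
  next
    case 3
    then show ?thesis
      using Lim_transform_eventually[OF tendsto_const zL] Lim_transform_eventually[OF tendsto_const zR]
      by (intro exI[of _ 0]) (auto simp: tu tz)
  qed
qed

text \<open>The product rule adds \<open>w' * u\<close> to the derivative, which is continuous. The
  jump is therefore \<open>w\<close> times the old one, and the interface conditions survive the
  multiplication.\<close>

lemma dsol_mult:
  fixes w :: "real \<Rightarrow> complex"
  assumes "dsol a u v g"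
    and w1: "\<And>x. (w has_vector_derivative w' x) (at x)"
    and w2: "\<And>x. (w' has_vector_derivative w'' x) (at x)"
    and w3: "continuous_on UNIV w''"
  shows "dsol a (\<lambda>x. w x * u x) (\<lambda>x. w x * v x + w' x * u x) (\<lambda>x. w x * g x + 2 * w' x * v x + w'' x * u x)"
proof -
  have c: "continuous_on S w" "continuous_on S w'" "continuous_on S w''" for S
    using w1 w2 continuous_on_subset[OF w3]
    by (auto intro!: continuous_at_imp_continuous_on has_vector_derivative_continuous)
  have lim: "(w \<longlongrightarrow> w x) (at x within S)" "(w' \<longlongrightarrow> w' x) (at x within S)" for x S
    using c(1,2)[of UNIV] by (auto simp: continuous_on_def intro: tendsto_within_subset)
  have ACX: "absolutely_continuous_on s t f"
    if "\<And>x. (f has_vector_derivative f' x) (at x)" "continuous_on UNIV f'" for s t and f f' :: "real \<Rightarrow> complex"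
  proof -
    have "bounded (f' ` {s..t})"
      by (intro compact_imp_bounded compact_continuous_image) (auto intro: continuous_on_subset[OF that(2)])
    then obtain B where "\<forall>y\<in>f' ` {s..t}. cmod y \<le> B" unfolding bounded_iff by blast
    then show ?thesis
      by (intro differentiable_bounded_imp_absolutely_continuous_on[of _ _ _ f' B])
         (auto intro: has_vector_derivative_at_within[OF that(1)])
  qed
  show ?thesis
    unfolding dsol_def
  proof (intro conjI ballI allI impI)
    show "continuous_on half_line (\<lambda>x. w x * u x)"
      by (intro continuous_intros c dsolD(1)[OF assms(1)])
  next
    fix x assume "x \<in> half_line - grid"
    then have "(u has_vector_derivative v x) (at x within half_line)" using dsolD(2)[OF assms(1)] by auto
    from has_vector_derivative_mult[OF has_vector_derivative_at_within[OF w1] this]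
    show "((\<lambda>x. w x * u x) has_vector_derivative w x * v x + w' x * u x) (at x within half_line)" .
  next
    show "(\<lambda>x. w x * v x + w' x * u x) \<in> AC_loc (half_line - grid)"
      using dsolD(3)[OF assms(1)] dform_AC[OF dsol_imp_dform[OF assms(1)]] unfolding AC_loc_def
      by (auto intro!: absolutely_continuous_on_add absolutely_continuous_on_mult ACX[OF w1] ACX[OF w2] c)
  next
    have "AE x in half_line_measure. x \<notin> grid"
      unfolding AE_half_line_iff using negligible_grid by blast
    with dsolD(4)[OF assms(1)] AE_space
    show "AE x in half_line_measure. ((\<lambda>x. w x * v x + w' x * u x) has_vector_derivative
        w x * g x + 2 * w' x * v x + w'' x * u x) (at x within half_line)"
    proof eventually_elim
      case (elim x)
      then have "(u has_vector_derivative v x) (at x within half_line)" using dsolD(2)[OF assms(1)] by auto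
      from has_vector_derivative_add[OF has_vector_derivative_mult[OF has_vector_derivative_at_within[OF w1] elim(1)]
          has_vector_derivative_mult[OF has_vector_derivative_at_within[OF w2] this]]
      show ?case by (simp add: algebra_simps)
    qed
  next
    fix b
    have c2: "continuous_on half_line (\<lambda>x. 2 * w' x)" by (intro continuous_on_mult_left c)
    have "(\<lambda>x. w'' x * u x) absolutely_integrable_on {0..b}"
      by (rule absolutely_integrable_continuous_real,
          rule continuous_on_mult[OF c(3) continuous_on_subset[OF dsolD(1)[OF assms(1)]]]) auto
    from set_integral_add(1)[OF set_integral_add(1)[OF
        absolutely_integrable_continuous_mult[OF dsolD(5)[OF assms(1)] c(1)]
        absolutely_integrable_continuous_mult[OF dform_derivative_integrable[OF dsol_imp_dform[OF assms(1)]] c2]] this]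
    show "(\<lambda>x. w x * g x + 2 * w' x * v x + w'' x * u x) absolutely_integrable_on {0..b}" .
  next
    fix n :: nat assume n: "n \<ge> 1"
    obtain p where p: "(v \<longlongrightarrow> p) (at_left (pt n))" "(v \<longlongrightarrow> p + of_real (a n) * u (pt n)) (at_right (pt n))"
      using assms(1) n by (auto simp: dsol_def)
    have "((\<lambda>x. w x * v x + w' x * u x) \<longlongrightarrow> w (pt n) * p + w' (pt n) * u (pt n)) (at_left (pt n))"
      using n by (intro tendsto_intros lim p half_line_filters(2)[OF dsolD(1)[OF assms(1)]]) auto
    moreover have "((\<lambda>x. w x * v x + w' x * u x) \<longlongrightarrow> w (pt n) * (p + of_real (a n) * u (pt n)) + w' (pt n) * u (pt n)) (at_right (pt n))"
      by (intro tendsto_intros lim p half_line_filters(1)[OF dsolD(1)[OF assms(1)]]) auto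
    ultimately show "\<exists>p. ((\<lambda>x. w x * v x + w' x * u x) \<longlongrightarrow> p) (at_left (pt n)) \<and>
         ((\<lambda>x. w x * v x + w' x * u x) \<longlongrightarrow> p + of_real (a n) * (w (pt n) * u (pt n))) (at_right (pt n))"
      by (intro exI[of _ "w (pt n) * p + w' (pt n) * u (pt n)"]) (simp add: algebra_simps)
  qed
qed

text \<open>Where the value is 0 the interface condition asks for a derivative without jump,
  whatever the strength.\<close>

lemma dsol_smooth:
  fixes u :: "real \<Rightarrow> complex"
  assumes u1: "\<And>x. (u has_vector_derivative u' x) (at x)"
    and u2: "\<And>x. (u' has_vector_derivative u'' x) (at x)"
    and u3: "continuous_on UNIV u''"
    and z: "\<And>n. n \<ge> 1 \<Longrightarrow> u (pt n) = 0"
  shows "dsol a u u' u''"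
proof -
  have "dsol a (\<lambda>x. (\<lambda>n. u) (cell x) x) (\<lambda>x. (\<lambda>n. u') (cell x) x) u''"
  proof (rule dsol_cellsI)
    fix n :: nat
    have "bounded (u'' ` {pt n..pt (Suc n)})"
      by (intro compact_imp_bounded compact_continuous_image) (auto intro: continuous_on_subset[OF u3])
    then obtain B where "\<forall>y\<in>u'' ` {pt n..pt (Suc n)}. cmod y \<le> B" unfolding bounded_iff by blast
    then show "absolutely_continuous_on (pt n) (pt (Suc n)) u'"
      by (intro differentiable_bounded_imp_absolutely_continuous_on[of _ _ _ u'' B])
         (auto intro: has_vector_derivative_at_within[OF u2])
  next
    show "u'' absolutely_integrable_on {0..b}" for b
      by (intro absolutely_integrable_continuous_real continuous_on_subset[OF u3]) auto
  qed (auto simp: z u2 intro: has_vector_derivative_at_within[OF u1])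
  then show ?thesis by simp
qed

section \<open>Square integrability from bounds and supports\<close>

text \<open>The explicit norm bound depends only on the length of the interval. It later keeps the
  norm and the kinetic energy of the localized test functions bounded uniformly in their
  position.\<close>

lemma L2_bounded_interval:
  fixes f :: "real \<Rightarrow> complex"
  assumes "f \<in> borel_measurable half_line_measure"
    and "AE x in half_line_measure. cmod (f x) \<le> (if c \<le> x \<and> x \<le> b then B else 0)" and "0 \<le> c"
  shows "f \<in> L2" and "(L2_norm f)\<^sup>2 \<le> B\<^sup>2 * max (b - c) 0"
proof -
  have meas: "emeasure half_line_measure {c..b} = ennreal (max (b - c) 0)"
    using assms(3) by (subst emeasure_restrict_space) (auto simp: max_def emeasure_lborel_Icc_eq)
  have s: "{c..b} \<in> sets half_line_measure"
    using assms(3) by (subst sets_restrict_space_iff) auto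
  have int: "integrable half_line_measure (indicat_real {c..b})"
    using meas s by (intro integrable_real_indicator) auto
  have m: "(\<integral>x. indicat_real {c..b} x \<partial>half_line_measure) \<le> max (b - c) 0"
  proof -
    have "measure half_line_measure {c..b} = max (b - c) 0" using meas by (simp add: measure_def)
    moreover have "(\<integral>x. indicat_real {c..b} x \<partial>half_line_measure) = measure half_line_measure {c..b}"
      using Bochner_Integration.integral_indicator[of half_line_measure "{c..b}"] assms(3)
      by (simp add: max_absorb1)
    ultimately show ?thesis by simp
  qed
  have le: "AE x in half_line_measure. (cmod (f x))\<^sup>2 \<le> B\<^sup>2 * indicat_real {c..b} x"
    using assms(2) AE_space
  proof eventually_elim
    case (elim x)
    then show ?case
      using power_mono[of "cmod (f x)" B 2] by (auto simp: indicator_def split: if_splits)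
  qed
  have fi: "integrable half_line_measure (\<lambda>x. (cmod (f x))\<^sup>2)"
  proof (rule Bochner_Integration.integrable_bound)
    show "integrable half_line_measure (\<lambda>x. B\<^sup>2 * indicat_real {c..b} x)" using int by simp
    show "AE x in half_line_measure. norm ((cmod (f x))\<^sup>2) \<le> norm (B\<^sup>2 * indicat_real {c..b} x)"
      using le by eventually_elim simp
  qed (use assms(1) in measurable)
  then show "f \<in> L2" using assms(1) by (simp add: L2_def)
  have "(L2_norm f)\<^sup>2 \<le> (\<integral>x. B\<^sup>2 * indicat_real {c..b} x \<partial>half_line_measure)"
    unfolding L2_norm_square by (rule integral_mono_AE[OF fi _ le]) (use int in simp)
  also have "\<dots> \<le> B\<^sup>2 * max (b - c) 0" using m by (simp add: mult_left_mono)
  finally show "(L2_norm f)\<^sup>2 \<le> B\<^sup>2 * max (b - c) 0" .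
qed

lemma L2_bounded_support:
  fixes f :: "real \<Rightarrow> complex"
  assumes "f \<in> borel_measurable half_line_measure"
    and "AE x in half_line_measure. cmod (f x) \<le> (if x \<le> b then B else 0)"
  shows "f \<in> L2"
proof (rule L2_bounded_interval(1)[OF assms(1), of 0 b B])
  show "AE x in half_line_measure. cmod (f x) \<le> (if 0 \<le> x \<and> x \<le> b then B else 0)"
    using assms(2) AE_space by eventually_elim auto
qed simp

lemma continuous_measurable_half_line:
  fixes u :: "real \<Rightarrow> complex"
  shows "continuous_on half_line u \<Longrightarrow> u \<in> borel_measurable half_line_measure"
  by (rule continuous_imp_measurable_on_sets_lebesgue) auto

lemma L2_continuous_support:
  fixes u :: "real \<Rightarrow> complex"
  assumes u: "continuous_on {0..b} u" and h: "h \<in> borel_measurable half_line_measure"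
    and h1: "\<And>x. 0 \<le> x \<Longrightarrow> x \<le> b \<Longrightarrow> cmod (h x) \<le> cmod (u x)" and h2: "\<And>x. x > b \<Longrightarrow> h x = 0"
  shows "h \<in> L2"
proof -
  have "bounded (u ` {0..b})" by (intro compact_imp_bounded compact_continuous_image u) auto
  then obtain B where "\<forall>y\<in>u ` {0..b}. cmod y \<le> B" unfolding bounded_iff by blast
  then show ?thesis
    using h1 h2 by (intro L2_bounded_support[OF h, of b B] AE_I2) (fastforce intro: order_trans)
qed

lemma L2_square_integrable_on:
  assumes "f \<in> L2" "S \<in> sets lebesgue" "S \<subseteq> half_line"
  shows "(\<lambda>x. (cmod (f x))\<^sup>2) integrable_on S"
proof -
  have "(\<lambda>x. (cmod (f x))\<^sup>2) absolutely_integrable_on half_line"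
    using L2_integrable[OF assms(1)] unfolding set_integrable_def
    by (subst (asm) integrable_restrict_space) auto
  then have "(\<lambda>x. (cmod (f x))\<^sup>2) absolutely_integrable_on S"
    by (rule set_integrable_subset) (use assms in auto)
  then show ?thesis by (simp add: absolutely_integrable_on_def)
qed

lemma L2_absolutely_integrable:
  assumes "f \<in> L2"
  shows "f absolutely_integrable_on {0..b}"
proof (rule measurable_bounded_by_integrable_imp_absolutely_integrable)
  show "f \<in> borel_measurable (lebesgue_on {0..b})"
    by (rule measurable_half_line_Icc[OF L2_measurable[OF assms]])
  show "(\<lambda>x. 1 + (cmod (f x))\<^sup>2) integrable_on {0..b}"
    by (intro integrable_add L2_square_integrable_on[OF assms]) auto
  show "cmod (f x) \<le> 1 + (cmod (f x))\<^sup>2" for x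
    using sum_squares_bound[of 1 "cmod (f x)"] by (simp add: power2_eq_square) (smt (verit) norm_ge_zero)
qed simp

section \<open>The minimal operator and its adjoint\<close>

abbreviation T :: "(nat \<Rightarrow> real) \<Rightarrow> L2_graph" where
  "T a \<equiv> minus_second_derivative (delta_domain pt a)"

lemma interaction_set_pt [simp]: "interaction_set pt = grid"
  by (simp add: interaction_set_def grid_def)

section \<open>Domain elements as compactly supported local solutions\<close>

lemma D_half_line_eq:
  "x \<ge> 0 \<Longrightarrow> (f has_vector_derivative y) (at x within half_line) \<Longrightarrow> D_half_line f x = y"
  unfolding D_half_line_def using at_within_half_line_neq_bot by (rule vector_derivative_within)

lemma AC_loc_cong:
  assumes "\<And>x. x \<in> S \<Longrightarrow> f x = g x" "g \<in> AC_loc S"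
  shows "f \<in> AC_loc S"
  using assms unfolding AC_loc_def by (auto intro!: absolutely_continuous_on_cong[of _ _ f g])

text \<open>Transfers a solution to the original definition, in which derivatives are
  \<open>D_half_line\<close> of the function itself. Since \<open>D_half_line u\<close> is known to
  agree with \<open>v\<close> only off the grid, second derivatives and one-sided limits are
  compared on neighbourhoods, two-sided or one-sided, that avoid the grid.\<close>

lemma dsol_in_T:
  assumes "dsol a u v g" "v 0 = 0" and supp: "\<And>x. x > b \<Longrightarrow> u x = 0" and g: "g \<in> L2"
  shows "u \<in> L2" "(u, \<lambda>x. - g x) \<in> T a"
proof -
  note D = dsolD[OF assms(1)]
  show uL: "u \<in> L2"
    by (rule L2_continuous_support[OF continuous_on_subset[OF D(1)] continuous_measurable_half_line[OF D(1)]])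
       (use supp in auto)
  have Du: "D_half_line u x = v x" if "x \<in> half_line - grid" for x
    using D_half_line_eq D(2) that by auto
  obtain N where N: "negligible N" "\<And>x. x \<ge> 0 \<Longrightarrow> x \<notin> N \<Longrightarrow> (v has_vector_derivative g x) (at x within half_line)"
    using D(4) by (auto simp: AE_half_line_iff)
  have DDu: "(D_half_line u has_vector_derivative g x) (at x within half_line)"
    if x: "x \<ge> 0" "x \<notin> N \<union> grid" for x
  proof -
    obtain d where d: "d > 0" "\<forall>y\<in>half_line. dist y x < d \<longrightarrow> y \<notin> grid"
      using eventually_off_grid[of x] x by auto
    show ?thesis
      by (rule has_vector_derivative_transform_within[OF N(2) d(1)]) (use x d Du in auto)
  qed
  have neg: "negligible (N \<union> grid)" using N negligible_grid by (auto intro: negligible_Un)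
  have eq: "L2_eq g (D_half_line (D_half_line u))"
    unfolding L2_eq_def AE_half_line_iff
    by (intro exI[of _ "N \<union> grid"] conjI neg) (auto simp: D_half_line_eq[OF _ DDu])
  have "u \<in> delta_domain pt a"
    unfolding delta_domain_def W22_comp_def W22_def interaction_set_pt mem_Collect_eq
  proof (intro conjI ballI allI impI uL)
    show "u \<in> AC_loc (half_line - grid)"
      using dform_AC[OF dsol_imp_dform[OF assms(1)]] by (auto simp: AC_loc_def)
    show "u differentiable at x within half_line" if "x \<in> half_line - grid" for x
      using D(2)[of x] that by (auto intro: differentiableI_vector)
    show "D_half_line u \<in> AC_loc (half_line - grid)"
      by (rule AC_loc_cong[OF Du D(3)])
    show "AE x in half_line_measure. D_half_line u differentiable at x within half_line"
      unfolding AE_half_line_iff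
      by (intro exI[of _ "N \<union> grid"] conjI neg) (auto intro: differentiableI_vector[OF DDu])
    show "D_half_line (D_half_line u) \<in> L2"
      by (rule L2_cong_AE[OF g eq])
    have "{x \<in> half_line - grid. u x \<noteq> 0} \<subseteq> {0..b}" using supp by force
    then show "compact (closure {x \<in> half_line - grid. u x \<noteq> 0})"
      by (meson bounded_closed_interval bounded_subset compact_closure)
    show "D_half_line u 0 = 0" using Du[of 0] assms(2) by simp
  next
    fix n :: nat assume n: "n \<ge> 1"
    obtain p where p: "(v \<longlongrightarrow> p) (at_left (pt n))" "(v \<longlongrightarrow> p + of_real (a n) * u (pt n)) (at_right (pt n))"
      using assms(1) n by (auto simp: dsol_def)
    have ev: "\<forall>\<^sub>F x in at_left (pt n). v x = D_half_line u x" "\<forall>\<^sub>F x in at_right (pt n). v x = D_half_line u x"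
      using grid_eventually[OF n] by (auto elim!: eventually_mono simp: Du)
    show "\<exists>c p q. (u \<longlongrightarrow> c) (at_left (pt n)) \<and> (u \<longlongrightarrow> c) (at_right (pt n)) \<and>
        (D_half_line u \<longlongrightarrow> p) (at_left (pt n)) \<and> (D_half_line u \<longlongrightarrow> q) (at_right (pt n)) \<and>
        q - p = of_real (a n) * c"
      using n half_line_filters[OF D(1), of "pt n"] Lim_transform_eventually[OF p(1) ev(1)] Lim_transform_eventually[OF p(2) ev(2)]
      by (intro exI[of _ "u (pt n)"] exI[of _ p] exI[of _ "p + of_real (a n) * u (pt n)"]) auto
  qed
  then show "(u, \<lambda>x. - g x) \<in> T a"
    unfolding minus_second_derivative_def using uL g eq
    by (auto simp: L2_eq_def intro!: bexI[of _ u] elim: eventually_mono)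
qed

text \<open>The converse translation. Functions in the domain have arbitrary values on the grid;
  replacing these by the common one-sided limits gives a continuous representative of the same L2
  class. The compact support is enlarged to end at a point \<open>pt m\<close>, where the identities
  on cells can be applied.\<close>

lemma T_E:
  assumes "(f, k) \<in> T a"
  obtains u v g m where "dsol a u v g" "v 0 = 0" "\<And>x. x \<ge> pt m \<Longrightarrow> u x = 0"
    "u \<in> L2" "g \<in> L2" "L2_eq f u" "L2_eq k (\<lambda>x. - g x)"
proof -
  obtain w where w: "w \<in> delta_domain pt a" "L2_eq f w" "L2_eq k (\<lambda>x. - D_half_line (D_half_line w) x)"
    and fL: "f \<in> L2"
    using assms by (auto simp: minus_second_derivative_def)
  define v where "v = D_half_line w"
  define g where "g = D_half_line v"
  have W: "w \<in> L2" "\<And>x. x \<in> half_line - grid \<Longrightarrow> w differentiable at x within half_line"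
     "v \<in> AC_loc (half_line - grid)" "AE x in half_line_measure. v differentiable at x within half_line"
     "g \<in> L2" "compact (closure {x \<in> half_line - grid. w x \<noteq> 0})" "v 0 = 0"
    using w(1) by (auto simp: delta_domain_def W22_comp_def W22_def v_def g_def)
  have der: "(w has_vector_derivative v x) (at x within half_line)" if "x \<ge> 0" "x \<notin> grid" for x
    using W(2)[of x] that unfolding vector_derivative_works v_def D_half_line_def by auto
  have "\<forall>n\<in>{1..}. \<exists>c p q. (w \<longlongrightarrow> c) (at_left (pt n)) \<and> (w \<longlongrightarrow> c) (at_right (pt n)) \<and>
        (v \<longlongrightarrow> p) (at_left (pt n)) \<and> (v \<longlongrightarrow> q) (at_right (pt n)) \<and> q - p = of_real (a n) * c"
    using w(1) by (auto simp: delta_domain_def v_def)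
  then obtain c where c: "\<And>n. n \<ge> 1 \<Longrightarrow> \<exists>p q. (w \<longlongrightarrow> c n) (at_left (pt n)) \<and> (w \<longlongrightarrow> c n) (at_right (pt n)) \<and>
        (v \<longlongrightarrow> p) (at_left (pt n)) \<and> (v \<longlongrightarrow> q) (at_right (pt n)) \<and> q - p = of_real (a n) * c n"
    using bchoice[of "{1..}"] by (metis (mono_tags, lifting) atLeast_iff)
  \<comment> \<open>At a grid point \<open>cell\<close> returns its own index, so the value there is
    the prescribed limit.\<close>
  define u where "u x = (if x \<in> grid then c (cell x) else w x)" for x
  have u_pt: "u (pt n) = c n" if "n \<ge> 1" for n
    using that pt_in_grid[of n] by (simp add: u_def cell_def)
  have uw: "u x = w x" if "x \<notin> grid" for x using that by (simp add: u_def)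
  have cont: "continuous_on half_line u"
    unfolding continuous_on_def
  proof
    fix x assume x: "x \<in> half_line"
    show "(u \<longlongrightarrow> u x) (at x within half_line)"
    proof (cases "x \<in> grid")
      case True
      then obtain n where n: "n \<ge> 1" "x = pt n" by (auto simp: grid_def)
      have ev: "\<forall>\<^sub>F x in at_left (pt n). w x = u x" "\<forall>\<^sub>F x in at_right (pt n). w x = u x"
        using grid_eventually[OF n(1)] by (auto elim!: eventually_mono simp: uw)
      have "(u \<longlongrightarrow> c n) (at_left (pt n))" "(u \<longlongrightarrow> c n) (at_right (pt n))"
        using c[OF n(1)] Lim_transform_eventually[OF _ ev(1)] Lim_transform_eventually[OF _ ev(2)] by blast+
      then have "(u \<longlongrightarrow> c n) (at (pt n))" by (rule filterlim_split_at)
      then show ?thesis using n u_pt[OF n(1)] by (simp add: at_within_half_line)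
    next
      case False
      obtain d where d: "d > 0" "\<forall>y\<in>half_line. dist y x < d \<longrightarrow> y \<notin> grid"
        using eventually_off_grid[of x] x False by auto
      have "(w \<longlongrightarrow> w x) (at x within half_line)"
        using has_vector_derivative_continuous[OF der[of x]] x False by (auto simp: continuous_within)
      moreover have "\<forall>\<^sub>F y in at x within half_line. w y = u y"
        unfolding eventually_at using d uw by (intro exI[of _ d]) auto
      ultimately show ?thesis unfolding uw[OF False] by (rule Lim_transform_eventually)
    qed
  qed
  have ae: "AE x in half_line_measure. x \<notin> grid"
    unfolding AE_half_line_iff using negligible_grid by blast
  have ds: "dsol a u v g"
    unfolding dsol_def
  proof (intro conjI ballI allI impI cont W(3))
    fix x assume x: "x \<in> half_line - grid"
    obtain d where d: "d > 0" "\<forall>y\<in>half_line. dist y x < d \<longrightarrow> y \<notin> grid"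
      using eventually_off_grid[of x] x by auto
    show "(u has_vector_derivative v x) (at x within half_line)"
      by (rule has_vector_derivative_transform_within[OF der d(1)]) (use x d uw in auto)
  next
    show "AE x in half_line_measure. (v has_vector_derivative g x) (at x within half_line)"
      using W(4) by eventually_elim (simp add: vector_derivative_works g_def D_half_line_def[abs_def])
    show "g absolutely_integrable_on {0..b}" for b by (rule L2_absolutely_integrable[OF W(5)])
  next
    fix n :: nat assume n: "n \<ge> 1"
    then obtain p q where "(v \<longlongrightarrow> p) (at_left (pt n))" "(v \<longlongrightarrow> q) (at_right (pt n))" "q - p = of_real (a n) * c n"
      using c by blast
    then show "\<exists>p. (v \<longlongrightarrow> p) (at_left (pt n)) \<and> (v \<longlongrightarrow> p + of_real (a n) * u (pt n)) (at_right (pt n))"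
      using u_pt[OF n] by (intro exI[of _ p]) (auto simp: algebra_simps)
  qed
  obtain B where B: "\<And>x. x \<ge> 0 \<Longrightarrow> x \<notin> grid \<Longrightarrow> w x \<noteq> 0 \<Longrightarrow> x \<le> B"
  proof -
    have "bounded {x \<in> half_line - grid. w x \<noteq> 0}" using W(6) by (simp add: compact_closure)
    then obtain B where "\<forall>x\<in>{x \<in> half_line - grid. w x \<noteq> 0}. norm x \<le> B" unfolding bounded_iff by blast
    then show thesis using that[of B] by auto
  qed
  define m where "m = Suc (cell \<bar>B\<bar>)"
  have m: "pt m > B" using pt_cell(2)[of "\<bar>B\<bar>"] by (simp add: m_def)
  \<comment> \<open>The support condition controls \<open>w\<close> off the grid only; at a grid
    point beyond \<open>B\<close> the value 0 comes from continuity, as a right limit of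
    zeros.\<close>
  have supp: "u x = 0" if x: "x \<ge> pt m" for x
  proof (cases "x \<in> grid")
    case True
    then obtain n where n: "n \<ge> 1" "x = pt n" by (auto simp: grid_def)
    have "\<forall>\<^sub>F y in at_right x. 0 = u y"
      using grid_eventually(2)[OF n(1), folded n(2)] eventually_at_right_less[of x]
    proof eventually_elim
      case (elim y)
      then show ?case using B[of y] m x uw[of y] by force
    qed
    then have "(u \<longlongrightarrow> 0) (at_right x)" using Lim_transform_eventually[OF tendsto_const] by blast
    moreover have "(u \<longlongrightarrow> u x) (at_right x)" using half_line_filters(1)[OF cont] n by simp
    ultimately show ?thesis using tendsto_unique trivial_limit_at_right_real by blast
  next
    case False
    have "x \<ge> 0" using x by (auto intro: order_trans[of 0 "pt m"])
    then show ?thesis using B[of x] m x False uw by force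
  qed
  have uwae: "L2_eq w u" unfolding L2_eq_def using ae by eventually_elim (simp add: uw)
  have "u \<in> L2" by (rule L2_cong_AE[OF W(1) uwae])
  moreover have "L2_eq f u"
    using w(2) uwae unfolding L2_eq_def by eventually_elim simp
  moreover have "L2_eq k (\<lambda>x. - g x)" using w(3) by (simp add: g_def v_def)
  ultimately show thesis using that[OF ds W(7) supp] W(5) by blast
qed

text \<open>Beyond the support the derivative vanishes off the grid. The left limit is taken one
  grid point further, at \<open>pt (Suc m)\<close>, where Green's formula ends.\<close>

lemma dsol_support_limit:
  assumes "dsol a u v g" "\<And>x. x \<ge> pt m \<Longrightarrow> u x = 0"
  shows "(v \<longlongrightarrow> 0) (at_left (pt (Suc m)))" "AE x in half_line_measure. x > pt m \<longrightarrow> g x = 0"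
proof -
  have v0: "v x = 0" if x: "x > pt m" "x \<notin> grid" for x
  proof -
    have x0: "x > 0" using x(1) by (auto intro: le_less_trans[of 0 "pt m"])
    have "(u has_vector_derivative v x) (at x)"
      using dsolD(2)[OF assms(1), of x] x x0 by (simp add: at_within_half_line)
    moreover have "(u has_vector_derivative 0) (at x)"
      by (rule has_vector_derivative_transform_within_open[of "\<lambda>x. 0" _ _ "{pt m<..}"])
         (use x assms(2) in auto)
    ultimately show ?thesis by (rule vector_derivative_unique_at)
  qed
  show "(v \<longlongrightarrow> 0) (at_left (pt (Suc m)))"
  proof (rule Lim_transform_eventually[OF tendsto_const])
    have "pt m < pt (Suc m)" by (simp add: of_nat_Suc)
    then show "\<forall>\<^sub>F x in at_left (pt (Suc m)). 0 = v x"
      unfolding eventually_at_left_field using v0 open_cell_grid[of m] by (intro exI[of _ "pt m"]) auto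
  qed
  have ae: "AE x in half_line_measure. x \<notin> grid"
    unfolding AE_half_line_iff using negligible_grid by blast
  show "AE x in half_line_measure. x > pt m \<longrightarrow> g x = 0"
    using dsolD(4)[OF assms(1)] ae AE_space
  proof (eventually_elim, intro impI)
    fix x assume x: "(v has_vector_derivative g x) (at x within half_line)" "x \<notin> grid" "x \<in> space half_line_measure" "x > pt m"
    have x0: "x > 0" using x(4) by (auto intro: le_less_trans[of 0 "pt m"])
    obtain n where n: "pt n < x" "x < pt (Suc n)" using grid_cases[of x] x x0 by (metis less_irrefl less_imp_le)
    have "(v has_vector_derivative g x) (at x)" using x x0 by (simp add: at_within_half_line)
    moreover have "(v has_vector_derivative 0) (at x)"
      by (rule has_vector_derivative_transform_within_open[of "\<lambda>x. 0" _ _ "{max (pt m) (pt n)<..<pt (Suc n)}"])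
         (use x n v0 open_cell_grid[of n] in auto)
    ultimately show "g x = 0" by (rule vector_derivative_unique_at)
  qed
qed

lemma L2_inner_eq_integral:
  assumes "f \<in> L2" "h \<in> L2" "AE x in half_line_measure. x > b \<longrightarrow> f x * cnj (h x) = 0"
  shows "L2_inner f h = integral {0..b} (\<lambda>x. f x * cnj (h x))"
proof -
  obtain N where N: "negligible N" "\<And>x. x \<ge> 0 \<Longrightarrow> x \<notin> N \<Longrightarrow> x > b \<Longrightarrow> f x * cnj (h x) = 0"
    using assms(3) by (auto simp: AE_half_line_iff)
  have "L2_inner f h = integral half_line (\<lambda>x. f x * cnj (h x))"
    unfolding L2_inner_def by (rule lebesgue_integral_eq_integral[OF L2_inner_integrable[OF assms(1,2)]]) simp
  also have "\<dots> = integral {0..b} (\<lambda>x. f x * cnj (h x))"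
  proof (rule integral_spike_set)
    have "{x \<in> half_line - {0..b}. f x * cnj (h x) \<noteq> 0} \<subseteq> N"
    proof
      fix x assume "x \<in> {x \<in> half_line - {0..b}. f x * cnj (h x) \<noteq> 0}"
      then have "x \<ge> 0" "x > b" "f x * cnj (h x) \<noteq> 0" by auto
      then show "x \<in> N" using N(2) by blast
    qed
    then show "negligible {x \<in> half_line - {0..b}. f x * cnj (h x) \<noteq> 0}"
      by (rule negligible_subset[OF N(1)])
    have "{x \<in> {0..b} - half_line. f x * cnj (h x) \<noteq> 0} = {}" by auto
    then show "negligible {x \<in> {0..b} - half_line. f x * cnj (h x) \<noteq> 0}" by (simp only: negligible_empty)
  qed
  finally show ?thesis .
qed

lemma T_subset: "T a \<subseteq> L2 \<times> L2"
  by (auto simp: minus_second_derivative_def)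

text \<open>The Wronskian vanishes at both ends: at 0 by the Neumann conditions, and at
  \<open>pt (Suc m)\<close> because the compactly supported solution has value and left derivative 0
  there. The second solution may be global.\<close>

lemma dsol_symmetric:
  assumes "dsol a u v g" "v 0 = 0" "\<And>x. x \<ge> pt m \<Longrightarrow> u x = 0" and 2: "dsol a w w' k" "w' 0 = 0"
  shows "((\<lambda>x. g x * w x - u x * k x) has_integral 0) {0..pt (Suc m)}"
proof -
  obtain l where "(w' \<longlongrightarrow> l) (at_left (pt (Suc m)))" using 2(1) unfolding dsol_def by (metis le_add1 plus_1_eq_Suc)
  from dsol_wronskian[OF assms(1) 2(1) dsol_support_limit(1)[OF assms(1,3)] this]
  show ?thesis using assms by simp
qed

text \<open>The claim reduces to the vanishing Wronskian of one domain element and the conjugate of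
  the other, on a bounded interval containing the support of the first.\<close>

lemma T_symmetric: "T a \<subseteq> operator_adjoint (T a)"
proof clarify
  fix f k assume fk: "(f, k) \<in> T a"
  have "L2_inner q f = L2_inner p k" if pq: "(p, q) \<in> T a" for p q
  proof -
    obtain u v g m where u: "dsol a u v g" "v 0 = 0" "\<And>x. x \<ge> pt m \<Longrightarrow> u x = 0"
      "u \<in> L2" "g \<in> L2" "L2_eq f u" "L2_eq k (\<lambda>x. - g x)" using T_E[OF fk] by metis
    obtain u' v' g' m' where u': "dsol a u' v' g'" "v' 0 = 0" "\<And>x. x \<ge> pt m' \<Longrightarrow> u' x = 0"
      "u' \<in> L2" "g' \<in> L2" "L2_eq p u'" "L2_eq q (\<lambda>x. - g' x)" using T_E[OF pq] by metis
    have L: "f \<in> L2" "k \<in> L2" "p \<in> L2" "q \<in> L2" using fk pq T_subset by auto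
    have g'0: "AE x in half_line_measure. x > pt m' \<longrightarrow> g' x = 0"
      by (rule dsol_support_limit(2)[OF u'(1)]) (rule u'(3))
    define b where "b = pt (Suc m')"
    have b: "pt m' < b" by (simp add: b_def of_nat_Suc)
    have "integral {0..b} (\<lambda>x. g' x * cnj (u x) - u' x * cnj (g x)) = 0"
      unfolding b_def by (rule integral_unique, rule dsol_symmetric[OF u'(1-3) dsol_cnj[OF u(1)]]) (use u in auto)
    moreover have ints: "(\<lambda>x. g' x * cnj (u x)) integrable_on {0..b}" "(\<lambda>x. u' x * cnj (g x)) integrable_on {0..b}"
    proof -
      have "continuous_on half_line (\<lambda>x. cnj (u x))" "continuous_on half_line u'"
        using dsolD(1)[OF u(1)] dsolD(1)[OF u'(1)] by (auto intro: continuous_intros)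
      from absolutely_integrable_continuous_mult[OF dsolD(5)[OF u'(1)] this(1), of b]
        absolutely_integrable_continuous_mult[OF dsolD(5)[OF dsol_cnj[OF u(1)]] this(2), of b]
      show "(\<lambda>x. g' x * cnj (u x)) integrable_on {0..b}" "(\<lambda>x. u' x * cnj (g x)) integrable_on {0..b}"
        by (auto simp: absolutely_integrable_on_def mult.commute)
    qed
    ultimately have eq: "integral {0..b} (\<lambda>x. g' x * cnj (u x)) = integral {0..b} (\<lambda>x. u' x * cnj (g x))"
      using integral_diff[OF ints] by simp
    have "L2_inner q f = L2_inner (\<lambda>x. - g' x) u"
      by (rule L2_inner_cong) (use L u u' in auto)
    also have "\<dots> = - L2_inner g' u" using L2_inner_cmult_left[of "-1" g' u] by simp
    also have "L2_inner g' u = integral {0..b} (\<lambda>x. g' x * cnj (u x))"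
      by (rule L2_inner_eq_integral[OF u'(5) u(4)])
         (use g'0 b in \<open>auto elim!: eventually_mono\<close>)
    also have "\<dots> = L2_inner u' g" unfolding eq
      by (rule L2_inner_eq_integral[OF u'(4) u(5), symmetric]) (use u'(3) b in auto)
    also have "- L2_inner u' g = L2_inner u' (\<lambda>x. - g x)" using L2_inner_cmult_right[of u' "-1" g] by simp
    also have "\<dots> = L2_inner p k"
      by (rule L2_inner_cong[symmetric]) (use L u u' in auto)
    finally show ?thesis .
  qed
  then show "(f, k) \<in> operator_adjoint (T a)"
    using fk T_subset by (fastforce simp: operator_adjoint_def)
qed

section \<open>Regularity of adjoint elements\<close>

lemma AE_half_line_exists:
  assumes "AE x in half_line_measure. P x" "d > 0"
  shows "\<exists>x. 0 \<le> x \<and> x < d \<and> P x"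
proof (rule ccontr)
  assume no: "\<not> ?thesis"
  obtain N where N: "negligible N" "\<And>x. x \<ge> 0 \<Longrightarrow> x \<notin> N \<Longrightarrow> P x"
    using assms(1) by (auto simp: AE_half_line_iff)
  have "box 0 d \<subseteq> N"
  proof
    fix x assume "x \<in> box 0 d"
    then have "0 \<le> x" "x < d" by (auto simp: box_real)
    then show "x \<in> N" using no N(2) by blast
  qed
  then have "negligible (box 0 d)" using N(1) negligible_subset by blast
  then show False using assms(2) negligible_interval(2)[of 0 d] by (simp add: box_real)
qed

lemma trunc_measurable:
  assumes "f \<in> borel_measurable half_line_measure"
  shows "trunc M f \<in> borel_measurable half_line_measure"
proof -
  have "(\<lambda>x. if x \<in> {..<pt M} then f x else 0) \<in> borel_measurable half_line_measure"
  proof (rule measurable_If_set)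
    show "{..<pt M} \<inter> space half_line_measure \<in> sets half_line_measure"
      by (subst sets_restrict_space_iff) auto
  qed (use assms in auto)
  then show ?thesis by (simp add: trunc_def[abs_def])
qed

lemma trunc_L2:
  assumes "f \<in> L2" shows "trunc M f \<in> L2"
proof (rule L2_dominated[OF assms, of _ 1])
  show "trunc M f \<in> borel_measurable half_line_measure"
    by (rule trunc_measurable[OF L2_measurable[OF assms]])
qed (auto simp: trunc_def intro!: AE_I2)

lemma trunc_continuous_L2:
  assumes "continuous_on half_line f"
  shows "trunc M f \<in> L2"
proof (rule L2_continuous_support[of "pt M" f])
  show "trunc M f \<in> borel_measurable half_line_measure"
    by (rule trunc_measurable[OF continuous_measurable_half_line[OF assms]])
  show "continuous_on {0..pt M} f" by (rule continuous_on_subset[OF assms]) auto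
qed (auto simp: trunc_def)

lemma L2_inner_trunc:
  assumes "\<And>x. x \<ge> pt M \<Longrightarrow> f x = 0"
  shows "L2_inner f (trunc M h) = L2_inner f h"
proof -
  have "(\<lambda>x. f x * cnj (trunc M h x)) = (\<lambda>x. f x * cnj (h x))"
    using assms by (auto simp: trunc_def)
  then show ?thesis by (simp add: L2_inner_def)
qed

lemma dsol_left_limit:
  assumes "dsol a u v g"
  obtains l where "(v \<longlongrightarrow> l) (at_left (pt (Suc m)))"
  using assms unfolding dsol_def by (metis le_add1 plus_1_eq_Suc)

text \<open>
  If the right-hand side is orthogonal to the solution \<open>\<theta>\<close> of the homogeneous initial value problem,
  the Wronskian of \<open>\<theta>\<close> and any solution \<open>y\<close> with vanishing initial data vanishes at the right end, so
  that a multiple of \<open>\<theta>\<close> can be subtracted from \<open>y\<close> to make both boundary values zero.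
\<close>

lemma dsol_compact_support:
  assumes \<theta>: "dsol a \<theta> \<theta>' (\<lambda>x. 0)" "\<theta> 0 = 1" "\<theta>' 0 = 0"
    and g: "g \<in> L2" "\<And>x. x \<ge> pt (Suc m) \<Longrightarrow> g x = 0"
    and orth: "L2_inner g (trunc (Suc m) (\<lambda>x. cnj (\<theta> x))) = 0"
  obtains u v where "dsol a u v g" "v 0 = 0" "\<And>x. x \<ge> pt (Suc m) \<Longrightarrow> u x = 0"
     "(v \<longlongrightarrow> 0) (at_left (pt (Suc m)))"
proof -
  define b where "b = pt (Suc m)"
  have b: "b > 0" by (simp add: b_def of_nat_Suc)
  have gi: "g absolutely_integrable_on {0..b}" for b by (rule L2_absolutely_integrable[OF g(1)])
  obtain y y' where y: "dsol a y y' g" "y 0 = 0" "y' 0 = 0" using dsol_exists[OF gi] by metis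
  \<comment> \<open>\<open>\<phi>\<close> certifies that the end values \<open>\<theta> b\<close>
    and \<open>l\<theta>\<close> are not both 0: its Wronskian with \<open>\<theta>\<close> is
    constant and nonzero.\<close>
  obtain \<phi> \<phi>' where \<phi>: "dsol a \<phi> \<phi>' (\<lambda>x. 0)" "\<phi> 0 = 0" "\<phi>' 0 = 1"
    using dsol_exists[where g = "\<lambda>x. 0" and a = a and c = 0 and d = 1] by auto
  obtain ly where ly: "(y' \<longlongrightarrow> ly) (at_left b)" using dsol_left_limit[OF y(1)] unfolding b_def by blast
  obtain l\<theta> where l\<theta>: "(\<theta>' \<longlongrightarrow> l\<theta>) (at_left b)" using dsol_left_limit[OF \<theta>(1)] unfolding b_def by blast
  obtain l\<phi> where l\<phi>: "(\<phi>' \<longlongrightarrow> l\<phi>) (at_left b)" using dsol_left_limit[OF \<phi>(1)] unfolding b_def by blast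
  have "((\<lambda>x. g x * \<theta> x) has_integral ly * \<theta> b - y b * l\<theta>) {0..b}"
    using dsol_wronskian[OF y(1) \<theta>(1) ly[unfolded b_def] l\<theta>[unfolded b_def]] y \<theta> by (simp add: b_def)
  moreover have "integral {0..b} (\<lambda>x. g x * \<theta> x) = 0"
  proof -
    have "0 = integral {0..b} (\<lambda>x. g x * cnj (trunc (Suc m) (\<lambda>x. cnj (\<theta> x)) x))"
      unfolding orth[symmetric]
      by (rule L2_inner_eq_integral)
         (use g \<theta>(1) in \<open>auto simp: b_def intro!: trunc_continuous_L2 dsolD(1)[OF dsol_cnj[OF \<theta>(1)]]\<close>)
    also have "(\<lambda>x. g x * cnj (trunc (Suc m) (\<lambda>x. cnj (\<theta> x)) x)) = (\<lambda>x. g x * \<theta> x)"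
      using g(2) by (auto simp: trunc_def)
    finally show ?thesis by simp
  qed
  ultimately have wr: "ly * \<theta> b = y b * l\<theta>" by (simp add: integral_unique)
  have "((\<lambda>x. 0) has_integral l\<theta> * \<phi> b - \<theta> b * l\<phi> + 1) {0..b}"
    using dsol_wronskian[OF \<theta>(1) \<phi>(1) l\<theta>[unfolded b_def] l\<phi>[unfolded b_def]] \<phi> \<theta> by (simp add: b_def)
  then have "l\<theta> * \<phi> b - \<theta> b * l\<phi> + 1 = 0" by (metis has_integral_0 has_integral_unique)
  then have nz: "\<theta> b \<noteq> 0 \<or> l\<theta> \<noteq> 0" by auto
  \<comment> \<open>By \<open>wr\<close> the pairs of end values of \<open>y\<close> and of
    \<open>\<theta>\<close> are proportional, and by \<open>nz\<close> the second pair is not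
    zero.\<close>
  obtain c where c: "y b = c * \<theta> b" "ly = c * l\<theta>"
  proof (cases "\<theta> b = 0")
    case True
    then show thesis using nz wr by (intro that[of "ly / l\<theta>"]) auto
  next
    case False
    then show thesis using wr by (intro that[of "y b / \<theta> b"]) (auto simp: field_simps)
  qed
  define f where "f x = y x + (- c) * \<theta> x" for x
  define f' where "f' x = y' x + (- c) * \<theta>' x" for x
  have f: "dsol a f f' (\<lambda>x. g x + (- c) * 0)"
    unfolding f_def[abs_def] f'_def[abs_def] by (rule dsol_add[OF y(1) dsol_cmult[OF \<theta>(1)]])
  have fl: "(f' \<longlongrightarrow> 0) (at_left b)"
  proof -
    have "(f' \<longlongrightarrow> ly + (- c) * l\<theta>) (at_left b)"
      unfolding f'_def[abs_def] by (intro tendsto_intros ly l\<theta>)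
    then show ?thesis by (simp add: c)
  qed
  have "dsol a (trunc (Suc m) f) (trunc (Suc m) f') (trunc (Suc m) (\<lambda>x. g x + (- c) * 0))"
    by (rule dsol_trunc[OF f]) (use fl c in \<open>auto simp: b_def f_def\<close>)
  moreover have "trunc (Suc m) (\<lambda>x. g x + (- c) * 0) = g" using g(2) by (auto simp: trunc_def)
  moreover have "(trunc (Suc m) f' \<longlongrightarrow> 0) (at_left (pt (Suc m)))"
  proof (rule Lim_transform_eventually[OF fl[unfolded b_def]])
    show "\<forall>\<^sub>F x in at_left (pt (Suc m)). f' x = trunc (Suc m) f' x"
      using eventually_at_left_real[of 0 "pt (Suc m)"] b by (auto simp: trunc_def b_def elim!: eventually_mono)
  qed
  moreover have "trunc (Suc m) f' 0 = 0" using y \<theta> by (simp add: trunc_def f'_def)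
  ultimately show thesis using that[of "trunc (Suc m) f" "trunc (Suc m) f'"] by (simp add: trunc_def)
qed

text \<open>Both sides equal minus the pairing of the compactly supported solution \<open>u\<close>
  of u'' = g with \<open>k\<close>: the left one by the definition of the adjoint, the right one by
  the Wronskian of \<open>u\<close> and the conjugate of the particular solution
  \<open>w\<close>.\<close>

lemma adjoint_T_test:
  assumes hk: "(h, k) \<in> operator_adjoint (T a)" and w: "dsol a w w' (\<lambda>x. - k x)" "w' 0 = 0"
    and \<theta>: "dsol a \<theta> \<theta>' (\<lambda>x. 0)" "\<theta> 0 = 1" "\<theta>' 0 = 0"
    and g: "g \<in> L2" "\<And>x. x \<ge> pt (Suc m) \<Longrightarrow> g x = 0"
    and orth: "L2_inner g (trunc (Suc m) (\<lambda>x. cnj (\<theta> x))) = 0"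
  shows "L2_inner g h = L2_inner g (trunc (Suc m) w)"
proof -
  obtain u v where u: "dsol a u v g" "v 0 = 0" "\<And>x. x \<ge> pt (Suc m) \<Longrightarrow> u x = 0"
     "(v \<longlongrightarrow> 0) (at_left (pt (Suc m)))"
    using dsol_compact_support[OF \<theta> g orth] by metis
  have L: "h \<in> L2" "k \<in> L2" using hk by (auto simp: operator_adjoint_def)
  have uT: "u \<in> L2" "(u, \<lambda>x. - g x) \<in> T a"
    using dsol_in_T[OF u(1,2) _ g(1), of "pt (Suc m)"] u(3) by auto
  define b where "b = pt (Suc m)"
  note w2 = dsol_cnj[OF w(1)]
  obtain l where l: "((\<lambda>x. cnj (w' x)) \<longlongrightarrow> l) (at_left (pt (Suc m)))" using dsol_left_limit[OF w2] by blast
  have z: "integral {0..b} (\<lambda>x. g x * cnj (w x) - u x * cnj (- k x)) = 0"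
    using dsol_wronskian[OF u(1) w2 u(4) l] u w by (simp add: b_def integral_unique)
  have ints: "(\<lambda>x. g x * cnj (w x)) integrable_on {0..b}" "(\<lambda>x. u x * cnj (- k x)) integrable_on {0..b}"
    using absolutely_integrable_continuous_mult[OF dsolD(5)[OF u(1)] dsolD(1)[OF w2], of b]
      absolutely_integrable_continuous_mult[OF dsolD(5)[OF w2] dsolD(1)[OF u(1)], of b]
    unfolding absolutely_integrable_on_def by (simp_all add: mult.commute)
  have eq: "integral {0..b} (\<lambda>x. g x * cnj (w x)) = integral {0..b} (\<lambda>x. u x * cnj (- k x))"
    using integral_diff[OF ints, symmetric] unfolding z by (simp only: right_minus_eq)
  have "L2_inner (\<lambda>x. - g x) h = L2_inner u k"
    using hk uT(2) by (fastforce simp: operator_adjoint_def)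
  then have "L2_inner g h = - L2_inner u k" using L2_inner_cmult_left[of "-1" g h] by simp
  also have "\<dots> = L2_inner u (\<lambda>x. - k x)" using L2_inner_cmult_right[of u "-1" k] by simp
  also have "\<dots> = integral {0..b} (\<lambda>x. u x * cnj (- k x))"
    by (rule L2_inner_eq_integral) (use uT L u(3) in \<open>auto simp: b_def\<close>)
  also have "\<dots> = integral {0..b} (\<lambda>x. g x * cnj (trunc (Suc m) w x))"
  proof -
    have "(\<lambda>x. g x * cnj (trunc (Suc m) w x)) = (\<lambda>x. g x * cnj (w x))"
      using g(2) by (auto simp: trunc_def)
    then show ?thesis by (simp add: eq)
  qed
  also have "\<dots> = L2_inner g (trunc (Suc m) w)"
    by (rule L2_inner_eq_integral[symmetric])
       (use g dsolD(1)[OF w(1)] in \<open>auto simp: b_def intro!: trunc_continuous_L2\<close>)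
  finally show ?thesis .
qed

text \<open>On each interval up to \<open>pt (Suc m)\<close> the component of \<open>h - w\<close>
  orthogonal to the conjugated homogeneous solution is itself an admissible right-hand side, and
  testing with it shows that its norm is 0. Hence \<open>h\<close> is \<open>w\<close> plus a
  multiple of a homogeneous solution, with a factor that does not depend on m.\<close>

lemma adjoint_T_regular:
  assumes hk: "(h, k) \<in> operator_adjoint (T a)"
  obtains u v where "dsol a u v (\<lambda>x. - k x)" "v 0 = 0" "L2_eq h u"
proof -
  have L: "h \<in> L2" "k \<in> L2" using hk by (auto simp: operator_adjoint_def)
  have "(\<lambda>x. - k x) absolutely_integrable_on {0..b}" for b
    by (rule L2_absolutely_integrable) (use L in simp)
  then obtain w w' where w: "dsol a w w' (\<lambda>x. - k x)" "w' 0 = 0" using dsol_exists by metis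
  obtain \<theta> \<theta>' where \<theta>: "dsol a \<theta> \<theta>' (\<lambda>x. 0)" "\<theta> 0 = 1" "\<theta>' 0 = 0"
    using dsol_exists[where g = "\<lambda>x. 0" and a = a and c = 1 and d = 0] by auto
  define ct where "ct x = cnj (\<theta> x)" for x
  have ct: "dsol a ct (\<lambda>x. cnj (\<theta>' x)) (\<lambda>x. 0)" using dsol_cnj[OF \<theta>(1)] by (simp add: ct_def[abs_def])
  \<comment> \<open>That \<open>ct\<close> does not vanish near 0 serves twice: its truncations have
    nonzero norm, and the constants of different m can be compared. The bound
    \<open>d \<le> 1\<close> keeps both arguments inside the first cell.\<close>
  obtain d where d: "d > 0" "d \<le> 1" "\<And>x. 0 \<le> x \<Longrightarrow> x < d \<Longrightarrow> ct x \<noteq> 0"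
  proof -
    have "(ct \<longlongrightarrow> ct 0) (at 0 within half_line)" using dsolD(1)[OF ct] by (auto simp: continuous_on_def)
    then have "\<forall>\<^sub>F x in at 0 within half_line. ct x \<noteq> 0"
      by (rule tendsto_imp_eventually_ne) (simp add: ct_def \<theta>)
    then obtain e where "e > 0" "\<forall>x\<in>half_line. x \<noteq> 0 \<and> dist x 0 < e \<longrightarrow> ct x \<noteq> 0"
      by (auto simp: eventually_at)
    moreover have "ct 0 \<noteq> 0" by (simp add: ct_def \<theta>)
    ultimately have "ct x \<noteq> 0" if "0 \<le> x" "x < e" for x
      using that by (cases "x = 0") (auto simp: dist_real_def)
    then show thesis using \<open>e > 0\<close> by (intro that[of "min e 1"]) auto
  qed
  have loc: "\<exists>C. AE x in half_line_measure. x < pt (Suc m) \<longrightarrow> h x = w x + C * ct x" for m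
  proof -
    define M where "M = Suc m"
    define tb where "tb = trunc M ct"
    define r where "r x = trunc M h x - trunc M w x" for x
    have LL: "tb \<in> L2" "r \<in> L2" "trunc M h \<in> L2" "trunc M w \<in> L2"
      using trunc_L2[OF L(1)] trunc_continuous_L2[OF dsolD(1)[OF ct]] trunc_continuous_L2[OF dsolD(1)[OF w(1)]]
      by (auto simp: tb_def r_def[abs_def] intro!: L2_diff)
    have tb0: "L2_norm tb \<noteq> 0"
    proof
      assume "L2_norm tb = 0"
      then have "AE x in half_line_measure. tb x = 0" using L2_norm_zero_iff[OF LL(1)] by (simp add: L2_eq_def)
      from AE_half_line_exists[OF this d(1)] obtain x where x: "0 \<le> x" "x < d" "tb x = 0" by blast
      have "1 \<le> pt M" by (simp add: M_def of_nat_Suc)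
      then have "x < pt M" using x d by linarith
      then show False using d x by (auto simp: tb_def trunc_def)
    qed
    \<comment> \<open>The coefficient of the orthogonal projection of \<open>r\<close> onto
      \<open>tb\<close>.\<close>
    define C where "C = L2_inner r tb / of_real ((L2_norm tb)\<^sup>2)"
    define g where "g x = r x - C * tb x" for x
    have gL: "g \<in> L2" using LL by (simp add: g_def[abs_def])
    have g0: "g x = 0" if "x \<ge> pt M" for x using that by (simp add: g_def r_def tb_def trunc_def)
    have orth: "L2_inner g tb = 0"
    proof -
      have "L2_inner g tb = L2_inner r tb - C * L2_inner tb tb"
        unfolding g_def[abs_def] using LL by (simp add: L2_inner_diff_left L2_inner_cmult_left)
      then show ?thesis using tb0 by (simp add: L2_inner_self C_def)
    qed
    have "L2_inner g h = L2_inner g (trunc M w)"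
      unfolding M_def by (rule adjoint_T_test[OF hk w \<theta> gL]) (use g0 orth in \<open>auto simp: M_def tb_def ct_def[abs_def]\<close>)
    then have "L2_inner g r = 0"
      unfolding r_def[abs_def] using LL gL L2_inner_trunc[of M g h] g0 by (simp add: L2_inner_diff_right)
    then have "L2_inner g g = 0"
      using LL gL orth by (subst (2) g_def[abs_def]) (simp add: L2_inner_diff_right L2_inner_cmult_right)
    then have "L2_norm g = 0" by (simp add: L2_inner_self)
    then have "AE x in half_line_measure. g x = 0" using L2_norm_zero_iff[OF gL] by (simp add: L2_eq_def)
    then have "AE x in half_line_measure. x < pt (Suc m) \<longrightarrow> h x = w x + C * ct x"
      by eventually_elim (auto simp: g_def r_def tb_def trunc_def M_def algebra_simps)
    then show ?thesis by blast
  qed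
  then obtain C where C: "\<And>m. AE x in half_line_measure. x < pt (Suc m) \<longrightarrow> h x = w x + C m * ct x"
    by metis
  have CC: "C m = C 0" for m
  proof -
    have "AE x in half_line_measure. (x < pt (Suc m) \<longrightarrow> h x = w x + C m * ct x) \<and> (x < pt (Suc 0) \<longrightarrow> h x = w x + C 0 * ct x)"
      using C[of m] C[of 0] by eventually_elim simp
    from AE_half_line_exists[OF this d(1)] obtain x where x: "0 \<le> x" "x < d"
      "x < pt (Suc m) \<longrightarrow> h x = w x + C m * ct x" "x < pt (Suc 0) \<longrightarrow> h x = w x + C 0 * ct x" by blast
    have "1 \<le> pt (Suc m)" "1 \<le> pt (Suc 0)" by (simp_all add: of_nat_Suc)
    then have "x < pt (Suc m)" "x < pt (Suc 0)" using x d by linarith+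
    then have "w x + C m * ct x = w x + C 0 * ct x" using x by metis
    then show ?thesis using x d by auto
  qed
  have "AE x in half_line_measure. \<forall>m. x < pt (Suc m) \<longrightarrow> h x = w x + C 0 * ct x"
    unfolding AE_all_countable
  proof
    show "AE x in half_line_measure. x < pt (Suc m) \<longrightarrow> h x = w x + C 0 * ct x" for m
      using C[of m] unfolding CC[of m] .
  qed
  then have "L2_eq h (\<lambda>x. w x + C 0 * ct x)"
    unfolding L2_eq_def using AE_space
  proof eventually_elim
    case (elim x)
    then show ?case using pt_cell(2)[of x] by auto
  qed
  moreover have "dsol a (\<lambda>x. w x + C 0 * ct x) (\<lambda>x. w' x + C 0 * cnj (\<theta>' x)) (\<lambda>x. - k x + C 0 * 0)"
    by (rule dsol_add[OF w(1) dsol_cmult[OF ct]])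
  ultimately show thesis using that w(2) \<theta>(3) by simp
qed

section \<open>Cutoff functions\<close>

text \<open>The cube of the positive part has two continuous derivatives, the regularity that
  multipliers of solutions require.\<close>

definition pcube :: "real \<Rightarrow> real" where "pcube s = (max 0 s) ^ 3"

lemma pcube_deriv:
  "(pcube has_real_derivative 3 * (max 0 s)\<^sup>2) (at s)"
  "((\<lambda>s. 3 * (max 0 s)\<^sup>2) has_real_derivative 6 * max 0 s) (at s)"
proof -
  have *: "((\<lambda>s. (max 0 s) ^ Suc (Suc k)) has_real_derivative real (Suc (Suc k)) * (max 0 s) ^ Suc k) (at s)" for k :: nat
  proof -
    consider "s < 0" | "s > 0" | "s = 0" by linarith
    then show ?thesis
    proof cases
      case 1
      have "((\<lambda>s. 0) has_real_derivative 0) (at s)" by simp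
      then show ?thesis
        by (rule has_field_derivative_transform_within_open[of _ _ _ "{..<0}", THEN DERIV_cong])
           (use 1 in \<open>auto simp: max_def\<close>)
    next
      case 2
      have "((\<lambda>s. s ^ Suc (Suc k)) has_real_derivative real (Suc (Suc k)) * s ^ Suc k) (at s)"
        using DERIV_pow[of "Suc (Suc k)" s] by simp
      then show ?thesis
        by (rule has_field_derivative_transform_within_open[of _ _ _ "{0<..}", THEN DERIV_cong])
           (use 2 in \<open>auto simp: max_def\<close>)
    next
      case 3
      have "(\<lambda>h::real. (max 0 h) ^ Suc (Suc k) / h) \<midarrow>0\<rightarrow> 0"
      proof (rule Lim_null_comparison)
        show "\<forall>\<^sub>F h in at 0. norm ((max 0 h) ^ Suc (Suc k) / h) \<le> \<bar>h\<bar> ^ Suc k"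
        proof (intro always_eventually allI)
          fix h :: real
          have "(max 0 h) ^ Suc (Suc k) / h = (if h > 0 then h ^ Suc k else 0)" by (simp add: max_def)
          then show "norm ((max 0 h) ^ Suc (Suc k) / h) \<le> \<bar>h\<bar> ^ Suc k"
            using zero_le_power[OF abs_ge_zero, of h "Suc k"] by (auto simp del: power_Suc)
        qed
        have "((\<lambda>h::real. \<bar>h\<bar> ^ Suc k) \<longlongrightarrow> \<bar>0\<bar> ^ Suc k) (at 0)" by (intro tendsto_intros)
        then show "((\<lambda>h::real. \<bar>h\<bar> ^ Suc k) \<longlongrightarrow> 0) (at 0)" by simp
      qed
      then show ?thesis using 3 by (simp add: DERIV_def)
    qed
  qed
  show "(pcube has_real_derivative 3 * (max 0 s)\<^sup>2) (at s)"
    using *[of 1] by (simp add: pcube_def[abs_def] numeral_3_eq_3 numeral_2_eq_2 of_nat_Suc)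
  show "((\<lambda>s. 3 * (max 0 s)\<^sup>2) has_real_derivative 6 * max 0 s) (at s)"
    using DERIV_cmult[OF *[of 0], of 3] by (simp add: numeral_2_eq_2 of_nat_Suc)
qed

text \<open>Equals (1 - s^3)^3 between 0 and 1, is 1 to the left and 0 to the right; both joints are
  of class C^2 because \<open>pcube\<close> is.\<close>

definition step :: "real \<Rightarrow> real" where "step s = pcube (1 - pcube s)"

definition step1 :: "real \<Rightarrow> real" where
  "step1 s = - (3 * (max 0 (1 - pcube s))\<^sup>2) * (3 * (max 0 s)\<^sup>2)"

definition step2 :: "real \<Rightarrow> real" where
  "step2 s = 6 * max 0 (1 - pcube s) * (3 * (max 0 s)\<^sup>2)\<^sup>2 - 3 * (max 0 (1 - pcube s))\<^sup>2 * (6 * max 0 s)"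

lemma step_deriv:
  "(step has_real_derivative step1 s) (at s)"
  "(step1 has_real_derivative step2 s) (at s)"
proof -
  have i: "((\<lambda>s. 1 - pcube s) has_real_derivative - (3 * (max 0 s)\<^sup>2)) (at s)"
    by (auto intro!: derivative_eq_intros pcube_deriv)
  show "(step has_real_derivative step1 s) (at s)"
    using DERIV_chain2[OF pcube_deriv(1) i] by (simp add: step_def[abs_def] step1_def)
  have "((\<lambda>s. - ((3 * (max 0 (1 - pcube s))\<^sup>2) * (3 * (max 0 s)\<^sup>2))) has_real_derivative
     - (6 * max 0 (1 - pcube s) * - (3 * (max 0 s)\<^sup>2) * (3 * (max 0 s)\<^sup>2) + 6 * max 0 s * (3 * (max 0 (1 - pcube s))\<^sup>2))) (at s)"
    by (rule DERIV_minus, rule DERIV_mult'[THEN DERIV_cong], rule DERIV_chain2[OF pcube_deriv(2) i], rule pcube_deriv(2)) simp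
  then show "(step1 has_real_derivative step2 s) (at s)"
    by (simp add: step1_def[abs_def] step2_def algebra_simps power2_eq_square)
qed

text \<open>For s >= 1 the factor \<open>y\<close> of both derivatives vanishes, and otherwise all
  powers of \<open>y\<close> and \<open>t\<close> are at most 1. This gives 9 = 3 * 3 and 72 = 54 +
  18.\<close>

lemma step_values:
  "s \<le> 0 \<Longrightarrow> step s = 1" "s \<ge> 1 \<Longrightarrow> step s = 0" "0 \<le> step s" "step s \<le> 1"
  "s \<ge> 1 \<Longrightarrow> step1 s = 0"
  "\<bar>step1 s\<bar> \<le> 9" "\<bar>step2 s\<bar> \<le> 72"
proof -
  have p0: "pcube s \<ge> 0" for s by (simp add: pcube_def)
  have p1: "pcube s \<le> 1" if "s \<le> 1" for s
    using that by (auto simp: pcube_def intro!: power_le_one)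
  have p2: "pcube s \<ge> 1" if "s \<ge> 1" for s
    using that by (simp add: pcube_def max_def)
  have z: "max 0 (1 - pcube s) = 0" if "s \<ge> 1" using p2[OF that] by simp
  show "s \<le> 0 \<Longrightarrow> step s = 1" by (simp add: step_def pcube_def)
  show "s \<ge> 1 \<Longrightarrow> step s = 0" using z unfolding step_def pcube_def[of "1 - pcube s"] by simp
  show "0 \<le> step s" by (simp add: step_def p0)
  show "step s \<le> 1" unfolding step_def using p0[of s] by (intro p1) simp
  show "s \<ge> 1 \<Longrightarrow> step1 s = 0" using z by (simp add: step1_def)
  define y where "y = max 0 (1 - pcube s)"
  define t where "t = max 0 s"
  have y: "0 \<le> y" "y \<le> 1" using p0[of s] by (auto simp: y_def)
  have t0: "0 \<le> t" by (simp add: t_def)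
  have yt: "y = 0 \<or> t \<le> 1" using z by (auto simp: y_def t_def)
  have "\<bar>step1 s\<bar> = 9 * (y\<^sup>2 * t\<^sup>2)" by (simp add: step1_def y_def t_def abs_mult)
  also have "y\<^sup>2 * t\<^sup>2 \<le> 1"
    using yt
  proof
    assume "t \<le> 1"
    then show ?thesis using y t0 by (intro mult_le_one power_le_one) auto
  qed simp
  finally show "\<bar>step1 s\<bar> \<le> 9" by simp
  have "\<bar>step2 s\<bar> = \<bar>54 * (y * t ^ 4) - 18 * (y\<^sup>2 * t)\<bar>"
    by (simp add: step2_def y_def t_def power2_eq_square eval_nat_numeral algebra_simps)
  moreover have "0 \<le> y * t ^ 4" "0 \<le> y\<^sup>2 * t" using y t0 by auto
  moreover have "y * t ^ 4 \<le> 1 \<and> y\<^sup>2 * t \<le> 1"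
    using yt
  proof
    assume "t \<le> 1"
    then show ?thesis using y t0 by (intro conjI mult_le_one power_le_one) auto
  qed simp
  ultimately show "\<bar>step2 s\<bar> \<le> 72" by linarith
qed

lemma continuous_step2: "continuous_on UNIV step2"
proof -
  have "continuous_on UNIV pcube"
    by (rule DERIV_continuous_on[OF has_field_derivative_at_within[OF pcube_deriv(1)]])
  then show ?thesis unfolding step2_def[abs_def] by (intro continuous_intros)
qed

section \<open>A slowly growing function critical at the integers\<close>

text \<open>The intended derivative is (1 - cos (2 pi y)) / (1 + y), which vanishes at the integers
  but has a divergent integral. Integrating its cosine part by parts and keeping only the boundary
  term gives this closed form; the resulting error in the derivative is the sine term of
  \<open>slow1\<close>, which vanishes at the integers too.\<close>

definition slow :: "real \<Rightarrow> real" where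
  "slow y = ln (1 + y) - sin (2 * pi * y) / (2 * pi * (1 + y))"

definition slow1 :: "real \<Rightarrow> real" where
  "slow1 y = (1 - cos (2 * pi * y)) / (1 + y) + sin (2 * pi * y) / (2 * pi * (1 + y)\<^sup>2)"

definition slow2 :: "real \<Rightarrow> real" where
  "slow2 y = 2 * pi * sin (2 * pi * y) / (1 + y) - (1 - cos (2 * pi * y)) / (1 + y)\<^sup>2
     + cos (2 * pi * y) / (1 + y)\<^sup>2 - sin (2 * pi * y) / (pi * (1 + y) ^ 3)"

lemma slow_deriv:
  assumes "y \<ge> 0"
  shows "(slow has_real_derivative slow1 y) (at y)" "(slow1 has_real_derivative slow2 y) (at y)"
proof -
  have nz: "1 + y \<noteq> 0" "1 + y > 0" using assms by auto
  define S where "S = sin (2 * pi * y)"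
  define C where "C = cos (2 * pi * y)"
  have s': "((\<lambda>y. sin (2 * pi * y)) has_real_derivative C * (2 * pi)) (at y)"
    "((\<lambda>y. cos (2 * pi * y)) has_real_derivative - S * (2 * pi)) (at y)"
    unfolding S_def C_def by (auto intro!: derivative_eq_intros)
  have alg1: "1 / z - (c * (2 * p) * (2 * p * z) - s * (2 * p)) / (2 * p * z * (2 * p * z))
      = (1 - c) / z + s / (2 * p * z\<^sup>2)" if "z \<noteq> 0" "p \<noteq> 0" for c s p z :: real
    using that by (simp add: field_simps power2_eq_square)
  have alg2: "(s * (2 * p) * z - (1 - c)) / (z * z) + (c * (2 * p) * (2 * p * z\<^sup>2) - s * (2 * p * (2 * z))) / (2 * p * z\<^sup>2 * (2 * p * z\<^sup>2))
      = 2 * p * s / z - (1 - c) / z\<^sup>2 + c / z\<^sup>2 - s / (p * z ^ 3)" if "z \<noteq> 0" "p \<noteq> 0" for c s p z :: real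
    using that by (simp add: field_simps power2_eq_square power3_eq_cube)
  have "(slow has_real_derivative 1 / (1 + y) - (C * (2 * pi) * (2 * pi * (1 + y)) - S * (2 * pi)) / (2 * pi * (1 + y) * (2 * pi * (1 + y)))) (at y)"
    unfolding slow_def[abs_def] S_def
    by (rule DERIV_diff DERIV_divide s' | (auto intro!: derivative_eq_intros simp: nz)[1])+
  then show "(slow has_real_derivative slow1 y) (at y)"
    by (rule DERIV_cong) (simp only: alg1[OF nz(1) pi_neq_zero] slow1_def S_def C_def)
  have "(slow1 has_real_derivative (S * (2 * pi) * (1 + y) - (1 - C)) / ((1 + y) * (1 + y))
     + (C * (2 * pi) * (2 * pi * (1 + y)\<^sup>2) - S * (2 * pi * (2 * (1 + y)))) / (2 * pi * (1 + y)\<^sup>2 * (2 * pi * (1 + y)\<^sup>2))) (at y)"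
    unfolding slow1_def[abs_def]
  proof (rule DERIV_add)
    have "((\<lambda>y. (1 - cos (2 * pi * y)) / (1 + y)) has_real_derivative (S * (2 * pi) * (1 + y) - (1 - cos (2 * pi * y)) * 1) / ((1 + y) * (1 + y))) (at y)"
      by (rule DERIV_divide) (auto intro!: derivative_eq_intros simp: S_def nz)
    then show "((\<lambda>y. (1 - cos (2 * pi * y)) / (1 + y)) has_real_derivative (S * (2 * pi) * (1 + y) - (1 - C)) / ((1 + y) * (1 + y))) (at y)"
      by (simp add: C_def)
    have "((\<lambda>y. sin (2 * pi * y) / (2 * pi * (1 + y)\<^sup>2)) has_real_derivative
      (C * (2 * pi) * (2 * pi * (1 + y)\<^sup>2) - sin (2 * pi * y) * (2 * pi * (2 * (1 + y)))) / (2 * pi * (1 + y)\<^sup>2 * (2 * pi * (1 + y)\<^sup>2))) (at y)"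
      by (rule DERIV_divide, rule s') (auto intro!: derivative_eq_intros simp: nz)
    then show "((\<lambda>y. sin (2 * pi * y) / (2 * pi * (1 + y)\<^sup>2)) has_real_derivative
      (C * (2 * pi) * (2 * pi * (1 + y)\<^sup>2) - S * (2 * pi * (2 * (1 + y)))) / (2 * pi * (1 + y)\<^sup>2 * (2 * pi * (1 + y)\<^sup>2))) (at y)"
      by (simp add: S_def)
  qed
  then show "(slow1 has_real_derivative slow2 y) (at y)"
    by (rule DERIV_cong) (simp only: alg2[OF nz(1) pi_neq_zero] slow2_def S_def C_def)
qed

text \<open>All terms other than the logarithm are bounded factors times powers of 1 / (1 + y), and
  higher powers are at most the first. The decay of the second derivative is decisive: with y = x^2
  the chain rule multiplies it by 4 x^2.\<close>

lemma slow_bounds: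
  assumes "y \<ge> 0"
  shows "\<bar>slow1 y\<bar> \<le> 3 / (1 + y)" "\<bar>slow2 y\<bar> \<le> 14 / (1 + y)" "slow y \<ge> ln (1 + y) - 1"
proof -
  define d where "d = 1 / (1 + y)"
  have d: "0 < d" "d \<le> 1" using assms by (auto simp: d_def field_simps)
  have d2: "d\<^sup>2 \<le> d" "d ^ 3 \<le> d" "0 \<le> d\<^sup>2" "0 \<le> d ^ 3"
    using d by (auto intro: power_le_one mult_le_one simp: power2_eq_square power3_eq_cube mult_le_cancel_left1 mult_left_le)
  define s where "s = sin (2 * pi * y)"
  define c where "c = cos (2 * pi * y)"
  have s: "\<bar>s\<bar> \<le> 1" and c: "\<bar>c\<bar> \<le> 1" by (auto simp: s_def c_def)
  have pi3: "pi \<ge> 3" using pi_gt3 by simp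
  have pi4: "pi \<le> 4" using pi_less_4 by simp
  have ip: "\<bar>1 / (2 * pi)\<bar> \<le> 1" "\<bar>1 / pi\<bar> \<le> 1" using pi3 by (auto simp: field_simps)
  have b: "\<bar>p * q\<bar> \<le> P * Q" if "\<bar>p\<bar> \<le> P" "\<bar>q\<bar> \<le> Q" for p q P Q :: real
    using that by (simp add: abs_mult mult_mono)
  have "slow1 y = (1 - c) * d + (s * (1 / (2 * pi))) * d\<^sup>2"
    using assms by (simp add: slow1_def s_def c_def d_def field_simps power2_eq_square)
  moreover have "\<bar>(1 - c) * d\<bar> \<le> 2 * d" using c d by (intro b) auto
  moreover have "\<bar>(s * (1 / (2 * pi))) * d\<^sup>2\<bar> \<le> (1 * 1) * d" using d2 by (intro b s ip) auto
  ultimately have "\<bar>slow1 y\<bar> \<le> 3 * d" by linarith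
  then show "\<bar>slow1 y\<bar> \<le> 3 / (1 + y)" by (simp add: d_def)
  have "slow2 y = (2 * pi * s) * d - (1 - c) * d\<^sup>2 + c * d\<^sup>2 - (s * (1 / pi)) * d ^ 3"
    using assms by (simp add: slow2_def s_def c_def d_def field_simps power2_eq_square power3_eq_cube)
  moreover have "\<bar>(2 * pi * s) * d\<bar> \<le> (8 * 1) * d" using pi4 d by (intro b s) auto
  moreover have "\<bar>(1 - c) * d\<^sup>2\<bar> \<le> 2 * d" using c d2 by (intro b) auto
  moreover have "\<bar>c * d\<^sup>2\<bar> \<le> 1 * d" using d2 by (intro b c) auto
  moreover have "\<bar>(s * (1 / pi)) * d ^ 3\<bar> \<le> (1 * 1) * d" using d2 by (intro b s ip) auto
  ultimately have "\<bar>slow2 y\<bar> \<le> 14 * d" using d by linarith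
  then show "\<bar>slow2 y\<bar> \<le> 14 / (1 + y)" by (simp add: d_def)
  have "slow y = ln (1 + y) - (s * (1 / (2 * pi))) * d"
    using assms by (simp add: slow_def s_def d_def field_simps)
  moreover have "\<bar>(s * (1 / (2 * pi))) * d\<bar> \<le> (1 * 1) * 1" using d by (intro b s ip) auto
  ultimately show "slow y \<ge> ln (1 + y) - 1" by linarith
qed

text \<open>
  The cutoff functions \<open>step (\<delta> slow (x\<^sup>2) - 1)\<close> are critical at the grid points because
  \<open>slow\<close> has vanishing derivative at the integers; unboundedness of \<open>slow\<close> reflects the divergence of
  the sum of the squared spacings of the grid.
\<close>

lemma cutoff_functions:
  obtains X X' X'' :: "nat \<Rightarrow> real \<Rightarrow> real" and b :: "nat \<Rightarrow> real" and B :: real where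
    "\<And>N x. (X N has_real_derivative X' N x) (at x)"
    "\<And>N x. (X' N has_real_derivative X'' N x) (at x)"
    "\<And>N. continuous_on UNIV (X'' N)"
    "\<And>N x. 0 \<le> X N x" "\<And>N x. X N x \<le> 1"
    "\<And>N n. X' N (pt n) = 0"
    "\<And>N x. \<bar>X' N x\<bar> \<le> B / real (Suc N)" "\<And>N x. \<bar>X'' N x\<bar> \<le> B / real (Suc N)"
    "\<And>N x. x > b N \<Longrightarrow> X N x = 0 \<and> X' N x = 0 \<and> X'' N x = 0"
    "\<And>x. (\<lambda>N. X N x) \<longlonglongrightarrow> 1"
proof -
  define \<tau> where "\<tau> x = slow (x\<^sup>2)" for x
  define \<tau>1 where "\<tau>1 x = 2 * x * slow1 (x\<^sup>2)" for x
  define \<tau>2 where "\<tau>2 x = 2 * slow1 (x\<^sup>2) + 4 * x\<^sup>2 * slow2 (x\<^sup>2)" for x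
  have sq: "((\<lambda>x. x\<^sup>2) has_real_derivative 2 * x) (at x)" for x :: real
    by (auto intro!: derivative_eq_intros)
  have \<tau>d: "(\<tau> has_real_derivative \<tau>1 x) (at x)" for x
    using DERIV_chain2[OF slow_deriv(1) sq, of x] by (simp add: \<tau>_def[abs_def] \<tau>1_def mult.commute)
  have \<tau>d2: "(\<tau>1 has_real_derivative \<tau>2 x) (at x)" for x
  proof -
    have "((\<lambda>x. 2 * x * slow1 (x\<^sup>2)) has_real_derivative 2 * x * (slow2 (x\<^sup>2) * (2 * x)) + 2 * slow1 (x\<^sup>2)) (at x)"
      by (rule DERIV_mult', auto intro!: derivative_eq_intros DERIV_chain2[OF slow_deriv(2) sq])
    then show ?thesis by (simp add: \<tau>1_def[abs_def] \<tau>2_def power2_eq_square algebra_simps)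
  qed
  have \<tau>c: "continuous_on UNIV \<tau>2"
    unfolding \<tau>2_def[abs_def] slow1_def slow2_def
    by (intro continuous_intros) (auto simp: add_nonneg_eq_0_iff)
  \<comment> \<open>The factor x is absorbed by the decay of \<open>slow1\<close>, since
    \<open>\<bar>x\<bar> \<le> 1 + x\<^sup>2\<close>; this leaves 2 * 3.\<close>
  have \<tau>1b: "\<bar>\<tau>1 x\<bar> \<le> 6" for x
  proof -
    have "2 * \<bar>x\<bar> \<le> 1 + x\<^sup>2" using sum_squares_bound[of 1 "\<bar>x\<bar>"] by simp
    then have *: "\<bar>x\<bar> \<le> 1 + x\<^sup>2" by linarith
    have p: "1 + x\<^sup>2 > 0" by (simp add: add_pos_nonneg)
    have "\<bar>\<tau>1 x\<bar> = 2 * \<bar>x\<bar> * \<bar>slow1 (x\<^sup>2)\<bar>" by (simp add: \<tau>1_def abs_mult)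
    also have "\<dots> \<le> 2 * (1 + x\<^sup>2) * (3 / (1 + x\<^sup>2))"
      using slow_bounds(1)[of "x\<^sup>2"] * by (intro mult_mono) auto
    also have "\<dots> = 6" using p by (simp add: field_simps)
    finally show ?thesis .
  qed
  \<comment> \<open>The two summands of \<open>\<tau>2\<close> are bounded by 2 * 3 and 4 *
    14.\<close>
  have \<tau>2b: "\<bar>\<tau>2 x\<bar> \<le> 62" for x
  proof -
    have p: "1 + x\<^sup>2 > 0" "1 + x\<^sup>2 \<ge> 1" by (simp_all add: add_pos_nonneg)
    have "\<bar>slow1 (x\<^sup>2)\<bar> \<le> 3"
    proof (rule order_trans[OF slow_bounds(1)])
      show "3 / (1 + x\<^sup>2) \<le> 3" using divide_left_mono[of 1 "1 + x\<^sup>2" 3] p by simp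
    qed simp
    moreover have "x\<^sup>2 * \<bar>slow2 (x\<^sup>2)\<bar> \<le> 14"
    proof -
      have "x\<^sup>2 * \<bar>slow2 (x\<^sup>2)\<bar> \<le> (1 + x\<^sup>2) * (14 / (1 + x\<^sup>2))"
        using slow_bounds(2)[of "x\<^sup>2"] by (intro mult_mono) auto
      also have "\<dots> = 14"
        using p(1) by (metis less_irrefl nonzero_mult_div_cancel_left times_divide_eq_right)
      finally show ?thesis .
    qed
    moreover have "\<bar>\<tau>2 x\<bar> \<le> 2 * \<bar>slow1 (x\<^sup>2)\<bar> + 4 * (x\<^sup>2 * \<bar>slow2 (x\<^sup>2)\<bar>)"
      unfolding \<tau>2_def by (rule order_trans[OF abs_triangle_ineq]) (simp add: abs_mult)
    ultimately show ?thesis by linarith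
  qed
  have \<tau>pt: "\<tau>1 (pt n) = 0" for n
  proof -
    have "cos (2 * pi * real n) = 1" "sin (2 * pi * real n) = 0"
      using cos_2pi_minus[of 0] sin_npi[of "2 * n"] cos_npi[of "2 * n"] by (auto simp: mult_ac)
    then show ?thesis by (simp add: \<tau>1_def slow1_def)
  qed
  \<comment> \<open>\<open>X N\<close> is 1 while \<open>\<delta> N * \<tau> x \<le> 1\<close> and 0
    once this product is at least 2. The scale \<open>\<delta> N\<close> makes both derivatives of
    order 1 / (N + 1), and every fixed x eventually falls into the first range.\<close>
  define \<delta> where "\<delta> N = 1 / real (Suc N)" for N
  have \<delta>: "0 < \<delta> N" "\<delta> N \<le> 1" for N by (auto simp: \<delta>_def of_nat_Suc)
  define X where "X N x = step (\<delta> N * \<tau> x - 1)" for N x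
  define X' where "X' N x = step1 (\<delta> N * \<tau> x - 1) * (\<delta> N * \<tau>1 x)" for N x
  define X'' where "X'' N x = step2 (\<delta> N * \<tau> x - 1) * (\<delta> N * \<tau>1 x)\<^sup>2 + step1 (\<delta> N * \<tau> x - 1) * (\<delta> N * \<tau>2 x)" for N x
  \<comment> \<open>For x > b N the logarithm is at least 2 (N + 1) + 1, and the loss of 1 in the
    lower bound for \<open>slow\<close> still leaves
    \<open>\<tau> x \<ge> 2 * real (Suc N)\<close>.\<close>
  define b where "b N = exp (2 * real (Suc N) + 1)" for N
  have inner: "((\<lambda>x. \<delta> N * \<tau> x - 1) has_real_derivative \<delta> N * \<tau>1 x) (at x)" for N x
    by (auto intro!: derivative_eq_intros \<tau>d)
  have big: "\<delta> N * \<tau> x - 1 \<ge> 1" if "x > b N" for N x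
  proof -
    have b1: "b N \<ge> 1" by (simp add: b_def)
    then have "x * 1 \<le> x * x" using that by (intro mult_left_mono) auto
    then have "b N \<le> 1 + x\<^sup>2" using that by (simp add: power2_eq_square)
    then have "ln (b N) \<le> ln (1 + x\<^sup>2)" using b1 by (intro ln_mono) auto
    then have "2 * real (Suc N) \<le> \<tau> x"
      using slow_bounds(3)[of "x\<^sup>2"] by (simp add: \<tau>_def b_def)
    then have "\<delta> N * (2 * real (Suc N)) \<le> \<delta> N * \<tau> x" using \<delta>[of N] by (intro mult_left_mono) auto
    moreover have "\<delta> N * (2 * real (Suc N)) = 2" by (simp add: \<delta>_def)
    ultimately show ?thesis by linarith
  qed
  have s2: "step2 s = 0" if "s \<ge> 1" for s
  proof -
    have "pcube s \<ge> 1" using that by (simp add: pcube_def max_def)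
    then show ?thesis by (simp add: step2_def)
  qed
  have st: "continuous_on UNIV (\<lambda>x. \<delta> N * \<tau> x - 1)" for N
    by (rule DERIV_continuous_on[OF has_field_derivative_at_within[OF inner]])
  show thesis
  \<comment> \<open>The constant collects the bounds of the two terms of \<open>X''\<close>, with
    the square of \<open>\<delta> N\<close> replaced by \<open>\<delta> N\<close>; it also covers
    \<open>X'\<close>.\<close>
  proof (rule that[of X X' X'' "72 * 6\<^sup>2 + 9 * 62" b])
    fix N x
    show "(X N has_real_derivative X' N x) (at x)"
      unfolding X_def[abs_def] X'_def by (rule DERIV_chain2[OF step_deriv(1) inner])
    show "(X' N has_real_derivative X'' N x) (at x)"
      unfolding X'_def[abs_def] X''_def
      by (rule DERIV_mult'[THEN DERIV_cong], rule DERIV_chain2[OF step_deriv(2) inner], rule DERIV_cmult[OF \<tau>d2])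
         (simp add: power2_eq_square algebra_simps)
    show "0 \<le> X N x" "X N x \<le> 1" by (simp_all add: X_def step_values)
    show "X' N (pt n) = 0" for n by (simp add: X'_def \<tau>pt)
    have 1: "\<bar>X' N x\<bar> \<le> 9 * (\<delta> N * 6)"
      unfolding X'_def abs_mult using \<tau>1b[of x] \<delta>[of N] by (intro mult_mono step_values) auto
    have "9 * (\<delta> N * 6) \<le> (72 * 6\<^sup>2 + 9 * 62) * \<delta> N" using \<delta>(1)[of N] by simp
    then show "\<bar>X' N x\<bar> \<le> (72 * 6\<^sup>2 + 9 * 62) / real (Suc N)" using 1 by (simp add: \<delta>_def)
    have "\<bar>X'' N x\<bar> \<le> \<bar>step2 (\<delta> N * \<tau> x - 1)\<bar> * (\<delta> N * \<bar>\<tau>1 x\<bar>)\<^sup>2 + \<bar>step1 (\<delta> N * \<tau> x - 1)\<bar> * (\<delta> N * \<bar>\<tau>2 x\<bar>)"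
      unfolding X''_def using \<delta>(1)[of N]
      by (intro order_trans[OF abs_triangle_ineq]) (simp add: abs_mult power_mult_distrib)
    also have "\<dots> \<le> 72 * (\<delta> N * 6)\<^sup>2 + 9 * (\<delta> N * 62)"
      using \<tau>1b[of x] \<tau>2b[of x] \<delta>(1)[of N]
      by (intro add_mono mult_mono step_values power_mono) auto
    also have "\<dots> \<le> 72 * (\<delta> N * 6\<^sup>2) + 9 * (\<delta> N * 62)"
      using \<delta>[of N] by (simp add: power_mult_distrib power2_eq_square mult_left_le)
    finally show "\<bar>X'' N x\<bar> \<le> (72 * 6\<^sup>2 + 9 * 62) / real (Suc N)" by (simp add: \<delta>_def)
    show "X N x = 0 \<and> X' N x = 0 \<and> X'' N x = 0" if "x > b N"
      using big[OF that] s2 by (simp add: X_def X'_def X''_def step_values)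
  next
    fix N
    have "continuous_on UNIV step1"
      by (rule DERIV_continuous_on[OF has_field_derivative_at_within[OF step_deriv(2)]])
    moreover have "continuous_on UNIV \<tau>1"
      by (rule DERIV_continuous_on[OF has_field_derivative_at_within[OF \<tau>d2]])
    ultimately show "continuous_on UNIV (X'' N)"
      unfolding X''_def[abs_def]
      by (intro continuous_intros \<tau>c continuous_on_compose2[OF continuous_step2 st] continuous_on_compose2[OF _ st]) auto
  next
    fix x
    have "(\<lambda>N. \<delta> N * \<tau> x - 1) \<longlonglongrightarrow> 0 * \<tau> x - 1"
      unfolding \<delta>_def by (intro tendsto_intros LIMSEQ_Suc[OF lim_1_over_n])
    then have "\<forall>\<^sub>F N in sequentially. \<delta> N * \<tau> x - 1 < 0"
      by (rule order_tendstoD(2)) simp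
    then show "(\<lambda>N. X N x) \<longlonglongrightarrow> 1"
      by (intro tendsto_eventually) (auto elim!: eventually_mono simp: X_def step_values)
  qed
qed

section \<open>Approximation of global solutions in the graph norm\<close>

lemma dform_mult:
  fixes w :: "real \<Rightarrow> complex"
  assumes "dform u v" and w: "\<And>x. (w has_vector_derivative w' x) (at x)" and w': "continuous_on UNIV w'"
  shows "dform (\<lambda>x. w x * u x) (\<lambda>x. w x * v x + w' x * u x)"
  unfolding dform_def
proof (intro conjI ballI allI)
  have wc: "continuous_on S w" for S
    by (auto intro!: continuous_at_imp_continuous_on has_vector_derivative_continuous[OF w])
  note c = wc continuous_on_subset[OF w']
  show "continuous_on half_line (\<lambda>x. w x * u x)"
    by (rule continuous_on_mult[OF wc dformD(1)[OF assms(1)]])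
  show "((\<lambda>x. w x * u x) has_vector_derivative w x * v x + w' x * u x) (at x within half_line)"
    if "x \<in> half_line - grid" for x
    using has_vector_derivative_mult[OF has_vector_derivative_at_within[OF w] dformD(2)[OF assms(1)]] that by auto
  show "(\<lambda>x. w x * v x + w' x * u x) \<in> borel_measurable half_line_measure"
    by (intro borel_measurable_add borel_measurable_times dformD(3)[OF assms(1)]
        continuous_measurable_half_line dformD(1)[OF assms(1)] wc continuous_on_subset[OF w']) auto
  fix b
  have bd: "\<exists>B. \<forall>x\<in>{0..b}. cmod (f x) \<le> B" if "continuous_on half_line f" for f :: "real \<Rightarrow> complex"
  proof -
    have "bounded (f ` {0..b})"
      by (intro compact_imp_bounded compact_continuous_image continuous_on_subset[OF that]) auto
    then show ?thesis unfolding bounded_iff by blast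
  qed
  obtain A where A: "\<forall>x\<in>{0..b}. cmod (w x) \<le> A" using bd[OF wc] by blast
  obtain C where C: "\<forall>x\<in>{0..b}. cmod (w' x * u x) \<le> C"
    using bd[OF continuous_on_mult[OF continuous_on_subset[OF w'] dformD(1)[OF assms(1)]]] by blast
  obtain B where B: "\<forall>x\<in>{0..b} - grid. cmod (v x) \<le> B" using assms(1) unfolding dform_def by blast
  have "cmod (w x * v x + w' x * u x) \<le> A * B + C" if x: "x \<in> {0..b} - grid" for x
  proof -
    have "cmod (w x * v x) \<le> A * B"
      unfolding norm_mult using A B x by (intro mult_mono) (auto intro: order_trans[OF norm_ge_zero])
    then show ?thesis using C x by (intro norm_triangle_le add_mono) auto
  qed
  then show "\<exists>B. \<forall>x\<in>{0..b} - grid. cmod (w x * v x + w' x * u x) \<le> B" by blast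
qed

lemma L2_inner_integrable_on:
  assumes "f \<in> L2" "h \<in> L2"
  shows "(\<lambda>x. f x * cnj (h x)) integrable_on {0..b}"
proof -
  have "(\<lambda>x. f x * cnj (h x)) absolutely_integrable_on half_line"
    using L2_inner_integrable[OF assms] unfolding set_integrable_def
    by (subst (asm) integrable_restrict_space) auto
  then have "(\<lambda>x. f x * cnj (h x)) absolutely_integrable_on {0..b}"
    by (rule set_integrable_subset) auto
  then show ?thesis by (simp add: absolutely_integrable_on_def)
qed

lemma of_real_vector_derivative:
  "(f has_real_derivative f') (at x) \<Longrightarrow> ((\<lambda>x. complex_of_real (f x)) has_vector_derivative of_real f') (at x)"
  unfolding has_real_derivative_iff_has_vector_derivative
  by (rule bounded_linear.has_vector_derivative[OF bounded_linear_of_real])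

text \<open>
  The energy estimate behind the cutoff argument: since \<open>w'\<close> vanishes on the grid, the point
  interactions do not contribute when \<open>-u''\<close> is tested against \<open>w'\<^sup>2 u\<close>.
\<close>

lemma cutoff_derivative_estimate:
  fixes w w' w'' :: "real \<Rightarrow> real"
  assumes u: "dsol a u v g" "u \<in> L2" "g \<in> L2"
    and w': "\<And>x. (w' has_real_derivative w'' x) (at x)" "continuous_on UNIV w''"
    and grid: "\<And>n. w' (pt n) = 0"
    and e: "\<And>x. \<bar>w' x\<bar> \<le> e" "\<And>x. \<bar>w'' x\<bar> \<le> e"
    and supp: "\<And>x. x > b \<Longrightarrow> w' x = 0" "\<And>x. x > b \<Longrightarrow> w'' x = 0"
  shows "(\<lambda>x. of_real (w' x) * v x) \<in> L2"
    "L2_norm (\<lambda>x. of_real (w' x) * v x) \<le> 3 * e * (L2_norm u + L2_norm g)"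
proof -
  have e0: "e \<ge> 0" using e(1)[of 0] by linarith
  have w'c: "continuous_on UNIV w'"
    by (rule DERIV_continuous_on[OF has_field_derivative_at_within[OF w'(1)]])
  have mb: "(\<lambda>x. complex_of_real (f x)) \<in> borel_measurable half_line_measure" if "continuous_on UNIV f" for f
    by (intro continuous_measurable_half_line continuous_on_of_real continuous_on_subset[OF that]) auto
  have vm: "v \<in> borel_measurable half_line_measure" by (rule dformD(3)[OF dsol_imp_dform[OF u(1)]])
  \<comment> \<open>In these terms Green's formula tested with w'^2 times the conjugate of u reads
    <R, S> + |P|^2 + 2 <P, Q> = 0. Only \<open>P\<close> contains the unknown derivative; the norms
    of \<open>Q\<close>, \<open>R\<close> and \<open>S\<close> are at most \<open>e\<close> times
    those of \<open>u\<close> or \<open>g\<close>.\<close>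
  define P where "P x = of_real (w' x) * v x" for x
  define Q where "Q x = of_real (w'' x) * u x" for x
  define R where "R x = of_real (w' x) * g x" for x
  define S where "S x = of_real (w' x) * u x" for x
  have P: "P \<in> L2"
  proof -
    obtain B where B: "\<forall>x\<in>{0..b} - grid. cmod (v x) \<le> B"
      using dsol_imp_dform[OF u(1)] unfolding dform_def by blast
    have ae: "AE x in half_line_measure. x \<notin> grid"
      unfolding AE_half_line_iff using negligible_grid by blast
    show ?thesis
    proof (rule L2_bounded_support[of _ b "e * B"])
      show "P \<in> borel_measurable half_line_measure"
        unfolding P_def[abs_def] by (intro borel_measurable_times mb w'c vm)
      show "AE x in half_line_measure. cmod (P x) \<le> (if x \<le> b then e * B else 0)"
        using ae AE_space
      proof eventually_elim
        case (elim x)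
        show ?case
        proof (cases "x \<le> b")
          case True
          then have "cmod (P x) \<le> e * B"
            unfolding P_def norm_mult norm_of_real using e e0 B elim by (intro mult_mono) auto
          then show ?thesis using True by simp
        qed (use supp in \<open>simp add: P_def\<close>)
      qed
    qed
  qed
  have dom: "(\<lambda>x. of_real (f x) * F x) \<in> L2 \<and> L2_norm (\<lambda>x. of_real (f x) * F x) \<le> e * L2_norm F"
    if f: "continuous_on UNIV f" "\<And>x. \<bar>f x\<bar> \<le> e" and F: "F \<in> L2" for f F
  proof
    have le: "cmod (of_real (f x) * F x) \<le> e * cmod (F x)" for x
      unfolding norm_mult norm_of_real by (intro mult_right_mono f) auto
    then show "(\<lambda>x. of_real (f x) * F x) \<in> L2"
      by (intro L2_dominated[OF F, of _ e] borel_measurable_times mb f(1) L2_measurable[OF F] AE_I2)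
    have "L2_norm (\<lambda>x. of_real (f x) * F x) \<le> L2_norm (\<lambda>x. of_real e * F x)"
      using le e0 by (intro L2_norm_mono AE_I2) (auto simp: F norm_mult)
    then show "L2_norm (\<lambda>x. of_real (f x) * F x) \<le> e * L2_norm F"
      using e0 by (simp add: L2_norm_cmult)
  qed
  have Q: "Q \<in> L2" "L2_norm Q \<le> e * L2_norm u" and R: "R \<in> L2" "L2_norm R \<le> e * L2_norm g"
    and S: "S \<in> L2" "L2_norm S \<le> e * L2_norm u"
    unfolding Q_def[abs_def] R_def[abs_def] S_def[abs_def] using dom w'c w'(2) e u by auto
  define m where "m = cell \<bar>b\<bar>"
  define c where "c = pt (Suc m)"
  have bc: "b < c" using pt_cell(2)[of "\<bar>b\<bar>"] by (simp add: c_def m_def)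
  define W where "W x = complex_of_real ((w' x)\<^sup>2)" for x
  define W1 where "W1 x = complex_of_real (2 * w' x * w'' x)" for x
  have Wd: "(W has_vector_derivative W1 x) (at x)" for x
    unfolding W_def[abs_def] W1_def
    by (intro of_real_vector_derivative) (auto intro!: derivative_eq_intros w'(1))
  have W1c: "continuous_on UNIV W1"
    unfolding W1_def[abs_def] by (intro continuous_intros w'c w'(2))
  have df: "dform (\<lambda>x. W x * cnj (u x)) (\<lambda>x. W x * cnj (v x) + W1 x * cnj (u x))"
    by (rule dform_mult[OF dsol_imp_dform[OF dsol_cnj[OF u(1)]] Wd W1c])
  obtain l where l: "(v \<longlongrightarrow> l) (at_left (pt (Suc m)))" using dsol_left_limit[OF u(1)] by blast
  \<comment> \<open>The interaction terms and the end term carry the factor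
    \<open>w' (pt n)\<close>; the boundary term at 0 vanishes by the same property, as
    \<open>pt 0 = 0\<close>.\<close>
  have "((\<lambda>x. g x * (W x * cnj (u x)) + v x * (W x * cnj (v x) + W1 x * cnj (u x))) has_integral 0) {0..c}"
    using dsol_green[OF u(1) df l] grid grid[of 0] by (simp add: W_def c_def)
  moreover have "(\<lambda>x. g x * (W x * cnj (u x)) + v x * (W x * cnj (v x) + W1 x * cnj (u x)))
     = (\<lambda>x. R x * cnj (S x) + P x * cnj (P x) + 2 * (P x * cnj (Q x)))"
    by (rule ext) (simp add: W_def W1_def P_def Q_def R_def S_def power2_eq_square algebra_simps)
  ultimately have z: "integral {0..c} (\<lambda>x. R x * cnj (S x) + P x * cnj (P x) + 2 * (P x * cnj (Q x))) = 0"
    by (simp add: integral_unique)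
  have i: "(\<lambda>x. R x * cnj (S x)) integrable_on {0..c}" "(\<lambda>x. P x * cnj (P x)) integrable_on {0..c}"
     "(\<lambda>x. P x * cnj (Q x)) integrable_on {0..c}"
    by (intro L2_inner_integrable_on P Q R S)+
  have "0 = integral {0..c} (\<lambda>x. R x * cnj (S x)) + integral {0..c} (\<lambda>x. P x * cnj (P x))
       + 2 * integral {0..c} (\<lambda>x. P x * cnj (Q x))"
    unfolding z[symmetric] integral_mult_right[symmetric]
    by (subst integral_add, intro integrable_add i integrable_on_mult_right, intro integrable_on_mult_right i,
        subst integral_add[OF i(1,2)]) simp
  also have "integral {0..c} (\<lambda>x. R x * cnj (S x)) = L2_inner R S"
    by (rule L2_inner_eq_integral[OF R(1) S(1), symmetric]) (use supp bc in \<open>auto simp: R_def\<close>)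
  also have "integral {0..c} (\<lambda>x. P x * cnj (P x)) = L2_inner P P"
    by (rule L2_inner_eq_integral[OF P P, symmetric]) (use supp bc in \<open>auto simp: P_def\<close>)
  also have "integral {0..c} (\<lambda>x. P x * cnj (Q x)) = L2_inner P Q"
    by (rule L2_inner_eq_integral[OF P Q(1), symmetric]) (use supp bc in \<open>auto simp: P_def\<close>)
  finally have "of_real ((L2_norm P)\<^sup>2) = - (L2_inner R S + 2 * L2_inner P Q)"
    by (simp add: L2_inner_self eq_neg_iff_add_eq_0 algebra_simps)
  then have "(L2_norm P)\<^sup>2 = cmod (- (L2_inner R S + 2 * L2_inner P Q))"
    by (metis norm_of_real abs_of_nonneg zero_le_power2)
  also have "\<dots> \<le> cmod (L2_inner R S) + 2 * cmod (L2_inner P Q)"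
    unfolding norm_minus_cancel by (rule order_trans[OF norm_triangle_ineq]) (simp add: norm_mult)
  also have "\<dots> \<le> L2_norm R * L2_norm S + 2 * (L2_norm P * L2_norm Q)"
    by (intro add_mono mult_left_mono L2_Cauchy_Schwarz P Q R S) simp
  finally have main: "(L2_norm P)\<^sup>2 \<le> L2_norm R * L2_norm S + 2 * (L2_norm P * L2_norm Q)" .
  define D where "D = e * (L2_norm u + L2_norm g)"
  have D0: "D \<ge> 0" using e0 by (simp add: D_def)
  have le: "L2_norm Q \<le> D" "L2_norm R \<le> D" "L2_norm S \<le> D"
    using Q(2) R(2) S(2) e0 by (auto simp: D_def distrib_left intro: order_trans)
  have "L2_norm R * L2_norm S + 2 * (L2_norm P * L2_norm Q) \<le> D * D + 2 * (L2_norm P * D)"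
    using le D0 by (intro add_mono mult_mono) auto
  with main have m2: "L2_norm P * L2_norm P \<le> D * D + 2 * (L2_norm P * D)" by (simp add: power2_eq_square)
  \<comment> \<open>The inequality p^2 <= D^2 + 2 p D bounds p by (1 + sqrt 2) D; 3 is a convenient
    larger factor.\<close>
  have "L2_norm P \<le> 3 * D"
  proof (rule ccontr)
    assume "\<not> L2_norm P \<le> 3 * D"
    then have gt: "L2_norm P > 3 * D" by simp
    have "D * D \<le> L2_norm P * D" using gt D0 by (intro mult_right_mono) auto
    moreover have "3 * D * L2_norm P < L2_norm P * L2_norm P" using gt D0 by (intro mult_strict_right_mono) auto
    ultimately show False using m2 by (simp add: algebra_simps)
  qed
  then show "(\<lambda>x. of_real (w' x) * v x) \<in> L2"
    "L2_norm (\<lambda>x. of_real (w' x) * v x) \<le> 3 * e * (L2_norm u + L2_norm g)"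
    using P by (auto simp: P_def[abs_def] D_def)
qed

text \<open>Up to signs, the image of X u differs from \<open>k\<close> by (1 - X) k and by 2 X' u'
  + X'' u. The former tends to 0 by dominated convergence; the latter is of order 1 / (N + 1), for
  its first term by the energy estimate and for its second by the pointwise cutoff bound.\<close>

lemma dsol_in_closure:
  assumes u: "dsol a u v (\<lambda>x. - k x)" "v 0 = 0" "u \<in> L2" "k \<in> L2"
  shows "(u, k) \<in> operator_closure (T a)"
proof -
  obtain X X' X'' :: "nat \<Rightarrow> real \<Rightarrow> real" and b :: "nat \<Rightarrow> real" and B :: real where
    X: "\<And>N x. (X N has_real_derivative X' N x) (at x)"
    "\<And>N x. (X' N has_real_derivative X'' N x) (at x)"
    "\<And>N. continuous_on UNIV (X'' N)"
    "\<And>N x. 0 \<le> X N x" "\<And>N x. X N x \<le> 1"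
    "\<And>N n. X' N (pt n) = 0"
    "\<And>N x. \<bar>X' N x\<bar> \<le> B / real (Suc N)" "\<And>N x. \<bar>X'' N x\<bar> \<le> B / real (Suc N)"
    and supp: "\<And>N x. x > b N \<Longrightarrow> X N x = 0 \<and> X' N x = 0 \<and> X'' N x = 0"
    and Xlim: "\<And>x. (\<lambda>N. X N x) \<longlonglongrightarrow> 1"
    by (rule cutoff_functions) (rule that; assumption)
  define g where "g x = - k x" for x
  have gL: "g \<in> L2" using u(4) by (simp add: g_def[abs_def])
  have ug: "dsol a u v g" using u(1) by (simp add: g_def[abs_def])
  define f where "f N x = of_real (X N x) * u x" for N x
  define P where "P N x = of_real (X' N x) * v x" for N x
  define Q where "Q N x = of_real (X'' N x) * u x" for N x
  define G where "G N x = of_real (X N x) * g x + 2 * of_real (X' N x) * v x + of_real (X'' N x) * u x" for N x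
  define s where "s N = B / real (Suc N)" for N
  have s0: "s N \<ge> 0" for N using X(7)[of N 0] by (simp add: s_def)
  have Xc: "continuous_on UNIV (X N)" for N
    by (rule DERIV_continuous_on[OF has_field_derivative_at_within[OF X(1)]])
  have mb: "(\<lambda>x. complex_of_real (h x)) \<in> borel_measurable half_line_measure" if "continuous_on UNIV h" for h
    by (intro continuous_measurable_half_line continuous_on_of_real continuous_on_subset[OF that]) auto
  have P: "P N \<in> L2" "L2_norm (P N) \<le> 3 * s N * (L2_norm u + L2_norm g)" for N
    unfolding P_def[abs_def] s_def
    using cutoff_derivative_estimate[OF ug u(3) gL X(2,3,6,7,8)] supp by blast+
  have Q: "Q N \<in> L2" "L2_norm (Q N) \<le> s N * L2_norm u" for N
  proof -
    have le: "cmod (Q N x) \<le> s N * cmod (u x)" for x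
      unfolding Q_def norm_mult norm_of_real s_def by (intro mult_right_mono X) auto
    show "Q N \<in> L2"
    proof (rule L2_dominated[OF u(3), of _ "s N"])
      show "Q N \<in> borel_measurable half_line_measure"
        unfolding Q_def[abs_def] by (intro borel_measurable_times mb X L2_measurable[OF u(3)])
    qed (use le in \<open>auto intro!: AE_I2\<close>)
    have "L2_norm (Q N) \<le> L2_norm (\<lambda>x. of_real (s N) * u x)"
      using le s0[of N] by (intro L2_norm_mono AE_I2) (auto simp: u norm_mult)
    then show "L2_norm (Q N) \<le> s N * L2_norm u"
      using s0[of N] by (simp add: L2_norm_cmult)
  qed
  have XF: "(\<lambda>x. of_real (X N x) * F x) \<in> L2" if "F \<in> L2" for N F
  proof (rule L2_dominated[OF that, of _ 1])
    show "(\<lambda>x. of_real (X N x) * F x) \<in> borel_measurable half_line_measure"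
      by (intro borel_measurable_times mb Xc L2_measurable[OF that])
    show "AE x in half_line_measure. cmod (of_real (X N x) * F x) \<le> 1 * cmod (F x)"
      unfolding norm_mult norm_of_real using X(4,5) by (intro AE_I2 mult_right_mono) auto
  qed
  have lim: "(\<lambda>N. L2_norm (\<lambda>x. F x - of_real (X N x) * F x)) \<longlonglongrightarrow> 0" if F: "F \<in> L2" for F
  proof (rule L2_norm_dominated_convergence[OF F])
    show "(\<lambda>x. F x - of_real (X N x) * F x) \<in> borel_measurable half_line_measure" for N
      by (rule L2_measurable[OF L2_diff[OF F XF[OF F]]])
    show "AE x in half_line_measure. cmod (F x - of_real (X N x) * F x) \<le> cmod (F x)" for N
    proof (rule AE_I2)
      fix x
      have "F x - of_real (X N x) * F x = of_real (1 - X N x) * F x" by (simp add: algebra_simps)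
      then have "cmod (F x - of_real (X N x) * F x) = \<bar>1 - X N x\<bar> * cmod (F x)"
        by (simp only: norm_mult norm_of_real)
      also have "\<dots> \<le> 1 * cmod (F x)" using X(4,5)[of N x] by (intro mult_right_mono) auto
      finally show "cmod (F x - of_real (X N x) * F x) \<le> cmod (F x)" by simp
    qed
    show "AE x in half_line_measure. (\<lambda>N. F x - of_real (X N x) * F x) \<longlonglongrightarrow> 0"
    proof (rule AE_I2)
      fix x
      have "(\<lambda>N. F x - of_real (X N x) * F x) \<longlonglongrightarrow> F x - of_real 1 * F x"
        by (intro tendsto_intros Xlim)
      then show "(\<lambda>N. F x - of_real (X N x) * F x) \<longlonglongrightarrow> 0" by simp
    qed
  qed
  have GL: "G N \<in> L2" for N
    using L2_add[OF L2_add[OF XF[OF gL] L2_cmult[OF P(1), of 2]] Q(1), of N N N]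
    by (simp add: G_def[abs_def] P_def[abs_def] Q_def[abs_def] mult.assoc)
  have fT: "(f N, \<lambda>x. - G N x) \<in> T a" for N
  proof (rule dsol_in_T(2))
    show "dsol a (f N) (\<lambda>x. of_real (X N x) * v x + of_real (X' N x) * u x) (G N)"
      unfolding f_def[abs_def] G_def[abs_def]
      by (rule dsol_mult[OF ug]) (auto intro!: of_real_vector_derivative X continuous_on_of_real)
    \<comment> \<open>The boundary condition at 0 survives because \<open>pt 0 = 0\<close> is among
      the points where \<open>X'\<close> vanishes.\<close>
    show "of_real (X N 0) * v 0 + of_real (X' N 0) * u 0 = 0" using u(2) X(6)[of N 0] by simp
    show "f N x = 0" if "x > b N" for x using supp[OF that] by (simp add: f_def)
  qed (rule GL)
  have kG: "L2_norm (\<lambda>x. k x - (- G N x)) \<le> L2_norm (\<lambda>x. g x - of_real (X N x) * g x)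
      + (2 * (3 * s N * (L2_norm u + L2_norm g)) + s N * L2_norm u)" for N
  proof -
    have "(\<lambda>x. k x - (- G N x)) = (\<lambda>x. (- 1) * (g x - of_real (X N x) * g x) + (2 * P N x + Q N x))"
      by (rule ext) (simp add: G_def P_def Q_def g_def algebra_simps)
    then have "L2_norm (\<lambda>x. k x - (- G N x))
        \<le> L2_norm (\<lambda>x. (- 1) * (g x - of_real (X N x) * g x)) + L2_norm (\<lambda>x. 2 * P N x + Q N x)"
      using L2_norm_triangle[OF L2_cmult[OF L2_diff[OF gL XF[OF gL]]] L2_add[OF L2_cmult[OF P(1)] Q(1)]] by (simp only:)
    moreover have "L2_norm (\<lambda>x. 2 * P N x + Q N x) \<le> L2_norm (\<lambda>x. 2 * P N x) + L2_norm (Q N)"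
      by (intro L2_norm_triangle L2_cmult P Q)
    moreover have "\<dots> \<le> 2 * (3 * s N * (L2_norm u + L2_norm g)) + s N * L2_norm u"
      using P(2)[of N] Q(2)[of N] unfolding L2_norm_cmult by (intro add_mono) auto
    moreover have "L2_norm (\<lambda>x. (- 1) * (g x - of_real (X N x) * g x)) = L2_norm (\<lambda>x. g x - of_real (X N x) * g x)"
      unfolding L2_norm_cmult by simp
    ultimately show ?thesis by linarith
  qed
  have "s \<longlonglongrightarrow> 0"
  proof -
    have "(\<lambda>N. B * (1 / real (Suc N))) \<longlonglongrightarrow> B * 0" by (intro tendsto_intros LIMSEQ_Suc[OF lim_1_over_n])
    then show ?thesis by (simp add: s_def[abs_def])
  qed
  then have "(\<lambda>N. L2_norm (\<lambda>x. g x - of_real (X N x) * g x)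
      + (2 * (3 * s N * (L2_norm u + L2_norm g)) + s N * L2_norm u))
      \<longlonglongrightarrow> 0 + (2 * (3 * 0 * (L2_norm u + L2_norm g)) + 0 * L2_norm u)"
    by (intro tendsto_intros lim[OF gL])
  then have lim2: "(\<lambda>N. L2_norm (\<lambda>x. g x - of_real (X N x) * g x)
      + (2 * (3 * s N * (L2_norm u + L2_norm g)) + s N * L2_norm u)) \<longlonglongrightarrow> 0" by simp
  show ?thesis
    unfolding operator_closure_def
  proof (clarify, intro conjI allI impI)
    fix e :: real assume e: "e > 0"
    have "\<forall>\<^sub>F N in sequentially. L2_norm (\<lambda>x. u x - of_real (X N x) * u x) < e"
      by (rule order_tendstoD(2)[OF lim[OF u(3)] e])
    moreover have "\<forall>\<^sub>F N in sequentially. L2_norm (\<lambda>x. g x - of_real (X N x) * g x)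
      + (2 * (3 * s N * (L2_norm u + L2_norm g)) + s N * L2_norm u) < e"
      by (rule order_tendstoD(2)[OF lim2 e])
    ultimately have "\<forall>\<^sub>F N in sequentially. L2_norm (\<lambda>x. u x - f N x) < e \<and> L2_norm (\<lambda>x. k x - (- G N x)) < e"
      by eventually_elim (use kG in \<open>auto simp: f_def intro: le_less_trans\<close>)
    then obtain N where "L2_norm (\<lambda>x. u x - f N x) < e \<and> L2_norm (\<lambda>x. k x - (- G N x)) < e"
      using eventually_happens trivial_limit_sequentially by blast
    then show "\<exists>(p, q)\<in>T a. L2_norm (\<lambda>x. u x - p x) < e \<and> L2_norm (\<lambda>x. k x - q x) < e"
      using fT[of N] by (intro bexI[of _ "(f N, \<lambda>x. - G N x)"]) auto
  qed (use u in auto)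
qed

text \<open>The membership in the closure is established for the regular representative; passing to
  another one leaves all distances to graph elements unchanged.\<close>

lemma adjoint_T_subset_closure: "operator_adjoint (T a) \<subseteq> operator_closure (T a)"
proof clarify
  fix h k assume hk: "(h, k) \<in> operator_adjoint (T a)"
  then have L: "h \<in> L2" "k \<in> L2" by (auto simp: operator_adjoint_def)
  obtain u v where u: "dsol a u v (\<lambda>x. - k x)" "v 0 = 0" "L2_eq h u"
    using adjoint_T_regular[OF hk] by metis
  have uL: "u \<in> L2" by (rule L2_cong_AE[OF L(1) u(3)])
  have c: "(u, k) \<in> operator_closure (T a)" by (rule dsol_in_closure[OF u(1,2) uL L(2)])
  have eq: "L2_norm (\<lambda>x. h x - p x) = L2_norm (\<lambda>x. u x - p x)" if "(p, q) \<in> T a" for p q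
  proof (rule L2_norm_cong_AE)
    show "L2_eq (\<lambda>x. h x - p x) (\<lambda>x. u x - p x)"
      using u(3) unfolding L2_eq_def by eventually_elim simp
    show "(\<lambda>x. h x - p x) \<in> L2" using that T_subset L by (intro L2_diff) auto
  qed
  show "(h, k) \<in> operator_closure (T a)"
    unfolding operator_closure_def
  proof (clarify, intro conjI allI impI L)
    fix e :: real assume "e > 0"
    then obtain p q where "(p, q) \<in> T a" "L2_norm (\<lambda>x. u x - p x) < e" "L2_norm (\<lambda>x. k x - q x) < e"
      using c unfolding operator_closure_def by blast
    then show "\<exists>(p, q)\<in>T a. L2_norm (\<lambda>x. h x - p x) < e \<and> L2_norm (\<lambda>x. k x - q x) < e"
      using eq[of p q] by (intro bexI[of _ "(p, q)"]) auto
  qed (use L in auto)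
qed

section \<open>Density of the domain\<close>

text \<open>The radial retraction onto the disc of radius B. Being continuous and fixing the disc,
  it makes approximants uniformly bounded without changing a limit that lies in the disc.\<close>

definition clip :: "real \<Rightarrow> complex \<Rightarrow> complex" where
  "clip B z = of_real (B / max B (cmod z)) * z"

lemma clip:
  assumes "B > 0"
  shows "continuous_on UNIV (clip B)" "cmod (clip B z) \<le> B" "cmod z \<le> B \<Longrightarrow> clip B z = z"
proof -
  show "continuous_on UNIV (clip B)"
    unfolding clip_def[abs_def] using assms by (intro continuous_intros) auto
  have "cmod (clip B z) = B * (cmod z / max B (cmod z))"
    unfolding clip_def norm_mult norm_of_real using assms by (simp add: max_def)
  also have "\<dots> \<le> B * 1" using assms by (intro mult_left_mono) (auto simp: max_def)
  finally show "cmod (clip B z) \<le> B" by simp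
  show "cmod z \<le> B \<Longrightarrow> clip B z = z" using assms by (simp add: clip_def max_def)
qed

text \<open>The exponent has the form \<open>Suc (Suc K)\<close> so that two differentiations need
  no subtraction of natural numbers; in the application it is even.\<close>

lemma grid_weight_derivatives:
  fixes K :: nat
  defines "C \<equiv> \<lambda>x::real. cos (pi * x\<^sup>2)"
  defines "C1 \<equiv> \<lambda>x::real. - sin (pi * x\<^sup>2) * (2 * pi * x)"
  defines "C2 \<equiv> \<lambda>x::real. - cos (pi * x\<^sup>2) * (2 * pi * x)\<^sup>2 - sin (pi * x\<^sup>2) * (2 * pi)"
  shows "((\<lambda>x. 1 - C x ^ Suc (Suc K)) has_real_derivative - real (Suc (Suc K)) * C x ^ Suc K * C1 x) (at x)"
    "((\<lambda>x. - real (Suc (Suc K)) * C x ^ Suc K * C1 x) has_real_derivative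
       - real (Suc (Suc K)) * (real (Suc K) * C x ^ K * C1 x * C1 x + C x ^ Suc K * C2 x)) (at x)"
    "continuous_on UNIV (\<lambda>x. - real (Suc (Suc K)) * (real (Suc K) * C x ^ K * C1 x * C1 x + C x ^ Suc K * C2 x))"
proof -
  have C: "(C has_real_derivative C1 x) (at x)" for x
    unfolding C_def C1_def by (auto intro!: derivative_eq_intros)
  have C1: "(C1 has_real_derivative C2 x) (at x)" for x
    unfolding C1_def C2_def by (auto intro!: derivative_eq_intros simp: power2_eq_square algebra_simps)
  have p: "((\<lambda>x. C x ^ Suc k) has_real_derivative real (Suc k) * C x ^ k * C1 x) (at x)" for k x
    using DERIV_power_Suc[OF C, of k x] by (simp add: mult_ac of_nat_Suc del: power_Suc)
  show "((\<lambda>x. 1 - C x ^ Suc (Suc K)) has_real_derivative - real (Suc (Suc K)) * C x ^ Suc K * C1 x) (at x)"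
    using DERIV_diff[OF DERIV_const[of 1] p[of "Suc K" x]] by (simp del: power_Suc)
  have "((\<lambda>x. - real (Suc (Suc K)) * (C x ^ Suc K * C1 x)) has_real_derivative
       - real (Suc (Suc K)) * (C x ^ Suc K * C2 x + real (Suc K) * C x ^ K * C1 x * C1 x)) (at x)"
    by (intro DERIV_cmult DERIV_mult' p C1)
  then show "((\<lambda>x. - real (Suc (Suc K)) * C x ^ Suc K * C1 x) has_real_derivative
       - real (Suc (Suc K)) * (real (Suc K) * C x ^ K * C1 x * C1 x + C x ^ Suc K * C2 x)) (at x)"
    by (simp add: mult.assoc add.commute del: power_Suc)
  show "continuous_on UNIV (\<lambda>x. - real (Suc (Suc K)) * (real (Suc K) * C x ^ K * C1 x * C1 x + C x ^ Suc K * C2 x))"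
    unfolding C_def C1_def C2_def by (intro continuous_intros)
qed

text \<open>At every \<open>pt k\<close>, 0 included, cos (pi x^2) is 1 or -1, so the even power
  makes the weight and its derivative vanish there. At all other points of the half-line the weight
  tends to 1 as n grows.\<close>

definition grid_weight :: "nat \<Rightarrow> real \<Rightarrow> real" where
  "grid_weight n x = 1 - cos (pi * x\<^sup>2) ^ (2 * Suc n)"

lemma grid_weight_bounds: "0 \<le> grid_weight n x" "grid_weight n x \<le> 1"
proof -
  have "cos (pi * x\<^sup>2) ^ (2 * Suc n) = ((cos (pi * x\<^sup>2))\<^sup>2) ^ Suc n" by (rule power_mult)
  moreover have "0 \<le> (cos (pi * x\<^sup>2))\<^sup>2" "(cos (pi * x\<^sup>2))\<^sup>2 \<le> 1" by (auto simp: power_le_one abs_square_le_1)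
  ultimately have "0 \<le> cos (pi * x\<^sup>2) ^ (2 * Suc n)" "cos (pi * x\<^sup>2) ^ (2 * Suc n) \<le> 1"
    by (simp_all add: power_le_one del: power_Suc)
  then show "0 \<le> grid_weight n x" "grid_weight n x \<le> 1" unfolding grid_weight_def by linarith+
qed

lemma grid_weight_tendsto:
  assumes "x > 0" "x \<notin> grid"
  shows "(\<lambda>n. grid_weight n x) \<longlonglongrightarrow> 1"
proof -
  have "sin (pi * x\<^sup>2) \<noteq> 0"
  proof
    assume "sin (pi * x\<^sup>2) = 0"
    then obtain i :: int where "pi * x\<^sup>2 = of_int i * pi" by (auto simp: sin_zero_iff_int2)
    then have i: "x\<^sup>2 = of_int i" by simp
    then have "i > 0" using assms(1) by (metis of_int_0_less_iff zero_less_power)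
    then have "x = pt (nat i)" "nat i \<ge> 1" using i assms(1) by (auto simp: real_sqrt_unique)
    then show False using assms(2) pt_in_grid by blast
  qed
  then have "0 < (sin (pi * x\<^sup>2))\<^sup>2" by simp
  then have "(cos (pi * x\<^sup>2))\<^sup>2 < 1" using sin_cos_squared_add[of "pi * x\<^sup>2"] by linarith
  then have "(\<lambda>n. ((cos (pi * x\<^sup>2))\<^sup>2) ^ n) \<longlonglongrightarrow> 0"
    by (intro LIMSEQ_power_zero) simp
  from tendsto_diff[OF tendsto_const[of 1] LIMSEQ_Suc[OF this]]
  have "(\<lambda>n. 1 - ((cos (pi * x\<^sup>2))\<^sup>2) ^ Suc n) \<longlonglongrightarrow> 1 - 0" .
  then show ?thesis unfolding grid_weight_def power_mult by simp
qed

text \<open>Value and derivative of the weighted polynomial vanish at every \<open>pt k\<close>. For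
  k = 0 this gives the Neumann condition, at grid points before \<open>pt M\<close> the interface
  condition with any strength, and for k = M the requirement for truncation.\<close>

lemma weighted_polynomial_in_T:
  assumes p: "polynomial_function p" and M: "M \<ge> 1"
  shows "\<exists>k. (trunc M (\<lambda>x. of_real (grid_weight n x) * p x), k) \<in> T a"
proof -
  define K where "K = 2 * n"
  have K: "2 * Suc n = Suc (Suc K)" by (simp add: K_def)
  define s1 where "s1 x = - real (Suc (Suc K)) * cos (pi * x\<^sup>2) ^ Suc K * (- sin (pi * x\<^sup>2) * (2 * pi * x))" for x :: real
  have "\<exists>s2. (\<forall>x. (grid_weight n has_real_derivative s1 x) (at x)) \<and>
      (\<forall>x. (s1 has_real_derivative s2 x) (at x)) \<and> continuous_on UNIV s2"
    unfolding grid_weight_def[abs_def] K s1_def[abs_def]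
    by (rule exI, intro conjI allI, rule grid_weight_derivatives(1), rule grid_weight_derivatives(2),
        rule grid_weight_derivatives(3))
  then obtain s2 where s: "\<And>x. (grid_weight n has_real_derivative s1 x) (at x)"
    "\<And>x. (s1 has_real_derivative s2 x) (at x)" "continuous_on UNIV s2"
    by blast
  obtain p1 where p1: "polynomial_function p1" "\<And>x. (p has_vector_derivative p1 x) (at x)"
    using has_vector_derivative_polynomial_function[OF p] by metis
  obtain p2 where p2: "polynomial_function p2" "\<And>x. (p1 has_vector_derivative p2 x) (at x)"
    using has_vector_derivative_polynomial_function[OF p1(1)] by metis
  define u where "u x = of_real (grid_weight n x) * p x" for x
  define u1 where "u1 x = of_real (grid_weight n x) * p1 x + of_real (s1 x) * p x" for x
  define u2 where "u2 x = (of_real (grid_weight n x) * p2 x + of_real (s1 x) * p1 x) + (of_real (s1 x) * p1 x + of_real (s2 x) * p x)" for x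
  have cs: "cos (pi * (pt k)\<^sup>2) ^ (2 * Suc n) = 1" "sin (pi * (pt k)\<^sup>2) = 0" for k
  proof -
    have "(cos (real k * pi))\<^sup>2 = 1" using sin_cos_squared_add[of "real k * pi"] by (simp add: sin_npi)
    then have "cos (real k * pi) ^ (2 * Suc n) = 1" unfolding power_mult by simp
    then show "cos (pi * (pt k)\<^sup>2) ^ (2 * Suc n) = 1" by (simp add: mult.commute)
    show "sin (pi * (pt k)\<^sup>2) = 0" using sin_npi[of k] by (simp add: mult.commute)
  qed
  have z: "u (pt k) = 0" "u1 (pt k) = 0" for k
    using cs[of k] by (simp_all add: u_def u1_def s1_def grid_weight_def del: power_Suc)
  have c: "continuous_on UNIV p" "continuous_on UNIV p1" "continuous_on UNIV p2"
      "continuous_on UNIV (grid_weight n)" "continuous_on UNIV s1" "continuous_on UNIV s2"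
    by (rule continuous_on_polymonial_function[OF p] continuous_on_polymonial_function[OF p1(1)]
        continuous_on_polymonial_function[OF p2(1)] s(3)
        DERIV_continuous_on[OF has_field_derivative_at_within[OF s(1)]]
        DERIV_continuous_on[OF has_field_derivative_at_within[OF s(2)]])+
  have ds: "dsol a u u1 u2"
  proof (rule dsol_smooth)
    show "(u has_vector_derivative u1 x) (at x)" for x
      unfolding u_def[abs_def] u1_def by (intro has_vector_derivative_mult of_real_vector_derivative s p1)
    show "(u1 has_vector_derivative u2 x) (at x)" for x
      unfolding u1_def[abs_def] u2_def
      by (intro has_vector_derivative_add has_vector_derivative_mult of_real_vector_derivative s p1 p2)
    show "continuous_on UNIV u2"
      unfolding u2_def[abs_def] by (intro continuous_intros c)
  qed (rule z)
  have "(u1 \<longlongrightarrow> u1 (pt M)) (at_left (pt M))"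
  proof -
    have "continuous_on UNIV u1" unfolding u1_def[abs_def] by (intro continuous_intros c)
    then have "(u1 \<longlongrightarrow> u1 (pt M)) (at (pt M))" by (auto simp: continuous_on_def)
    then show ?thesis by (rule tendsto_mono[OF at_le, rotated]) simp
  qed
  then have d: "dsol a (trunc M u) (trunc M u1) (trunc M u2)"
    using z by (intro dsol_trunc[OF ds M]) auto
  have d0: "trunc M u1 0 = 0" using z(2)[of 0] by (simp add: trunc_def)
  have L: "trunc M u2 \<in> L2"
  proof (rule trunc_continuous_L2)
    have "continuous_on UNIV u2"
      unfolding u2_def[abs_def] by (intro continuous_intros c)
    then show "continuous_on half_line u2" by (rule continuous_on_subset) simp
  qed
  have "(trunc M u, \<lambda>x. - trunc M u2 x) \<in> T a"
    by (rule dsol_in_T(2)[OF d d0 _ L, of "pt M"]) (simp add: trunc_def)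
  then show ?thesis unfolding u_def[abs_def] by blast
qed

text \<open>Continuous functions converging to \<open>H\<close> almost everywhere exist by
  measurability. Clipping bounds them, polynomials replace them uniformly on the compact interval,
  and the weight, which tends to 1 almost everywhere, moves the polynomials into the domain. The
  number M bounds both the size and the support of \<open>H\<close>.\<close>

lemma bounded_approximation_T:
  assumes H: "H \<in> borel_measurable half_line_measure" and M: "M \<ge> 1"
    and bd: "\<And>x. cmod (H x) \<le> real M" "\<And>x. x \<ge> pt M \<Longrightarrow> H x = 0" and e: "e > 0"
  shows "\<exists>(f, k)\<in>T a. L2_norm (\<lambda>x. H x - f x) < e"
proof -
  have Mp: "real M > 0" using M by simp
  have "H measurable_on half_line"
    using H by (simp add: measurable_on_iff_borel_measurable)
  then obtain N g where N: "negligible N" and g: "\<And>n. continuous_on UNIV (g n)"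
    and lim: "\<And>x. x \<notin> N \<Longrightarrow> (\<lambda>n. g n x) \<longlonglongrightarrow> (if x \<in> half_line then H x else 0)"
    unfolding measurable_on_def by blast
  have "\<exists>p. polynomial_function p \<and> (\<forall>x\<in>{0..pt M}. cmod (clip (real M) (g n x) - p x) < 1 / real (Suc n))" for n
  proof (rule Stone_Weierstrass_polynomial_function)
    show "continuous_on {0..pt M} (\<lambda>x. clip (real M) (g n x))"
      by (intro continuous_on_compose2[OF clip(1)[OF Mp]] continuous_on_subset[OF g]) auto
  qed (auto simp: of_nat_Suc)
  then obtain p where p: "\<And>n. polynomial_function (p n)"
    and pc: "\<And>n x. x \<in> {0..pt M} \<Longrightarrow> cmod (clip (real M) (g n x) - p n x) < 1 / real (Suc n)"
    by metis
  define f where "f n = trunc M (\<lambda>x. of_real (grid_weight n x) * p n x)" for n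
  have fT: "\<exists>k. (f n, k) \<in> T a" for n
    unfolding f_def by (rule weighted_polynomial_in_T[OF p M])
  then have fL: "f n \<in> L2" for n using T_subset by blast
  have "(\<lambda>n. L2_norm (\<lambda>x. H x - f n x)) \<longlonglongrightarrow> 0"
  proof (rule L2_norm_dominated_convergence)
    \<comment> \<open>The dominating constant is \<open>real M\<close> for \<open>H\<close> plus
      \<open>real M + 1\<close> for the polynomials.\<close>
    show "trunc M (\<lambda>x. of_real (2 * real M + 1)) \<in> L2"
      by (intro trunc_continuous_L2 continuous_intros)
    show "(\<lambda>x. H x - f n x) \<in> borel_measurable half_line_measure" for n
      by (intro borel_measurable_diff H L2_measurable fL)
    show "AE x in half_line_measure. cmod (H x - f n x) \<le> cmod (trunc M (\<lambda>x. of_real (2 * real M + 1)) x)" for n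
      using AE_space
    proof eventually_elim
      case (elim x)
      show ?case
      proof (cases "x < pt M")
        case True
        then have "cmod (p n x) \<le> cmod (clip (real M) (g n x)) + cmod (clip (real M) (g n x) - p n x)"
          by (metis norm_minus_commute norm_triangle_sub)
        moreover have "cmod (clip (real M) (g n x)) \<le> real M" by (rule clip(2)[OF Mp])
        moreover have "cmod (clip (real M) (g n x) - p n x) < 1 / real (Suc n)"
          using pc[of x n] True elim by auto
        moreover have "1 / real (Suc n) \<le> 1" by (simp add: of_nat_Suc)
        ultimately have p1: "cmod (p n x) \<le> real M + 1" by linarith
        have "cmod (f n x) = grid_weight n x * cmod (p n x)"
          using True grid_weight_bounds[of n x] by (simp add: f_def trunc_def norm_mult)
        also have "\<dots> \<le> 1 * (real M + 1)"
          using grid_weight_bounds[of n x] p1 by (intro mult_mono) auto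
        finally have "cmod (H x) + cmod (f n x) \<le> real M + 1 * (real M + 1)"
          by (intro add_mono bd(1))
        also have "\<dots> = 2 * real M + 1" by simp
        finally have "cmod (H x - f n x) \<le> 2 * real M + 1"
          by (rule order_trans[OF norm_triangle_ineq4])
        moreover have "cmod (of_real (2 * real M + 1)) = 2 * real M + 1"
          unfolding norm_of_real by simp
        ultimately show ?thesis using True by (simp only: trunc_def if_True)
      next
        case False
        then show ?thesis using bd(2)[of x] by (simp add: f_def trunc_def)
      qed
    qed
    have "AE x in half_line_measure. x \<notin> N \<union> grid \<union> {0}"
      unfolding AE_half_line_iff using N negligible_grid
      by (intro exI[of _ "N \<union> grid \<union> {0}"]) (auto intro: negligible_Un)
    then show "AE x in half_line_measure. (\<lambda>n. H x - f n x) \<longlonglongrightarrow> 0"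
      using AE_space
    proof eventually_elim
      case (elim x)
      then have x: "x > 0" "x \<notin> grid" "x \<notin> N" by auto
      show ?case
      proof (cases "x < pt M")
        case True
        have "isCont (clip (real M)) (H x)"
          using clip(1)[OF Mp] by (simp add: continuous_on_eq_continuous_at)
        moreover have "(\<lambda>n. g n x) \<longlonglongrightarrow> H x" using lim[of x] x by simp
        ultimately have "(\<lambda>n. clip (real M) (g n x)) \<longlonglongrightarrow> clip (real M) (H x)"
          by (rule isCont_tendsto_compose)
        then have cl: "(\<lambda>n. clip (real M) (g n x)) \<longlonglongrightarrow> H x" using clip(3)[OF Mp bd(1)] by simp
        have "(\<lambda>n. clip (real M) (g n x) - p n x) \<longlonglongrightarrow> 0"
        proof (rule Lim_null_comparison)
          show "\<forall>\<^sub>F n in sequentially. cmod (clip (real M) (g n x) - p n x) \<le> 1 / real (Suc n)"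
            using pc[of x] True x by (intro always_eventually allI less_imp_le) auto
          show "(\<lambda>n. 1 / real (Suc n)) \<longlonglongrightarrow> 0" by (rule LIMSEQ_Suc[OF lim_1_over_n])
        qed
        from tendsto_diff[OF cl this] have pl: "(\<lambda>n. p n x) \<longlonglongrightarrow> H x" by simp
        have "(\<lambda>n. H x - of_real (grid_weight n x) * p n x) \<longlonglongrightarrow> H x - of_real 1 * H x"
          by (intro tendsto_intros pl grid_weight_tendsto x)
        then show ?thesis using True by (simp add: f_def trunc_def)
      next
        case False
        then show ?thesis using bd(2)[of x] by (simp add: f_def trunc_def)
      qed
    qed
  qed
  then have "\<forall>\<^sub>F n in sequentially. L2_norm (\<lambda>x. H x - f n x) < e"
    using e by (rule order_tendstoD(2))
  then obtain n where "L2_norm (\<lambda>x. H x - f n x) < e"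
    using eventually_happens trivial_limit_sequentially by blast
  then show ?thesis using fT[of n] by blast
qed

text \<open>A single index M truncates both the values and the support of \<open>h\<close>, which
  reduces density to the bounded case.\<close>

lemma densely_defined_T: "densely_defined (T a)"
  unfolding densely_defined_def
proof (intro ballI allI impI)
  fix h and e :: real assume h: "h \<in> L2" and e: "e > 0"
  define c where "c M = trunc M (\<lambda>x. if cmod (h x) \<le> real M then h x else 0)" for M
  have hm: "h \<in> borel_measurable half_line_measure" by (rule L2_measurable[OF h])
  have cm: "c M \<in> borel_measurable half_line_measure" for M
  proof -
    have "(\<lambda>x. cmod (h x)) \<in> borel_measurable half_line_measure" using hm by measurable
    then have "{x \<in> space half_line_measure. cmod (h x) \<le> real M} \<in> sets half_line_measure"
      by (simp add: borel_measurable_iff_le)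
    then show ?thesis
      unfolding c_def by (intro trunc_measurable measurable_If hm borel_measurable_const)
  qed
  have le: "cmod (c M x) \<le> cmod (h x)" for M x by (simp add: c_def trunc_def)
  have cL: "c M \<in> L2" for M
    using le by (intro L2_dominated[OF h cm, of _ 1] AE_I2) simp
  have "(\<lambda>M. L2_norm (\<lambda>x. h x - c M x)) \<longlonglongrightarrow> 0"
  proof (rule L2_norm_dominated_convergence[OF h])
    show "(\<lambda>x. h x - c M x) \<in> borel_measurable half_line_measure" for M
      by (intro borel_measurable_diff hm cm)
    show "AE x in half_line_measure. cmod (h x - c M x) \<le> cmod (h x)" for M
      by (rule AE_I2) (simp add: c_def trunc_def)
    show "AE x in half_line_measure. (\<lambda>M. h x - c M x) \<longlonglongrightarrow> 0"
    proof (rule AE_I2)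
      fix x
      obtain m1 :: nat where m1: "cmod (h x) \<le> real m1" using real_arch_simple by blast
      obtain m2 :: nat where m2: "x\<^sup>2 < real m2" using reals_Archimedean2 by blast
      have x: "x < pt m2" using m2 by (meson real_less_rsqrt)
      have "h x - c M x = 0" if "M \<ge> max m1 m2" for M
      proof -
        have "pt m2 \<le> pt M" "real m1 \<le> real M" using that by auto
        then have "x < pt M" "cmod (h x) \<le> real M" using x m1 by linarith+
        then show ?thesis by (simp add: c_def trunc_def)
      qed
      then show "(\<lambda>M. h x - c M x) \<longlonglongrightarrow> 0"
        by (intro tendsto_eventually eventually_sequentiallyI[of "max m1 m2"])
    qed
  qed
  then have "\<forall>\<^sub>F M in sequentially. L2_norm (\<lambda>x. h x - c M x) < e / 2"
    using e by (intro order_tendstoD(2)) auto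
  then have "\<forall>\<^sub>F M in sequentially. L2_norm (\<lambda>x. h x - c M x) < e / 2 \<and> M \<ge> 1"
    using eventually_ge_at_top by (rule eventually_conj)
  then obtain M where M: "L2_norm (\<lambda>x. h x - c M x) < e / 2" "M \<ge> 1"
    using eventually_happens trivial_limit_sequentially by blast
  have "\<exists>(f, k)\<in>T a. L2_norm (\<lambda>x. c M x - f x) < e / 2"
    by (rule bounded_approximation_T[OF cm M(2)]) (use e in \<open>auto simp: c_def trunc_def\<close>)
  then obtain f k where fk: "(f, k) \<in> T a" "L2_norm (\<lambda>x. c M x - f x) < e / 2" by auto
  have fL: "f \<in> L2" using fk T_subset by blast
  have "L2_norm (\<lambda>x. h x - f x) < e"
    using L2_norm_triangle[OF L2_diff[OF h cL] L2_diff[OF cL fL], of M M] M fk by simp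
  then show "\<exists>(f, g)\<in>T a. L2_norm (\<lambda>x. h x - f x) < e" using fk(1) by blast
qed

section \<open>Unboundedness from below\<close>

text \<open>
  A function with value \<open>1\<close> at every grid point and the prescribed jumps of the derivative: on each cell
  the cubic \<open>y (1 - y/d)\<^sup>2\<close> has derivative \<open>1\<close> at the left end and a double zero at the right end.
\<close>

definition coef :: "(nat \<Rightarrow> real) \<Rightarrow> nat \<Rightarrow> real" where
  "coef a n = (if n = 0 then 0 else a n)"

definition gap :: "nat \<Rightarrow> real" where "gap n = pt (Suc n) - pt n"

definition spl :: "(nat \<Rightarrow> real) \<Rightarrow> nat \<Rightarrow> real \<Rightarrow> real" where
  "spl a n x = 1 + coef a n * ((x - pt n) * (1 - (x - pt n) / gap n)\<^sup>2)"

definition spl1 :: "(nat \<Rightarrow> real) \<Rightarrow> nat \<Rightarrow> real \<Rightarrow> real" where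
  "spl1 a n x = coef a n * ((1 - (x - pt n) / gap n) * (1 - 3 * ((x - pt n) / gap n)))"

definition spl2 :: "(nat \<Rightarrow> real) \<Rightarrow> nat \<Rightarrow> real \<Rightarrow> real" where
  "spl2 a n x = coef a n * ((6 * ((x - pt n) / gap n) - 4) / gap n)"

lemma gap: "gap n > 0" "gap n \<le> 1"
proof -
  show "gap n > 0" by (simp add: gap_def of_nat_Suc)
  have "pt (Suc n) \<le> pt n + 1"
    by (rule real_le_lsqrt) (auto simp: power2_sum of_nat_Suc)
  then show "gap n \<le> 1" by (simp add: gap_def)
qed

lemma spl_deriv:
  "(spl a n has_real_derivative spl1 a n x) (at x)"
  "(spl1 a n has_real_derivative spl2 a n x) (at x)"
proof -
  have g: "gap n \<noteq> 0" using gap(1)[of n] by simp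
  show "(spl a n has_real_derivative spl1 a n x) (at x)"
    unfolding spl_def[abs_def] spl1_def using g
    by (auto intro!: derivative_eq_intros simp: field_simps power2_eq_square)
  show "(spl1 a n has_real_derivative spl2 a n x) (at x)"
    unfolding spl1_def[abs_def] spl2_def using g
    by (auto intro!: derivative_eq_intros simp: field_simps power2_eq_square)
qed

text \<open>Since the spacings are at most 1, value and derivative are bounded uniformly over all
  cells. The second derivative may grow with the inverse spacing, which is harmless: it matters only
  for membership in the domain, whereas the energy involves first derivatives.\<close>

lemma spl_bounds:
  assumes "\<And>n. n \<ge> 1 \<Longrightarrow> \<bar>a n\<bar> \<le> 1" "x \<ge> 0"
  shows "\<bar>spl a (cell x) x\<bar> \<le> 2" "\<bar>spl1 a (cell x) x\<bar> \<le> 2" "\<bar>spl2 a (cell x) x\<bar> \<le> 10 / gap (cell x)"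
proof -
  define n where "n = cell x"
  define t where "t = (x - pt n) / gap n"
  have x: "pt n \<le> x" "x < pt (Suc n)" using pt_cell assms(2) by (auto simp: n_def)
  have t: "0 \<le> t" "t \<le> 1" using x gap(1)[of n] by (auto simp: t_def gap_def field_simps)
  have c: "\<bar>coef a n\<bar> \<le> 1" using assms(1) by (simp add: coef_def)
  have y: "0 \<le> x - pt n" "x - pt n \<le> 1" using x gap(2)[of n] by (auto simp: gap_def)
  have "\<bar>coef a n * ((x - pt n) * (1 - t)\<^sup>2)\<bar> \<le> 1 * (1 * 1)"
    unfolding abs_mult using c y t by (intro mult_mono) (auto simp: power_le_one)
  then show "\<bar>spl a (cell x) x\<bar> \<le> 2" unfolding spl_def n_def[symmetric] t_def[symmetric] by linarith
  have "\<bar>coef a n * ((1 - t) * (1 - 3 * t))\<bar> \<le> 1 * (1 * 2)"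
    unfolding abs_mult using c t by (intro mult_mono) auto
  then show "\<bar>spl1 a (cell x) x\<bar> \<le> 2" unfolding spl1_def n_def[symmetric] t_def[symmetric] by simp
  have "\<bar>coef a n * ((6 * t - 4) / gap n)\<bar> \<le> 1 * (10 / gap n)"
    unfolding abs_mult abs_divide using c t gap(1)[of n] by (intro mult_mono divide_mono) auto
  then show "\<bar>spl2 a (cell x) x\<bar> \<le> 10 / gap (cell x)"
    unfolding spl2_def n_def[symmetric] t_def[symmetric] by simp
qed

lemma cell_measurable: "cell \<in> measurable half_line_measure (count_space UNIV)"
proof -
  have "(\<lambda>x::real. x\<^sup>2) \<in> borel_measurable lborel" by simp
  from measurable_compose[OF measurable_compose[OF this measurable_real_floor] measurable_count_space[of nat]]
  have "cell \<in> measurable lborel (count_space UNIV)" by (simp add: cell_def[abs_def])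
  then have "cell \<in> measurable lebesgue (count_space UNIV)"
    by (rule measurable_completion)
  then show ?thesis by (rule measurable_restrict_space1)
qed

lemma piecewise_measurable:
  fixes W :: "nat \<Rightarrow> real \<Rightarrow> complex"
  assumes "\<And>n. continuous_on half_line (W n)"
  shows "(\<lambda>x. W (cell x) x) \<in> borel_measurable half_line_measure"
  by (rule measurable_compose_countable[OF continuous_measurable_half_line[OF assms] cell_measurable])

text \<open>Only the finitely many cells up to that of \<open>b\<close> occur, and the sum of their
  bounds dominates each of them.\<close>

lemma spl2_locally_bounded:
  assumes "\<And>n. n \<ge> 1 \<Longrightarrow> \<bar>a n\<bar> \<le> 1"
  obtains B where "\<And>x. 0 \<le> x \<Longrightarrow> x \<le> b \<Longrightarrow> \<bar>spl2 a (cell x) x\<bar> \<le> B"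
proof
  fix x assume x: "0 \<le> x" "x \<le> b"
  have "x\<^sup>2 \<le> b\<^sup>2" using x by (intro power_mono) auto
  then have "cell x \<le> cell b" unfolding cell_def by (intro nat_mono floor_mono)
  then have "10 / gap (cell x) \<le> (\<Sum>n\<le>cell b. 10 / gap n)"
    using gap(1) by (intro member_le_sum) (auto intro: less_imp_le)
  then show "\<bar>spl2 a (cell x) x\<bar> \<le> (\<Sum>n\<le>cell b. 10 / gap n)"
    using spl_bounds(3)[of a x, OF assms x(1)] by linarith
qed

text \<open>At the right end of a cell the derivative is 0, at the left end of the next one it is
  the strength, and the value is 1, so the jump condition holds exactly. The convention of
  \<open>coef\<close> at index 0 makes the function constant on the first cell.\<close>

lemma spl_dsol:
  assumes "\<And>n. n \<ge> 1 \<Longrightarrow> \<bar>a n\<bar> \<le> 1"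
  shows "dsol a (\<lambda>x. of_real (spl a (cell x) x)) (\<lambda>x. of_real (spl1 a (cell x) x)) (\<lambda>x. of_real (spl2 a (cell x) x))"
    "(\<lambda>x. complex_of_real (spl2 a (cell x) x)) \<in> borel_measurable half_line_measure"
proof -
  have c: "continuous_on S (spl2 a n)" for n S
    unfolding spl2_def[abs_def] using gap(1)[of n] by (intro continuous_intros) auto
  show m: "(\<lambda>x. complex_of_real (spl2 a (cell x) x)) \<in> borel_measurable half_line_measure"
    by (rule piecewise_measurable[where W = "\<lambda>n x. of_real (spl2 a n x)"]) (intro continuous_intros c)
  show "dsol a (\<lambda>x. of_real (spl a (cell x) x)) (\<lambda>x. of_real (spl1 a (cell x) x)) (\<lambda>x. of_real (spl2 a (cell x) x))"
  proof (rule dsol_cellsI[where U = "\<lambda>n x. of_real (spl a n x)" and V = "\<lambda>n x. of_real (spl1 a n x)"])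
    show "((\<lambda>x. complex_of_real (spl a n x)) has_vector_derivative of_real (spl1 a n x)) (at x within half_line)" for n x
      by (rule has_vector_derivative_at_within[OF of_real_vector_derivative[OF spl_deriv(1)]])
  next
    fix n
    have "bounded ((\<lambda>x. complex_of_real (spl2 a n x)) ` {pt n..pt (Suc n)})"
      by (intro compact_imp_bounded compact_continuous_image continuous_on_of_real c) auto
    then obtain B where "\<forall>y\<in>(\<lambda>x. complex_of_real (spl2 a n x)) ` {pt n..pt (Suc n)}. cmod y \<le> B"
      unfolding bounded_iff by blast
    then show "absolutely_continuous_on (pt n) (pt (Suc n)) (\<lambda>x. of_real (spl1 a n x))"
      by (intro differentiable_bounded_imp_absolutely_continuous_on[
            OF has_vector_derivative_at_within[OF of_real_vector_derivative[OF spl_deriv(2)]]]) auto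
  next
    have "((\<lambda>x. complex_of_real (spl1 a n x)) has_vector_derivative of_real (spl2 a (cell x) x)) (at x)"
      if "pt n < x" "x < pt (Suc n)" for n x
    proof -
      have "x \<ge> 0" by (rule order_trans[of _ "pt n"]) (use that(1) in auto)
      then have "cell x = n" using that by (subst cell_eq_iff) auto
      then show ?thesis by (auto intro: of_real_vector_derivative spl_deriv)
    qed
    then show "AE x in half_line_measure. \<forall>n. pt n < x \<longrightarrow> x < pt (Suc n) \<longrightarrow>
        ((\<lambda>x. complex_of_real (spl1 a n x)) has_vector_derivative of_real (spl2 a (cell x) x)) (at x)"
      by (intro AE_I2) blast
  next
    fix b
    obtain B where B: "\<And>x. 0 \<le> x \<Longrightarrow> x \<le> b \<Longrightarrow> \<bar>spl2 a (cell x) x\<bar> \<le> B"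
      using spl2_locally_bounded[of a b, OF assms] by blast
    show "(\<lambda>x. complex_of_real (spl2 a (cell x) x)) absolutely_integrable_on {0..b}"
      by (rule measurable_bounded_by_integrable_imp_absolutely_integrable[OF measurable_half_line_Icc[OF m], of b "\<lambda>x. B"])
         (use B in auto)
  next
    fix n
    have g: "pt (Suc n) - pt n = gap n" "gap n \<noteq> 0" using gap(1)[of n] by (auto simp: gap_def)
    show "complex_of_real (spl a (Suc n) (pt (Suc n))) = of_real (spl a n (pt (Suc n)))"
      using g by (simp add: spl_def)
    show "complex_of_real (spl1 a (Suc n) (pt (Suc n)))
       = of_real (spl1 a n (pt (Suc n))) + of_real (a (Suc n)) * of_real (spl a n (pt (Suc n)))"
      using g by (simp add: spl_def spl1_def coef_def)
  qed
qed

section \<open>Localized test functions of low energy\<close>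

text \<open>The profile (1 - x^2)^3 on [-1, 1], extended by 0, has the two continuous derivatives
  that a multiplier of solutions needs.\<close>

definition bump :: "real \<Rightarrow> real" where "bump x = pcube (1 - x\<^sup>2)"
definition bump1 :: "real \<Rightarrow> real" where "bump1 x = - (3 * (max 0 (1 - x\<^sup>2))\<^sup>2) * (2 * x)"
definition bump2 :: "real \<Rightarrow> real" where
  "bump2 x = 6 * max 0 (1 - x\<^sup>2) * (2 * x)\<^sup>2 - (3 * (max 0 (1 - x\<^sup>2))\<^sup>2) * 2"

lemma bump_deriv:
  "(bump has_real_derivative bump1 x) (at x)"
  "(bump1 has_real_derivative bump2 x) (at x)"
  "continuous_on S bump2"
proof -
  have i: "((\<lambda>x. 1 - x\<^sup>2) has_real_derivative - (2 * x)) (at x)" by (auto intro!: derivative_eq_intros)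
  show "(bump has_real_derivative bump1 x) (at x)"
    using DERIV_chain2[OF pcube_deriv(1) i] by (simp add: bump_def[abs_def] bump1_def)
  have j: "((\<lambda>x. - (2 * x)) has_real_derivative - 2) (at x)" by (auto intro!: derivative_eq_intros)
  have "((\<lambda>x. (3 * (max 0 (1 - x\<^sup>2))\<^sup>2) * - (2 * x)) has_real_derivative
      (3 * (max 0 (1 - x\<^sup>2))\<^sup>2) * - 2 + (6 * max 0 (1 - x\<^sup>2) * - (2 * x)) * - (2 * x)) (at x)"
    by (rule DERIV_mult'[OF DERIV_chain2[OF pcube_deriv(2) i] j])
  then show "(bump1 has_real_derivative bump2 x) (at x)"
    by (simp add: bump1_def[abs_def] bump2_def power2_eq_square algebra_simps)
  show "continuous_on S bump2" unfolding bump2_def[abs_def] by (intro continuous_intros)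
qed

lemma bump_bounds:
  \<comment> \<open>The lower bound 27 / 64 = (3 / 4)^3 is the value at |x| = 1/2, where 1 - x^2 =
    3/4.\<close>
  "\<bar>bump x\<bar> \<le> 1" "\<bar>bump1 x\<bar> \<le> 6" "\<bar>bump2 x\<bar> \<le> 30"
  "\<bar>x\<bar> \<ge> 1 \<Longrightarrow> bump x = 0" "\<bar>x\<bar> \<ge> 1 \<Longrightarrow> bump1 x = 0" "\<bar>x\<bar> \<ge> 1 \<Longrightarrow> bump2 x = 0"
  "\<bar>x\<bar> \<le> 1 / 2 \<Longrightarrow> bump x \<ge> 27 / 64" "bump x \<ge> 0"
proof -
  define m where "m = max 0 (1 - x\<^sup>2)"
  have m: "0 \<le> m" "m \<le> 1" by (auto simp: m_def)
  have z: "m = 0" if "\<bar>x\<bar> \<ge> 1" using that abs_le_square_iff[of 1 x] by (simp add: m_def)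
  have b: "bump x = m ^ 3" by (simp add: bump_def pcube_def m_def)
  have b1: "bump1 x = - (3 * m\<^sup>2) * (2 * x)" by (simp add: bump1_def m_def)
  have b2: "bump2 x = 6 * m * (2 * x)\<^sup>2 - 6 * m\<^sup>2" by (simp add: bump2_def m_def)
  show "bump x = 0" "bump1 x = 0" "bump2 x = 0" if "\<bar>x\<bar> \<ge> 1" using z[OF that] by (auto simp: b b1 b2)
  then have zz: "\<bar>x\<bar> \<ge> 1 \<Longrightarrow> bump1 x = 0" "\<bar>x\<bar> \<ge> 1 \<Longrightarrow> bump2 x = 0" by auto
  show "\<bar>bump x\<bar> \<le> 1" using m by (simp add: b power_le_one)
  show "bump x \<ge> 0" using m by (simp add: b)
  have m2: "m\<^sup>2 \<le> 1" "0 \<le> m\<^sup>2" using m by (auto simp: power_le_one)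
  show "\<bar>bump1 x\<bar> \<le> 6"
  proof (cases "\<bar>x\<bar> \<ge> 1")
    case False
    have "\<bar>bump1 x\<bar> = 6 * (m\<^sup>2 * \<bar>x\<bar>)" by (simp add: b1 abs_mult)
    also have "m\<^sup>2 * \<bar>x\<bar> \<le> 1" using False m2 by (intro mult_le_one) auto
    finally show ?thesis by simp
  qed (use zz in auto)
  show "\<bar>bump2 x\<bar> \<le> 30"
  proof (cases "\<bar>x\<bar> \<ge> 1")
    case False
    have "bump2 x = 24 * (m * x\<^sup>2) - 6 * m\<^sup>2" by (simp add: b2 power2_eq_square)
    moreover have "m * x\<^sup>2 \<le> 1" "0 \<le> m * x\<^sup>2"
      using False m abs_square_le_1[of x] by (auto intro!: mult_le_one)
    ultimately show ?thesis using m2 by linarith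
  qed (use zz in auto)
  show "bump x \<ge> 27 / 64" if "\<bar>x\<bar> \<le> 1 / 2"
  proof -
    have "x\<^sup>2 \<le> (1 / 2)\<^sup>2" using that by (subst abs_le_square_iff[symmetric]) auto
    then have "m \<ge> 3 / 4" by (simp add: m_def power2_eq_square)
    then have "m ^ 3 \<ge> (3 / 4) ^ 3" by (intro power_mono) auto
    then show ?thesis by (simp add: b power3_eq_cube)
  qed
qed

text \<open>The test function is the spline times a bump centred at N. Green's formula turns its
  energy into the squared norm of the derivative plus the sum of \<open>a n\<close> times |f (pt
  n)|^2. On an interval of length 2 the function is bounded by 2 and its derivative by 14 = 2 + 12,
  whence 8 = 2 * 2^2 and 392 = 2 * 14^2. The points with N^2 <= n <= N^2 + N lie within 1/2 of N
  because (N + 1/2)^2 exceeds N^2 + N.\<close>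

lemma test_function:
  assumes a: "\<And>n. n \<ge> 1 \<Longrightarrow> -1 \<le> a n" "\<And>n. n \<ge> 1 \<Longrightarrow> a n \<le> 0" and N: "N \<ge> 2"
  obtains f k where "(f, k) \<in> T a" "(L2_norm f)\<^sup>2 \<le> 8"
    "Re (L2_inner k f) \<le> 392 + (27 / 64)\<^sup>2 * (\<Sum>n=N\<^sup>2..N\<^sup>2 + N. a n)"
proof -
  have a1: "\<And>n. n \<ge> 1 \<Longrightarrow> \<bar>a n\<bar> \<le> 1" using a by (auto simp: abs_le_iff)
  define u where "u x = complex_of_real (spl a (cell x) x)" for x
  define v where "v x = complex_of_real (spl1 a (cell x) x)" for x
  define g where "g x = complex_of_real (spl2 a (cell x) x)" for x
  have u: "dsol a u v g" unfolding u_def[abs_def] v_def[abs_def] g_def[abs_def] by (rule spl_dsol(1)[of a, OF a1])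
  define w where "w x = complex_of_real (bump (x - real N))" for x
  define w1 where "w1 x = complex_of_real (bump1 (x - real N))" for x
  define w2 where "w2 x = complex_of_real (bump2 (x - real N))" for x
  have sh: "((\<lambda>x. x - real N) has_real_derivative 1) (at x)" for x by (auto intro!: derivative_eq_intros)
  have wd: "(w has_vector_derivative w1 x) (at x)" for x
    unfolding w_def[abs_def] w1_def
    using of_real_vector_derivative[OF DERIV_chain2[OF bump_deriv(1) sh]] by simp
  have wd1: "(w1 has_vector_derivative w2 x) (at x)" for x
    unfolding w1_def[abs_def] w2_def
    using of_real_vector_derivative[OF DERIV_chain2[OF bump_deriv(2) sh]] by simp
  have wc2: "continuous_on S w2" for S
    unfolding w2_def[abs_def]
    by (intro continuous_on_of_real continuous_on_compose2[OF bump_deriv(3)[of UNIV]] continuous_intros) auto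
  define f where "f x = w x * u x" for x
  define f1 where "f1 x = w x * v x + w1 x * u x" for x
  define G where "G x = w x * g x + 2 * w1 x * v x + w2 x * u x" for x
  have f: "dsol a f f1 G"
    unfolding f_def[abs_def] f1_def[abs_def] G_def[abs_def] by (rule dsol_mult[OF u wd wd1 wc2])
  have wb: "cmod (w x) \<le> 1" "cmod (w1 x) \<le> 6" "cmod (w2 x) \<le> 30" for x
    unfolding w_def w1_def w2_def norm_of_real by (rule bump_bounds)+
  have wz: "w x = 0 \<and> w1 x = 0 \<and> w2 x = 0" if "x \<le> real N - 1 \<or> x \<ge> real N + 1" for x
  proof -
    have "\<bar>x - real N\<bar> \<ge> 1" using that by auto
    then show ?thesis by (simp add: w_def w1_def w2_def bump_bounds)
  qed
  have ub: "cmod (u x) \<le> 2" "cmod (v x) \<le> 2" if "x \<ge> 0" for x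
    unfolding u_def v_def norm_of_real using spl_bounds[of a x, OF a1 that] by auto
  define I where "I x \<longleftrightarrow> real N - 1 \<le> x \<and> x \<le> real N + 1" for x
  have fb: "cmod (f x) \<le> (if I x then 2 else 0)" if "x \<ge> 0" for x
  proof (cases "I x")
    case True
    have "cmod (f x) \<le> 1 * 2" unfolding f_def norm_mult using wb ub[OF that] by (intro mult_mono) auto
    then show ?thesis using True by simp
  qed (use wz in \<open>auto simp: I_def f_def\<close>)
  have f1b: "cmod (f1 x) \<le> (if I x then 14 else 0)" if "x \<ge> 0" for x
  proof (cases "I x")
    case True
    have "cmod (w x * v x) \<le> 1 * 2" "cmod (w1 x * u x) \<le> 6 * 2"
      unfolding norm_mult using wb ub[OF that] by (intro mult_mono; simp)+
    then show ?thesis using True norm_triangle_ineq[of "w x * v x" "w1 x * u x"] by (simp add: f1_def)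
  qed (use wz in \<open>auto simp: I_def f1_def\<close>)
  have fm: "f \<in> borel_measurable half_line_measure" "f1 \<in> borel_measurable half_line_measure"
    using dformD[OF dsol_imp_dform[OF f]] continuous_measurable_half_line by auto
  have c0: "0 \<le> real N - 1" using N by simp
  have "AE x in half_line_measure. cmod (f x) \<le> (if real N - 1 \<le> x \<and> x \<le> real N + 1 then 2 else 0)"
    by (rule AE_I2) (use fb in \<open>simp add: I_def\<close>)
  note fL = L2_bounded_interval[OF fm(1) this c0]
  have "AE x in half_line_measure. cmod (f1 x) \<le> (if real N - 1 \<le> x \<and> x \<le> real N + 1 then 14 else 0)"
    by (rule AE_I2) (use f1b in \<open>simp add: I_def\<close>)
  note f1L = L2_bounded_interval[OF fm(2) this c0]
  have GL: "G \<in> L2"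
  proof -
    obtain B where B: "\<And>x. 0 \<le> x \<Longrightarrow> x \<le> real N + 1 \<Longrightarrow> \<bar>spl2 a (cell x) x\<bar> \<le> B"
      using spl2_locally_bounded[of a "real N + 1", OF a1] by blast
    have wm: "w \<in> borel_measurable half_line_measure" "w1 \<in> borel_measurable half_line_measure" "w2 \<in> borel_measurable half_line_measure"
      by (intro continuous_measurable_half_line wc2 continuous_at_imp_continuous_on ballI
          has_vector_derivative_continuous[OF wd] has_vector_derivative_continuous[OF wd1])+
    have gm: "g \<in> borel_measurable half_line_measure"
      unfolding g_def[abs_def] by (rule spl_dsol(2)[of a, OF a1])
    have uvm: "u \<in> borel_measurable half_line_measure" "v \<in> borel_measurable half_line_measure"
      using dformD[OF dsol_imp_dform[OF u]] continuous_measurable_half_line by auto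
    show ?thesis
    proof (rule L2_bounded_support[of _ "real N + 1" "1 * B + 12 * 2 + 30 * 2"])
      show "G \<in> borel_measurable half_line_measure"
        unfolding G_def[abs_def]
        by (intro borel_measurable_add borel_measurable_times borel_measurable_const wm gm uvm)
      show "AE x in half_line_measure. cmod (G x) \<le> (if x \<le> real N + 1 then 1 * B + 12 * 2 + 30 * 2 else 0)"
      proof (rule AE_I2)
        fix x assume "x \<in> space half_line_measure"
        then have x: "x \<ge> 0" by simp
        show "cmod (G x) \<le> (if x \<le> real N + 1 then 1 * B + 12 * 2 + 30 * 2 else 0)"
        proof (cases "x \<le> real N + 1")
          case True
          have gb: "cmod (g x) \<le> B" unfolding g_def norm_of_real by (rule B[OF x True])
          have "cmod (w x * g x) \<le> 1 * B" "cmod (w2 x * u x) \<le> 30 * 2"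
            unfolding norm_mult using wb[of x] ub[OF x] gb by (intro mult_mono; simp)+
          moreover have "cmod (2 * w1 x * v x) \<le> 12 * 2"
            unfolding norm_mult using wb(2)[of x] ub[OF x] by (intro mult_mono) auto
          ultimately have "cmod (G x) \<le> 1 * B + 12 * 2 + 30 * 2"
            unfolding G_def by (intro norm_triangle_le add_mono)
          then show ?thesis using True by simp
        qed (use wz[of x] in \<open>simp add: G_def\<close>)
      qed
    qed
  qed
  have z: "f x = 0" if "x \<ge> real N + 1" for x using wz[of x] that by (simp add: f_def)
  have f10: "f1 0 = 0" using wz[of 0] c0 by (simp add: f1_def)
  have T: "(f, \<lambda>x. - G x) \<in> T a"
    by (rule dsol_in_T(2)[OF f f10 _ GL, of "real N + 1"]) (simp add: z)
  \<comment> \<open>The support ends at N + 1, so a grid point beyond it serves as the end point for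
    Green's formula.\<close>
  define m where "m = (N + 1)\<^sup>2"
  have ptm: "real N + 1 < pt (Suc m)"
    by (rule real_less_rsqrt) (simp add: m_def of_nat_Suc add.commute)
  define b where "b = pt (Suc m)"
  obtain l where l: "(f1 \<longlongrightarrow> l) (at_left (pt (Suc m)))" using dsol_left_limit[OF f] by blast
  have fpt: "f (pt n) * cnj (f (pt n)) = of_real ((bump (pt n - real N))\<^sup>2)" if "n \<ge> 1" for n
  proof -
    have "cell (pt n) = n" by (simp add: cell_def)
    then have "f (pt n) = of_real (bump (pt n - real N))" by (simp add: f_def w_def u_def spl_def)
    then show ?thesis by (simp add: power2_eq_square)
  qed
  define s where "s = (\<Sum>n=1..m. a n * (bump (pt n - real N))\<^sup>2)"
  have "(\<Sum>n=1..m. of_real (a n) * f (pt n) * cnj (f (pt n))) = complex_of_real s"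
    unfolding s_def of_real_sum by (rule sum.cong) (auto simp: fpt mult.assoc)
  then have "((\<lambda>x. G x * cnj (f x) + f1 x * cnj (f1 x)) has_integral - of_real s) {0..b}"
    using dsol_green[OF f dsol_imp_dform[OF dsol_cnj[OF f]] l] z[of b] ptm f10 by (simp add: b_def)
  then have E1: "integral {0..b} (\<lambda>x. G x * cnj (f x)) + integral {0..b} (\<lambda>x. f1 x * cnj (f1 x)) = - of_real s"
    using integral_add[OF L2_inner_integrable_on[OF GL fL(1), of b] L2_inner_integrable_on[OF f1L(1) f1L(1), of b]]
    by (simp add: integral_unique)
  have E2: "integral {0..b} (\<lambda>x. G x * cnj (f x)) = L2_inner G f"
    by (rule L2_inner_eq_integral[OF GL fL(1), symmetric]) (use z ptm in \<open>auto simp: b_def\<close>)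
  have E3: "integral {0..b} (\<lambda>x. f1 x * cnj (f1 x)) = L2_inner f1 f1"
    by (rule L2_inner_eq_integral[OF f1L(1) f1L(1), symmetric]) (use wz ptm in \<open>auto simp: b_def f1_def\<close>)
  have "L2_inner G f + of_real ((L2_norm f1)\<^sup>2) = - of_real s"
    using E1 unfolding E2 E3 L2_inner_self .
  from arg_cong[OF this, of Re] have "Re (L2_inner G f) + (L2_norm f1)\<^sup>2 = - s" by simp
  then have E: "Re (L2_inner (\<lambda>x. - G x) f) = (L2_norm f1)\<^sup>2 + s"
    using L2_inner_cmult_left[of "-1" G f] by simp
  \<comment> \<open>All terms are nonpositive, so restricting the sum to fewer points can only
    increase it.\<close>
  have "s \<le> (\<Sum>n=N\<^sup>2..N\<^sup>2 + N. a n * (bump (pt n - real N))\<^sup>2)"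
  proof -
    have "{N\<^sup>2..N\<^sup>2 + N} \<subseteq> {1..m}" using N by (auto simp: m_def power2_eq_square)
    then have "(\<Sum>n\<in>{N\<^sup>2..N\<^sup>2 + N}. - (a n * (bump (pt n - real N))\<^sup>2)) \<le> (\<Sum>n=1..m. - (a n * (bump (pt n - real N))\<^sup>2))"
      using a by (intro sum_mono2) (auto simp: mult_nonpos_nonneg)
    then show ?thesis by (simp add: s_def sum_negf)
  qed
  also have "\<dots> \<le> (\<Sum>n=N\<^sup>2..N\<^sup>2 + N. a n * (27 / 64)\<^sup>2)"
  proof (rule sum_mono)
    fix n assume n: "n \<in> {N\<^sup>2..N\<^sup>2 + N}"
    then have n1: "n \<ge> 1" using N by (auto simp: power2_eq_square intro: order_trans[rotated])
    have nr: "(real N)\<^sup>2 \<le> real n" "real n \<le> (real N)\<^sup>2 + real N"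
      using n by (simp_all flip: of_nat_power of_nat_add)
    have "real N \<le> pt n" using nr(1) by (rule real_le_rsqrt)
    moreover have "pt n \<le> real N + 1 / 2"
      using nr(2) by (intro real_le_lsqrt) (auto simp: power2_eq_square algebra_simps)
    ultimately have "bump (pt n - real N) \<ge> 27 / 64" by (intro bump_bounds(7)) auto
    then have "(27 / 64)\<^sup>2 \<le> (bump (pt n - real N))\<^sup>2" by (intro power_mono) auto
    then show "a n * (bump (pt n - real N))\<^sup>2 \<le> a n * (27 / 64)\<^sup>2"
      using a(2)[OF n1] by (intro mult_left_mono_neg)
  qed
  also have "\<dots> = (27 / 64)\<^sup>2 * (\<Sum>n=N\<^sup>2..N\<^sup>2 + N. a n)"
    unfolding sum_distrib_right[symmetric] by (rule mult.commute)
  finally have "s \<le> (27 / 64)\<^sup>2 * (\<Sum>n=N\<^sup>2..N\<^sup>2 + N. a n)" .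
  moreover have "(L2_norm f1)\<^sup>2 \<le> 392" "(L2_norm f)\<^sup>2 \<le> 8" using f1L(2) fL(2) by auto
  ultimately show thesis using that[OF T] E by simp
qed

text \<open>The sum in the energy has N + 1 terms, each at most -N^(-2 \<epsilon>) / 2, while the
  norm stays bounded. The energy thus falls below a constant minus a multiple of N^(1 - 2
  \<epsilon>), whose exponent is positive exactly for \<epsilon> < 1/2.\<close>

theorem T_not_semibounded:
  assumes eps: "0 \<le> \<epsilon>" "\<epsilon> < 1 / 2"
    and a: "\<And>n. n \<ge> 1 \<Longrightarrow> a n = - (real n powr (- \<epsilon>))"
  shows "\<not> semibounded_below (T a)"
proof
  assume "semibounded_below (T a)"
  then obtain c where c: "\<And>f g. (f, g) \<in> T a \<Longrightarrow> Re (L2_inner g f) \<ge> c * (L2_norm f)\<^sup>2"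
    unfolding semibounded_below_def by blast
  have a1: "-1 \<le> a n" "a n \<le> 0" if "n \<ge> 1" for n
    using that eps powr_mono[of "- \<epsilon>" 0 "real n"] by (auto simp: a)
  have key: "(27 / 64)\<^sup>2 / 2 * real N powr (1 - 2 * \<epsilon>) \<le> 392 + \<bar>c\<bar> * 8" if N: "N \<ge> 2" for N :: nat
  proof -
    obtain f k where fk: "(f, k) \<in> T a" "(L2_norm f)\<^sup>2 \<le> 8"
      "Re (L2_inner k f) \<le> 392 + (27 / 64)\<^sup>2 * (\<Sum>n=N\<^sup>2..N\<^sup>2 + N. a n)"
      using test_function[of a N, OF a1 N] by blast
    have "- (\<bar>c\<bar> * 8) \<le> c * (L2_norm f)\<^sup>2"
    proof -
      have "\<bar>c * (L2_norm f)\<^sup>2\<bar> \<le> \<bar>c\<bar> * 8" unfolding abs_mult using fk(2) by (intro mult_left_mono) auto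
      then show ?thesis by linarith
    qed
    also have "\<dots> \<le> 392 + (27 / 64)\<^sup>2 * (\<Sum>n=N\<^sup>2..N\<^sup>2 + N. a n)" using c[OF fk(1)] fk(3) by linarith
    finally have 1: "- (\<bar>c\<bar> * 8) \<le> 392 + (27 / 64)\<^sup>2 * (\<Sum>n=N\<^sup>2..N\<^sup>2 + N. a n)" .
    \<comment> \<open>On this range n is at most 2 N^2; the factor 2 costs 2^(-\<epsilon>), which is
      at least 1/2.\<close>
    have le: "a n \<le> - (real N powr (- 2 * \<epsilon>) / 2)" if n: "n \<in> {N\<^sup>2..N\<^sup>2 + N}" for n
    proof -
      have "n \<le> 2 * N\<^sup>2" using n le_square[of N] unfolding power2_eq_square atLeastAtMost_iff by linarith
      then have "real n \<le> real (2 * N\<^sup>2)" by (rule of_nat_mono)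
      then have nle: "real n \<le> 2 * (real N)\<^sup>2" by simp
      have n1: "n \<ge> 1" using n N by (auto simp: power2_eq_square intro: order_trans[rotated])
      have "(2 * (real N)\<^sup>2) powr (- \<epsilon>) \<le> real n powr (- \<epsilon>)"
        using nle n1 eps by (intro powr_mono2') auto
      moreover have "(2 * (real N)\<^sup>2) powr (- \<epsilon>) = 2 powr (- \<epsilon>) * real N powr (- 2 * \<epsilon>)"
        using N by (simp add: powr_mult powr_powr flip: powr_numeral)
      moreover have "1 / 2 * real N powr (- 2 * \<epsilon>) \<le> 2 powr (- \<epsilon>) * real N powr (- 2 * \<epsilon>)"
      proof (rule mult_right_mono)
        have "2 powr (- 1 :: real) \<le> 2 powr (- \<epsilon>)" using eps by (intro powr_mono) auto
        then show "1 / 2 \<le> 2 powr (- \<epsilon>)" by (simp add: powr_minus_divide)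
      qed simp
      ultimately show ?thesis using a[OF n1] by linarith
    qed
    have "(\<Sum>n=N\<^sup>2..N\<^sup>2 + N. a n) \<le> (\<Sum>n=N\<^sup>2..N\<^sup>2 + N. - (real N powr (- 2 * \<epsilon>) / 2))"
      by (rule sum_mono) (rule le)
    also have "\<dots> = - (real (Suc N) * (real N powr (- 2 * \<epsilon>) / 2))" by simp
    also have "\<dots> \<le> - (real N * (real N powr (- 2 * \<epsilon>) / 2))"
      by (simp add: of_nat_Suc mult_right_mono)
    also have "real N * (real N powr (- 2 * \<epsilon>) / 2) = real N powr (1 - 2 * \<epsilon>) / 2"
      using N powr_add[of "real N" 1 "- 2 * \<epsilon>"] by simp
    finally have "(27 / 64)\<^sup>2 * (\<Sum>n=N\<^sup>2..N\<^sup>2 + N. a n) \<le> (27 / 64)\<^sup>2 * - (real N powr (1 - 2 * \<epsilon>) / 2)"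
      by (intro mult_left_mono) auto
    then show ?thesis using 1 by simp
  qed
  \<comment> \<open>\<open>Z\<close> exceeds 12 times the bound in \<open>key\<close>; the factor is
    chosen because 1/12 < (27/64)^2 / 2.\<close>
  define Z where "Z = (392 + \<bar>c\<bar> * 8 + 1) * 12"
  have Z: "Z > 0" by (simp add: Z_def add_pos_nonneg)
  obtain N :: nat where "max 2 (Z powr (1 / (1 - 2 * \<epsilon>))) < real N" using reals_Archimedean2 by blast
  then have N2: "N \<ge> 2" and "Z powr (1 / (1 - 2 * \<epsilon>)) < real N" by auto
  then have "(Z powr (1 / (1 - 2 * \<epsilon>))) powr (1 - 2 * \<epsilon>) < real N powr (1 - 2 * \<epsilon>)"
    using eps by (intro powr_less_mono2) auto
  then have "Z < real N powr (1 - 2 * \<epsilon>)" using Z eps by (simp add: powr_powr)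
  then have N: "(392 + \<bar>c\<bar> * 8 + 1) * 12 < real N powr (1 - 2 * \<epsilon>)" "N \<ge> 2"
    using N2 by (simp_all add: Z_def)
  have "(1 / 12) * real N powr (1 - 2 * \<epsilon>) \<le> (27 / 64)\<^sup>2 / 2 * real N powr (1 - 2 * \<epsilon>)"
    by (intro mult_right_mono) (auto simp: power2_eq_square)
  from order_trans[OF this key[OF N(2)]]
  have "real N powr (1 - 2 * \<epsilon>) \<le> (392 + \<bar>c\<bar> * 8) * 12" by simp
  then show False using N(1) by (simp add: algebra_simps)
qed

theorem proposition5p28:
  fixes x \<alpha> :: "nat \<Rightarrow> real" and \<epsilon> :: real
  assumes x: "\<And>n. n \<ge> 1 \<Longrightarrow> x n = sqrt (real n)"
    and \<epsilon>: "\<epsilon> \<in> {0..<1/2}"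
    and \<alpha>: "\<And>n. n \<ge> 1 \<Longrightarrow> \<alpha> n = - (real n powr (- \<epsilon>))"
  shows "self_adjoint (H_delta x \<alpha>) \<and> \<not> semibounded_below (H_delta x \<alpha>)"
proof -
  \<comment> \<open>The interaction set and the interface conditions refer to indices n >= 1, on
    which \<open>x\<close> and \<open>pt\<close> agree, so \<open>x\<close> may be replaced by
    \<open>pt\<close>.\<close>
  have "x ` {1..} = pt ` {1..}" by (rule image_cong) (auto simp: x)
  then have "delta_domain x \<alpha> = delta_domain pt \<alpha>"
    unfolding delta_domain_def interaction_set_def using x by simp
  then have H: "H_delta x \<alpha> = operator_closure (T \<alpha>)" by (simp add: H_delta_def)
  have "self_adjoint (operator_closure (T \<alpha>))"
    by (rule self_adjoint_operator_closureI[OF T_subset densely_defined_T T_symmetric adjoint_T_subset_closure])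
  \<comment> \<open>A lower bound for the closure would restrict to the smaller graph.\<close>
  moreover have "\<not> semibounded_below (operator_closure (T \<alpha>))"
    using T_not_semibounded[of \<epsilon> \<alpha>] \<epsilon> \<alpha> semibounded_below_mono[OF operator_closure_superset[OF T_subset]] by auto
  ultimately show ?thesis by (simp add: H)
qed

end
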